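(* Let $\kappa\in(0,\infty]$ and let $G$ be a single-input single-output linear time-invariant, bounded and causal system on $\ell^2$ (also acting on $\ell^{2e}$) with a finite-dimensional state-space representation. Let $\epsilon>0$ and suppose that there exists no $M\in\mathcal{H}_1$ such that $$\left\langle \begin{pmatrix} Gw\\ w\end{pmatrix},\ \Pi_M(0,\kappa)\begin{pmatrix} Gw\\ w\end{pmatrix}\right\rangle\le -\epsilon\|w\|^2\quad\text{for all } w\in \ell^2 .$$ Then there exist some $d\in\mathbb{N}$ and some $\Delta\in\mathbf{\Delta}_d(0,\kappa)$ such that the interconnection relation $R(\Delta)$ of $G\otimes I_d$ and $\Delta$ has gain at least $1/\sqrt{8\epsilon}$, i.e. $\|R(\Delta)\|\ge 1/\sqrt{8\epsilon}$ (the gain being $+\infty$ if $R(\Delta)$ is unbounded).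
   Context: Signals: $\ell^{2e}_d$ is the space of all sequences $x:\mathbb{N}_0\to\mathbb{R}^d$; $\ell^2_d$ is the subspace of square summable sequences with inner product $\langle x,y\rangle=\sum_{k\ge 0} x_k^\top y_k$; for $d=1$ the index is omitted. $P_Nx$ is the truncation $(P_Nx)_k=x_k$ for $k\le N$ and $0$ for $k>N$. $\otimes$ is the Kronecker product; $G\otimes I_d$ is the system on $\ell^{2e}_d$ acting as $G$ on each of the $d$ components. Multipliers: $\mathcal{H}$ is the set of infinite real Toeplitz matrices $M=(m_{i-j})_{i,j=0}^\infty$ that are doubly hyperdominant, i.e. $m_j\le 0$ for $j\ne 0$, the series $\sum_{j=-\infty}^\infty m_j$ converges, and $\sum_{j=-\infty}^\infty m_j\ge 0$. Each such $M$ acts as a bounded operator on $\ell^2$, with adjoint $M^*$. $\mathcal{H}_1=\{M\in\mathcal{H}: m_0\le 1\}$. With the convention $1/\infty=0$, $$\Pi_M(\lambda,\kappa)=\begin{pmatrix}-\lambda(M+M^* ) & M^*+\frac{\lambda}{\kappa}M\\ M+\frac{\lambda}{\kappa}M^* & -\frac1\kappa(M+M^* )\end{pmatrix},\qquad \Pi_M(0,\kappa)=\begin{pmatrix}0 & M^*\\ M & -\frac1\kappa(M+M^* )\end{pmatrix}.$$ Nonlinearities: A multifunction $f:\mathbb{R}^d\rightrightarrows\mathbb{R}^d$ is a relation $f\subseteq\mathbb{R}^d\times\mathbb{R}^d$, with $f(x)=\{y:(x,y)\in f\}$ and $\operatorname{dom}(f)=\{x: f(x)\neq\emptyset\}$;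 it is total if $\operatorname{dom}(f)=\mathbb{R}^d$. It is cyclically monotone if for all $n$, all $x_1,\dots,x_n\in\operatorname{dom}(f)$, $x_{n+1}=x_1$, and $y_j\in f(x_j)$ one has $\sum_{j=1}^n\langle y_j,x_{j+1}-x_j\rangle\le 0$. For $\lambda\in(-\infty,0]$, $\kappa\in(0,\infty]$ define the multifunction $T_{\lambda,\kappa,f}=(f-\lambda I)\circ(I-\frac1\kappa f)^{-1}$, i.e. $y\in T_{\lambda,\kappa,f}(x)$ iff there are $z\in\operatorname{dom}(f)$ and $u\in f(z)$ with $x=z-\frac1\kappa u$ and $y=u-\lambda z$. Write $f\in\operatorname{slope}_d[\lambda,\kappa]$ if $T_{\lambda,\kappa,f}$ is cyclically monotone. The static relation $\Delta_f\subseteq\ell^{2e}_d\times\ell^{2e}_d$ is defined by $(w,z)\in\Delta_f$ iff $z_k\in f(w_k)$ for all $k\in\mathbb{N}_0$. Finally $\mathbf{\Delta}_d(\lambda,\kappa)=\{\Delta_f : f\in\operatorname{slope}_d[\lambda,\kappa]\text{ total and }0\in f(0)\}$. Interconnection: for a linear system $\tilde G$ on $\ell^{2e}_d$ and a relation $\Delta\subseteq\ell^{2e}_d\times\ell^{2e}_d$, the interconnection relation $R(\Delta)$ is the set of pairs $(u,e)$, $u=(u_1,u_2)\in\ell^{2e}_{2d}$, $e=(e_1,e_2)\in\ell^{2e}_{2d}$, with $e_2=\tilde Ge_1+u_2$ and $(e_2,e_1-u_1)\in\Delta$. Here $\tilde G=G\otimes I_d$. The gain $\|R\|$ of a relation $R$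 is the infimum of all $\gamma\ge 0$ for which there is $\beta\in\mathbb{R}$ with $\|P_Ny\|\le\gamma\|P_Nx\|+\beta$ for all $(x,y)\in R$ and all $N\in\mathbb{N}_0$ ($\|R\|=\infty$ if there is no such $\gamma$). *)

theory Defs
  imports
    "Jordan_Normal_Form.Matrix"
    "HOL-Analysis.Infinite_Sum"
    "HOL-Library.Extended_Real"
begin

section \<open>Scalar signals\<close>

text \<open>A scalar signal is a function of type \<^typ>\<open>nat \<Rightarrow> real\<close>; the whole type plays the role of
  the extended space.\<close>

definition l2 :: "(nat \<Rightarrow> real) set" where
  "l2 = {x. summable (\<lambda>k. (x k)\<^sup>2)}"

definition l2_inner :: "(nat \<Rightarrow> real) \<Rightarrow> (nat \<Rightarrow> real) \<Rightarrow> real" where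
  "l2_inner x y = (\<Sum>k. x k * y k)"

definition l2_norm :: "(nat \<Rightarrow> real) \<Rightarrow> real" where
  "l2_norm x = sqrt (l2_inner x x)"

definition trunc :: "nat \<Rightarrow> (nat \<Rightarrow> real) \<Rightarrow> nat \<Rightarrow> real" where
  "trunc N x = (\<lambda>k. if k \<le> N then x k else 0)"

definition right_shift :: "(nat \<Rightarrow> real) \<Rightarrow> nat \<Rightarrow> real" where
  "right_shift x = case_nat 0 x"

text \<open>The adjoint is pinned down only on \<^const>\<open>l2\<close>; for the operators it is applied to below,
  its existence and its values there are established in lemma \<open>l2_adjoint_toeplitz\<close>.\<close>

definition l2_adjoint :: "((nat \<Rightarrow> real) \<Rightarrow> nat \<Rightarrow> real) \<Rightarrow> (nat \<Rightarrow> real) \<Rightarrow> nat \<Rightarrow> real" where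
  "l2_adjoint T = (SOME T'. \<forall>x\<in>l2. T' x \<in> l2 \<and> (\<forall>y\<in>l2. l2_inner (T y) x = l2_inner y (T' x)))"


section \<open>Linear time-invariant systems\<close>

definition linear_system :: "((nat \<Rightarrow> real) \<Rightarrow> nat \<Rightarrow> real) \<Rightarrow> bool" where
  "linear_system G \<longleftrightarrow>
     (\<forall>a b x y. G (\<lambda>k. a * x k + b * y k) = (\<lambda>k. a * G x k + b * G y k))"

definition time_invariant :: "((nat \<Rightarrow> real) \<Rightarrow> nat \<Rightarrow> real) \<Rightarrow> bool" where
  "time_invariant G \<longleftrightarrow> (\<forall>x. G (right_shift x) = right_shift (G x))"

definition causal :: "((nat \<Rightarrow> real) \<Rightarrow> nat \<Rightarrow> real) \<Rightarrow> bool" where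
  "causal G \<longleftrightarrow> (\<forall>N x. trunc N (G x) = trunc N (G (trunc N x)))"

definition l2_bounded :: "((nat \<Rightarrow> real) \<Rightarrow> nat \<Rightarrow> real) \<Rightarrow> bool" where
  "l2_bounded G \<longleftrightarrow> (\<exists>c. \<forall>x\<in>l2. G x \<in> l2 \<and> l2_norm (G x) \<le> c * l2_norm x)"

definition finite_dim_realizable :: "((nat \<Rightarrow> real) \<Rightarrow> nat \<Rightarrow> real) \<Rightarrow> bool" where
  "finite_dim_realizable G \<longleftrightarrow>
     (\<exists>n A b c D. A \<in> carrier_mat n n \<and> b \<in> carrier_vec n \<and> c \<in> carrier_vec n \<and>
        (\<forall>w. \<exists>x. x 0 = 0\<^sub>v n \<and>
           (\<forall>k. x (Suc k) = A *\<^sub>v x k + w k \<cdot>\<^sub>v b \<and>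
                G w k = scalar_prod c (x k) + D * w k)))"


section \<open>Multipliers\<close>

definition doubly_hyperdominant :: "(int \<Rightarrow> real) \<Rightarrow> bool" where
  "doubly_hyperdominant m \<longleftrightarrow>
     (\<forall>j. j \<noteq> 0 \<longrightarrow> m j \<le> 0) \<and> m summable_on UNIV \<and> (\<Sum>\<^sub>\<infinity>j. m j) \<ge> 0"

definition toeplitz :: "(int \<Rightarrow> real) \<Rightarrow> nat \<Rightarrow> nat \<Rightarrow> real" where
  "toeplitz m = (\<lambda>i j. m (int i - int j))"

definition multipliers :: "(nat \<Rightarrow> nat \<Rightarrow> real) set" where
  "multipliers = {toeplitz m | m. doubly_hyperdominant m}"

definition multipliers1 :: "(nat \<Rightarrow> nat \<Rightarrow> real) set" where
  "multipliers1 = {M \<in> multipliers. M 0 0 \<le> 1}"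

definition matrix_op :: "(nat \<Rightarrow> nat \<Rightarrow> real) \<Rightarrow> (nat \<Rightarrow> real) \<Rightarrow> nat \<Rightarrow> real" where
  "matrix_op M x = (\<lambda>i. \<Sum>j. M i j * x j)"

lemma toeplitz_row_summable:
  assumes m: "m summable_on (UNIV :: int set)"
  shows "(\<lambda>j. \<bar>toeplitz m i j\<bar>) summable_on UNIV"
    and "(\<Sum>\<^sub>\<infinity>j. \<bar>toeplitz m i j\<bar>) \<le> (\<Sum>\<^sub>\<infinity>k. \<bar>m k\<bar>)"
    and "(\<lambda>i. \<bar>toeplitz m i j\<bar>) summable_on UNIV"
    and "(\<Sum>\<^sub>\<infinity>i. \<bar>toeplitz m i j\<bar>) \<le> (\<Sum>\<^sub>\<infinity>k. \<bar>m k\<bar>)"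
proof -
  have abs: "(\<lambda>k. \<bar>m k\<bar>) summable_on UNIV"
    using iffD1[OF summable_on_iff_abs_summable_on_real m] by simp
  have *: "(\<lambda>j. \<bar>m (h j)\<bar>) summable_on UNIV \<and> (\<Sum>\<^sub>\<infinity>j. \<bar>m (h j)\<bar>) \<le> (\<Sum>\<^sub>\<infinity>k. \<bar>m k\<bar>)"
    if h: "inj h" for h :: "nat \<Rightarrow> int"
  proof -
    have s: "(\<lambda>k. \<bar>m k\<bar>) summable_on range h"
      using abs by (rule summable_on_subset_banach) simp
    have "(\<lambda>j. \<bar>m (h j)\<bar>) summable_on UNIV"
      using s summable_on_reindex[OF h, of "\<lambda>k. \<bar>m k\<bar>"] by (simp add: o_def)
    moreover have "(\<Sum>\<^sub>\<infinity>j. \<bar>m (h j)\<bar>) = (\<Sum>\<^sub>\<infinity>k\<in>range h. \<bar>m k\<bar>)"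
      using infsum_reindex[OF h, of "\<lambda>k. \<bar>m k\<bar>"] by (simp add: o_def)
    moreover have "\<dots> \<le> (\<Sum>\<^sub>\<infinity>k. \<bar>m k\<bar>)"
      using s abs by (intro infsum_mono2) auto
    ultimately show ?thesis by simp
  qed
  have "inj (\<lambda>j. int i - int j)" "inj (\<lambda>i. int i - int j)" by (auto simp: inj_def)
  from this[THEN *] show "(\<lambda>j. \<bar>toeplitz m i j\<bar>) summable_on UNIV"
    "(\<Sum>\<^sub>\<infinity>j. \<bar>toeplitz m i j\<bar>) \<le> (\<Sum>\<^sub>\<infinity>k. \<bar>m k\<bar>)"
    "(\<lambda>i. \<bar>toeplitz m i j\<bar>) summable_on UNIV"
    "(\<Sum>\<^sub>\<infinity>i. \<bar>toeplitz m i j\<bar>) \<le> (\<Sum>\<^sub>\<infinity>k. \<bar>m k\<bar>)"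
    by (simp_all add: toeplitz_def)
qed

lemma toeplitz_weight_summable:
  assumes m: "m summable_on (UNIV :: int set)" and x: "x \<in> l2"
  shows "(\<lambda>(i, j). \<bar>toeplitz m i j\<bar> * (x j)\<^sup>2) summable_on UNIV \<times> UNIV"
    and "(\<lambda>(i, j). \<bar>toeplitz m i j\<bar> * (x i)\<^sup>2) summable_on UNIV \<times> UNIV"
proof -
  let ?K = "\<Sum>\<^sub>\<infinity>k. \<bar>m k\<bar>"
  have x2: "(\<lambda>j. (x j)\<^sup>2) summable_on UNIV"
    using x by (simp add: l2_def summable_on_UNIV_nonneg_real_iff)
  then have Kx2: "(\<lambda>j. ?K * (x j)\<^sup>2) summable_on UNIV"
    by (rule summable_on_cmult_right)
  have *: "(\<lambda>(j, i). t j i * (x j)\<^sup>2) summable_on UNIV \<times> UNIV"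
    if t: "\<And>j. t j summable_on UNIV" "\<And>j. infsum (t j) UNIV \<le> ?K" "\<And>i j. t j i \<ge> 0"
    for t :: "nat \<Rightarrow> nat \<Rightarrow> real"
  proof (rule summable_on_SigmaI)
    show "((\<lambda>i. case (j, i) of (j, i) \<Rightarrow> t j i * (x j)\<^sup>2) has_sum infsum (t j) UNIV * (x j)\<^sup>2) UNIV" for j
      using has_sum_cmult_left[OF has_sum_infsum[OF t(1)]] by simp
    show "(\<lambda>j. infsum (t j) UNIV * (x j)\<^sup>2) summable_on UNIV"
      using Kx2 by (rule summable_on_comparison_test)
        (use t in \<open>auto intro!: mult_right_mono mult_nonneg_nonneg infsum_nonneg\<close>)
  qed (use t in auto)
  show "(\<lambda>(i, j). \<bar>toeplitz m i j\<bar> * (x i)\<^sup>2) summable_on UNIV \<times> UNIV"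
    by (rule *) (use toeplitz_row_summable[OF m] in auto)
  have "(\<lambda>(j, i). \<bar>toeplitz m i j\<bar> * (x j)\<^sup>2) summable_on UNIV \<times> UNIV"
    by (rule *) (use toeplitz_row_summable[OF m] in auto)
  then show "(\<lambda>(i, j). \<bar>toeplitz m i j\<bar> * (x j)\<^sup>2) summable_on UNIV \<times> UNIV"
    by (subst summable_on_swap) simp
qed

lemma toeplitz_row_prod_summable:
  assumes m: "m summable_on (UNIV :: int set)" and x: "x \<in> l2"
  shows "(\<lambda>j. toeplitz m i j * x j) summable_on UNIV"
    and "(\<lambda>j. \<bar>toeplitz m i j\<bar> * (x j)\<^sup>2) summable_on UNIV"
    and "matrix_op (toeplitz m) x i = (\<Sum>\<^sub>\<infinity>j. toeplitz m i j * x j)"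
proof -
  show 2: "(\<lambda>j. \<bar>toeplitz m i j\<bar> * (x j)\<^sup>2) summable_on UNIV"
    using summable_on_SigmaD1[OF toeplitz_weight_summable(1)[OF assms], of i] by simp
  have "(\<lambda>j. \<bar>toeplitz m i j\<bar> + \<bar>toeplitz m i j\<bar> * (x j)\<^sup>2) summable_on UNIV"
    by (intro summable_on_add toeplitz_row_summable[OF m] 2)
  then have "(\<lambda>j. norm (toeplitz m i j * x j)) summable_on UNIV"
  proof (rule summable_on_comparison_test)
    fix j
    have "\<bar>x j\<bar> \<le> 1 + (x j)\<^sup>2"
      using sum_squares_bound[of "\<bar>x j\<bar>" 1] abs_ge_zero[of "x j"] by (simp del: abs_ge_zero)
    from mult_left_mono[OF this, of "\<bar>toeplitz m i j\<bar>"]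
    show "norm (toeplitz m i j * x j) \<le> \<bar>toeplitz m i j\<bar> + \<bar>toeplitz m i j\<bar> * (x j)\<^sup>2"
      by (simp add: abs_mult algebra_simps)
  qed simp
  then show 1: "(\<lambda>j. toeplitz m i j * x j) summable_on UNIV"
    by (rule iffD2[OF summable_on_iff_abs_summable_on_real])
  show "matrix_op (toeplitz m) x i = (\<Sum>\<^sub>\<infinity>j. toeplitz m i j * x j)"
    unfolding matrix_op_def using has_sum_imp_sums[OF has_sum_infsum[OF 1]] by (simp add: sums_iff)
qed

lemma toeplitz_l2:
  assumes m: "m summable_on (UNIV :: int set)" and x: "x \<in> l2"
  shows "matrix_op (toeplitz m) x \<in> l2"
proof -
  define K where "K = (\<Sum>\<^sub>\<infinity>k. \<bar>m k\<bar>)"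
  have K: "K \<ge> 0" unfolding K_def by (simp add: infsum_nonneg)
  define q where "q = (\<lambda>i. \<Sum>\<^sub>\<infinity>j. \<bar>toeplitz m i j\<bar> * (x j)\<^sup>2)"
  have "q summable_on UNIV"
    unfolding q_def
    using summable_on_Sigma_banach[OF toeplitz_weight_summable(1)[OF assms]] by simp
  then have Kq: "(\<lambda>i. (K + 1) * q i) summable_on UNIV" by (rule summable_on_cmult_right)
  have "(\<lambda>i. (matrix_op (toeplitz m) x i)\<^sup>2) summable_on UNIV"
    using Kq
  proof (rule summable_on_comparison_test)
    fix i
    define u where "u = matrix_op (toeplitz m) x i"
    define t where "t = u / (K + 1)"
    have "2 * t * u = (\<Sum>\<^sub>\<infinity>j. 2 * t * (toeplitz m i j * x j))"
      unfolding u_def toeplitz_row_prod_summable(3)[OF assms]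
      by (rule infsum_cmult_right'[symmetric])
    also have "\<dots> \<le> (\<Sum>\<^sub>\<infinity>j. t\<^sup>2 * \<bar>toeplitz m i j\<bar> + \<bar>toeplitz m i j\<bar> * (x j)\<^sup>2)"
    proof (rule infsum_mono)
      fix j
      have "2 * t * (toeplitz m i j * x j) \<le> \<bar>toeplitz m i j\<bar> * \<bar>2 * t * x j\<bar>"
        by (metis abs_ge_self abs_mult mult.left_commute)
      also have "\<dots> \<le> \<bar>toeplitz m i j\<bar> * (t\<^sup>2 + (x j)\<^sup>2)"
        using sum_squares_bound[of "\<bar>t\<bar>" "\<bar>x j\<bar>"]
        by (intro mult_left_mono) (auto simp: abs_mult)
      finally show "2 * t * (toeplitz m i j * x j)
          \<le> t\<^sup>2 * \<bar>toeplitz m i j\<bar> + \<bar>toeplitz m i j\<bar> * (x j)\<^sup>2"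
        by (simp add: algebra_simps)
    qed (intro summable_on_add summable_on_cmult_right toeplitz_row_summable[OF m]
        toeplitz_row_prod_summable[OF assms])+
    also have "\<dots> = t\<^sup>2 * (\<Sum>\<^sub>\<infinity>j. \<bar>toeplitz m i j\<bar>) + q i"
      unfolding q_def
      by (subst infsum_add) (auto simp: infsum_cmult_right' intro!: summable_on_cmult_right
          toeplitz_row_summable[OF m] toeplitz_row_prod_summable[OF assms])
    also have "\<dots> \<le> t\<^sup>2 * (K + 1) + q i"
      using toeplitz_row_summable(2)[OF m, of i] by (auto simp: K_def intro!: mult_left_mono)
    finally have q: "2 * t * u - t\<^sup>2 * (K + 1) \<le> q i" by simp
    have "2 * t * u - t\<^sup>2 * (K + 1) = u\<^sup>2 / (K + 1)"
      using K unfolding t_def by (simp add: power2_eq_square divide_simps)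
    with q have "u\<^sup>2 / (K + 1) \<le> q i" by (rule subst[rotated])
    then show "u\<^sup>2 \<le> (K + 1) * q i"
      using K by (simp add: pos_divide_le_eq mult.commute)
  qed simp
  then show ?thesis
    unfolding l2_def by (simp add: summable_on_UNIV_nonneg_real_iff)
qed

lemma l2_inner_infsum:
  assumes "x \<in> l2" "y \<in> l2"
  shows "l2_inner x y = (\<Sum>\<^sub>\<infinity>k. x k * y k)"
proof -
  have "(\<lambda>k. (x k)\<^sup>2 + (y k)\<^sup>2) summable_on UNIV"
    using assms by (intro summable_on_add) (simp_all add: l2_def summable_on_UNIV_nonneg_real_iff)
  then have "(\<lambda>k. norm (x k * y k)) summable_on UNIV"
  proof (rule summable_on_comparison_test)
    fix k
    show "norm (x k * y k) \<le> (x k)\<^sup>2 + (y k)\<^sup>2"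
      using sum_squares_bound[of "\<bar>x k\<bar>" "\<bar>y k\<bar>"] mult_nonneg_nonneg[of "\<bar>x k\<bar>" "\<bar>y k\<bar>"]
      unfolding real_norm_def abs_mult power2_abs by linarith
  qed simp
  then have "(\<lambda>k. x k * y k) summable_on UNIV"
    by (rule iffD2[OF summable_on_iff_abs_summable_on_real])
  from has_sum_imp_sums[OF has_sum_infsum[OF this]] show ?thesis
    by (simp add: l2_inner_def sums_iff)
qed

lemma toeplitz_adjoint:
  assumes m: "m summable_on (UNIV :: int set)" and x: "x \<in> l2" and y: "y \<in> l2"
  shows "l2_inner (matrix_op (toeplitz m) y) x = l2_inner y (matrix_op (toeplitz (\<lambda>k. m (- k))) x)"
proof -
  let ?m' = "\<lambda>k. m (- k)"
  have m': "?m' summable_on UNIV"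
    using summable_on_reindex_bij_betw[of "uminus :: int \<Rightarrow> int" UNIV UNIV m] m
    by (simp add: bij_uminus)
  have tr: "toeplitz ?m' j i = toeplitz m i j" for i j by (simp add: toeplitz_def)
  have "(\<lambda>p. (case p of (i, j) \<Rightarrow> \<bar>toeplitz m i j\<bar> * (y j)\<^sup>2)
      + (case p of (i, j) \<Rightarrow> \<bar>toeplitz m i j\<bar> * (x i)\<^sup>2)) summable_on UNIV \<times> UNIV"
    by (intro summable_on_add toeplitz_weight_summable m x y)
  then have "(\<lambda>p. norm (case p of (i, j) \<Rightarrow> toeplitz m i j * y j * x i)) summable_on UNIV \<times> UNIV"
  proof (rule summable_on_comparison_test)
    fix p :: "nat \<times> nat"
    obtain i j where p: "p = (i, j)" by fastforce
    have "\<bar>y j\<bar> * \<bar>x i\<bar> \<le> (y j)\<^sup>2 + (x i)\<^sup>2"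
      using sum_squares_bound[of "\<bar>y j\<bar>" "\<bar>x i\<bar>"] mult_nonneg_nonneg[of "\<bar>y j\<bar>" "\<bar>x i\<bar>"]
      unfolding power2_abs by linarith
    from mult_left_mono[OF this, of "\<bar>toeplitz m i j\<bar>"]
    show "norm (case p of (i, j) \<Rightarrow> toeplitz m i j * y j * x i)
      \<le> (case p of (i, j) \<Rightarrow> \<bar>toeplitz m i j\<bar> * (y j)\<^sup>2)
      + (case p of (i, j) \<Rightarrow> \<bar>toeplitz m i j\<bar> * (x i)\<^sup>2)"
      by (simp add: p abs_mult algebra_simps)
  qed simp
  then have S: "(\<lambda>(i, j). toeplitz m i j * y j * x i) summable_on UNIV \<times> UNIV"
    by (rule iffD2[OF summable_on_iff_abs_summable_on_real])
  have "l2_inner (matrix_op (toeplitz m) y) x = (\<Sum>\<^sub>\<infinity>i. (\<Sum>\<^sub>\<infinity>j. toeplitz m i j * y j) * x i)"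
    by (simp add: l2_inner_infsum toeplitz_l2 toeplitz_row_prod_summable(3) m x y)
  also have "\<dots> = (\<Sum>\<^sub>\<infinity>i. \<Sum>\<^sub>\<infinity>j. toeplitz m i j * y j * x i)"
    by (simp add: infsum_cmult_left')
  also have "\<dots> = (\<Sum>\<^sub>\<infinity>j. \<Sum>\<^sub>\<infinity>i. toeplitz m i j * y j * x i)"
    by (rule infsum_swap_banach) (use S in simp)
  also have "\<dots> = (\<Sum>\<^sub>\<infinity>j. \<Sum>\<^sub>\<infinity>i. y j * (toeplitz ?m' j i * x i))"
    by (simp add: tr mult_ac)
  also have "\<dots> = (\<Sum>\<^sub>\<infinity>j. y j * (\<Sum>\<^sub>\<infinity>i. toeplitz ?m' j i * x i))"
    by (simp add: infsum_cmult_right')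
  also have "\<dots> = l2_inner y (matrix_op (toeplitz ?m') x)"
    by (simp add: l2_inner_infsum toeplitz_l2 toeplitz_row_prod_summable(3) m' x y)
  finally show ?thesis .
qed

lemma l2_adjoint_toeplitz:
  assumes m: "doubly_hyperdominant m" and x: "x \<in> l2"
  shows "l2_adjoint (matrix_op (toeplitz m)) x = matrix_op (toeplitz (\<lambda>k. m (- k))) x"
proof -
  let ?T = "matrix_op (toeplitz m)" and ?T' = "matrix_op (toeplitz (\<lambda>k. m (- k)))"
  let ?P = "\<lambda>T'. \<forall>x\<in>l2. T' x \<in> l2 \<and> (\<forall>y\<in>l2. l2_inner (?T y) x = l2_inner y (T' x))"
  have m1: "m summable_on UNIV" using m by (simp add: doubly_hyperdominant_def)
  have "(\<lambda>k. m (- k)) summable_on UNIV"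
    using summable_on_reindex_bij_betw[of "uminus :: int \<Rightarrow> int" UNIV UNIV m] m1
    by (simp add: bij_uminus)
  then have "?P ?T'" using toeplitz_l2 toeplitz_adjoint[OF m1] by blast
  moreover from this have "?P (l2_adjoint ?T)"
    unfolding l2_adjoint_def by (rule someI[of ?P])
  ultimately have eq: "l2_inner y (l2_adjoint ?T x) = l2_inner y (?T' x)" if "y \<in> l2" for y
    using x that by metis
  show ?thesis
  proof
    fix k
    let ?e = "\<lambda>i::nat. if i = k then 1 else 0 :: real"
    have e: "l2_inner ?e z = z k" for z
      unfolding l2_inner_def using suminf_finite[of "{k}" "\<lambda>i. ?e i * z i"] by simp
    have "?e \<in> l2"
      unfolding l2_def using summable_finite[of "{k}" "\<lambda>i. (?e i)\<^sup>2"] by simp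
    from eq[OF this] show "l2_adjoint ?T x k = ?T' x k" by (simp add: e)
  qed
qed

text \<open>In \<^typ>\<open>ereal\<close> one has \<open>1 / \<infinity> = 0\<close>.\<close>

abbreviation recip :: "ereal \<Rightarrow> real" where
  "recip \<kappa> \<equiv> real_of_ereal (1 / \<kappa>)"

definition Pi_mult :: "(nat \<Rightarrow> nat \<Rightarrow> real) \<Rightarrow> real \<Rightarrow> ereal \<Rightarrow>
    (nat \<Rightarrow> real) \<times> (nat \<Rightarrow> real) \<Rightarrow> (nat \<Rightarrow> real) \<times> (nat \<Rightarrow> real)" where
  "Pi_mult M lam \<kappa> = (\<lambda>(a, b).
     let T = matrix_op M; T' = l2_adjoint (matrix_op M) in
       (\<lambda>k. - lam * (T a k + T' a k) + (T' b k + lam * recip \<kappa> * T b k),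
        \<lambda>k. (T a k + lam * recip \<kappa> * T' a k) - recip \<kappa> * (T b k + T' b k)))"

definition l2_inner_pair ::
    "(nat \<Rightarrow> real) \<times> (nat \<Rightarrow> real) \<Rightarrow> (nat \<Rightarrow> real) \<times> (nat \<Rightarrow> real) \<Rightarrow> real" where
  "l2_inner_pair p q = l2_inner (fst p) (fst q) + l2_inner (snd p) (snd q)"


section \<open>Vector-valued signals\<close>

definition l2e_vec :: "nat \<Rightarrow> (nat \<Rightarrow> real vec) set" where
  "l2e_vec d = {x. \<forall>k. x k \<in> carrier_vec d}"

definition trunc_vec :: "nat \<Rightarrow> (nat \<Rightarrow> real vec) \<Rightarrow> nat \<Rightarrow> real vec" where
  "trunc_vec N x = (\<lambda>k. if k \<le> N then x k else 0\<^sub>v (dim_vec (x k)))"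

definition l2_inner_vec :: "(nat \<Rightarrow> real vec) \<Rightarrow> (nat \<Rightarrow> real vec) \<Rightarrow> real" where
  "l2_inner_vec x y = (\<Sum>k. scalar_prod (x k) (y k))"

definition l2_norm_vec :: "(nat \<Rightarrow> real vec) \<Rightarrow> real" where
  "l2_norm_vec x = sqrt (l2_inner_vec x x)"

definition kron_id :: "((nat \<Rightarrow> real) \<Rightarrow> nat \<Rightarrow> real) \<Rightarrow> nat \<Rightarrow> (nat \<Rightarrow> real vec) \<Rightarrow> nat \<Rightarrow> real vec" where
  "kron_id G d x = (\<lambda>k. vec d (\<lambda>i. G (\<lambda>t. x t $ i) k))"


section \<open>Slope-restricted multifunctions\<close>

definition total_multi :: "nat \<Rightarrow> (real vec \<times> real vec) set \<Rightarrow> bool" where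
  "total_multi d f \<longleftrightarrow> Domain f = carrier_vec d"

definition cyclically_monotone :: "(real vec \<times> real vec) set \<Rightarrow> bool" where
  "cyclically_monotone f \<longleftrightarrow>
     (\<forall>(n::nat) x y. (\<forall>j\<in>{1..n}. (x j, y j) \<in> f) \<and> x (n + 1) = x 1 \<longrightarrow>
        (\<Sum>j = 1..n. scalar_prod (y j) (x (j + 1) - x j)) \<le> 0)"

definition T_multi :: "real \<Rightarrow> ereal \<Rightarrow> (real vec \<times> real vec) set \<Rightarrow> (real vec \<times> real vec) set" where
  "T_multi lam \<kappa> f = {(x, y). \<exists>z u. (z, u) \<in> f \<and> x = z - recip \<kappa> \<cdot>\<^sub>v u \<and> y = u - lam \<cdot>\<^sub>v z}"

definition slope :: "nat \<Rightarrow> real \<Rightarrow> ereal \<Rightarrow> (real vec \<times> real vec) set set" where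
  "slope d lam \<kappa> =
     {f. f \<subseteq> carrier_vec d \<times> carrier_vec d \<and> cyclically_monotone (T_multi lam \<kappa> f)}"

definition static_relation ::
    "nat \<Rightarrow> (real vec \<times> real vec) set \<Rightarrow> ((nat \<Rightarrow> real vec) \<times> (nat \<Rightarrow> real vec)) set" where
  "static_relation d f = {(w, z) \<in> l2e_vec d \<times> l2e_vec d. \<forall>k. (w k, z k) \<in> f}"

definition Delta_class ::
    "nat \<Rightarrow> real \<Rightarrow> ereal \<Rightarrow> ((nat \<Rightarrow> real vec) \<times> (nat \<Rightarrow> real vec)) set set" where
  "Delta_class d lam \<kappa> =
     {static_relation d f | f. f \<in> slope d lam \<kappa> \<and> total_multi d f \<and> (0\<^sub>v d, 0\<^sub>v d) \<in> f}"


section \<open>Interconnections and gain\<close>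

definition interconnection ::
    "nat \<Rightarrow> ((nat \<Rightarrow> real vec) \<Rightarrow> nat \<Rightarrow> real vec) \<Rightarrow> ((nat \<Rightarrow> real vec) \<times> (nat \<Rightarrow> real vec)) set \<Rightarrow>
     ((nat \<Rightarrow> real vec) \<times> (nat \<Rightarrow> real vec)) set" where
  "interconnection d G \<Delta> =
     {(\<lambda>k. u1 k @\<^sub>v u2 k, \<lambda>k. e1 k @\<^sub>v e2 k) | u1 u2 e1 e2.
        u1 \<in> l2e_vec d \<and> u2 \<in> l2e_vec d \<and> e1 \<in> l2e_vec d \<and> e2 \<in> l2e_vec d \<and>
        e2 = (\<lambda>k. G e1 k + u2 k) \<and> (e2, \<lambda>k. e1 k - u1 k) \<in> \<Delta>}"

text \<open>The infimum of the empty set in \<^typ>\<open>ereal\<close> is \<open>\<infinity>\<close>.\<close>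

definition gain :: "((nat \<Rightarrow> real vec) \<times> (nat \<Rightarrow> real vec)) set \<Rightarrow> ereal" where
  "gain R = Inf {ereal \<gamma> | \<gamma>. \<gamma> \<ge> 0 \<and>
     (\<exists>\<beta>. \<forall>(x, y)\<in>R. \<forall>N.
        l2_norm_vec (trunc_vec N y) \<le> \<gamma> * l2_norm_vec (trunc_vec N x) + \<beta>)}"

end

theory Submission
  imports Defs "Jordan_Normal_Form.Determinant"
    "HOL-Analysis.Function_Topology"
    "HOL-Analysis.Uniform_Limit" "HOL-Computational_Algebra.Fundamental_Theorem_Algebra"
begin

unbundle no vec_syntax
hide_type (open) Finite_Cartesian_Product.vec
hide_const (open) Finite_Cartesian_Product.mat Finite_Cartesian_Product.vec Finite_Cartesian_Product.row

text \<open>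
  Write \<open>c = 1/\<kappa>\<close> and \<open>z = G w - c w\<close>; the multiplier inequality reads \<open>2\<langle>w, M z\<rangle> \<le> - \<epsilon> |w|\<^sup>2\<close>. If no
  multiplier satisfies it for all \<open>w\<close>, then compactness of the set of multipliers and a minimax
  argument yield one finite tuple of finitely supported signals (a vector signal \<open>v\<close>) such that
  \<open>2\<langle>v, M z\<rangle> > - \<epsilon> |v|\<^sup>2\<close> for all \<open>M\<close>; for \<open>M = I\<close> and \<open>M = I - S\<^sup>j\<close> this says that the correlation
  \<open>r(j)\<close> of \<open>v\<close> and \<open>z\<close> nearly satisfies \<open>r(0) \<ge> r(j)\<close> and \<open>r(0) \<ge> 0\<close>.

  Since a stable finite-dimensional \<open>G\<close> has an absolutely summable impulse response, \<open>v\<close> may be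
  periodized with a long period \<open>T\<close>. Stacking all \<open>T\<close> cyclic shifts of \<open>v\<close> into one vector signal
  \<open>y\<^sub>k\<close>, with response \<open>x\<^sub>k\<close>, makes the pairing \<open>\<langle>y\<^sub>k, x\<^sub>l\<rangle>\<close> a function of \<open>k - l\<close> mod \<open>T\<close>, so shift
  inequalities become cyclic monotonicity. The defect \<open>\<epsilon>\<close> is repaired by \<open>T\<close> additional orthogonal
  components of energy \<open>\<epsilon> |v|\<^sup>2\<close>, fed in through the external inputs; these inputs therefore carry a
  fraction of at most \<open>8\<epsilon>\<close> of the energy of the loop signals.
\<close>

section \<open>Impulse responses\<close>

definition geometrically_bounded :: "(nat \<Rightarrow> 'a::real_normed_vector) \<Rightarrow> bool" where
  "geometrically_bounded g \<longleftrightarrow> (\<exists>C r. 0 < r \<and> r < 1 \<and> (\<forall>k. norm (g k) \<le> C * r ^ k))"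

lemma geometrically_bounded_summable:
  assumes "geometrically_bounded g"
  shows "summable (\<lambda>k. norm (g k))"
proof -
  obtain C r where r: "0 < r" "r < 1" and le: "\<And>k. norm (g k) \<le> C * r ^ k"
    using assms unfolding geometrically_bounded_def by blast
  have "summable (\<lambda>k. C * r ^ k)" using r by (intro summable_mult summable_geometric) auto
  then show ?thesis by (rule summable_comparison_test') (use le in auto)
qed

lemma geometrically_bounded_of_stable_step:
  fixes g u :: "nat \<Rightarrow> complex"
  assumes lam: "norm lam < 1" and step: "\<And>k. g (Suc k) = lam * g k + u k"
    and u: "geometrically_bounded u"
  shows "geometrically_bounded g"
proof -
  obtain C r where r: "0 < r" "r < 1" and le: "\<And>k. norm (u k) \<le> C * r ^ k"
    using u unfolding geometrically_bounded_def by blast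
  \<comment> \<open>A rate strictly above both \<open>r\<close> and \<open>norm lam\<close> leaves
    the gap \<open>s - norm lam\<close>; \<open>D\<close> is chosen so that
    \<open>D * (s - norm lam)\<close> absorbs the forcing term in every step.\<close>
  define s where "s = (max r (norm lam) + 1) / 2"
  have s: "0 < s" "s < 1" "r < s" "norm lam < s" using r lam unfolding s_def by auto
  have C: "C \<ge> 0" using order_trans[OF norm_ge_zero le[of 0]] by simp
  define D where "D = max (norm (g 0)) (C / (s - norm lam))"
  have D: "D \<ge> 0" "norm (g 0) \<le> D" unfolding D_def by (auto simp: le_max_iff_disj)
  have "C \<le> D * (s - norm lam)"
    using s unfolding D_def by (simp add: pos_divide_le_eq[symmetric])
  have "norm (g k) \<le> D * s ^ k" for k
  proof (induction k)
    case (Suc k)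
    have "norm (g (Suc k)) \<le> norm lam * norm (g k) + norm (u k)"
      unfolding step by (metis norm_mult norm_triangle_ineq)
    also have "\<dots> \<le> norm lam * (D * s ^ k) + C * s ^ k"
      using Suc r s C by (intro add_mono mult_left_mono order_trans[OF le] power_mono) auto
    also have "\<dots> \<le> norm lam * (D * s ^ k) + (D * (s - norm lam)) * s ^ k"
      using \<open>C \<le> _\<close> s by (intro add_left_mono mult_right_mono) auto
    also have "\<dots> = D * s ^ Suc k" by (simp add: algebra_simps)
    finally show ?case .
  qed (use D in simp)
  then show ?thesis using s unfolding geometrically_bounded_def by blast
qed

text \<open>Because \<open>g\<close> tends to 0, the recursion can be solved backwards from
  infinity, where dividing by \<open>lam\<close> does not amplify. So \<open>g k\<close> is bounded
  by the tail sum of \<open>u\<close>, which is again geometric.\<close>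

lemma geometrically_bounded_of_unstable_step:
  fixes g u :: "nat \<Rightarrow> complex"
  assumes lam: "norm lam \<ge> 1" and step: "\<And>k. g (Suc k) = lam * g k + u k"
    and u: "geometrically_bounded u" and g: "g \<longlonglongrightarrow> 0"
  shows "geometrically_bounded g"
proof -
  obtain C r where r: "0 < r" "r < 1" and le: "\<And>k. norm (u k) \<le> C * r ^ k"
    using u unfolding geometrically_bounded_def by blast
  have C: "C \<ge> 0" using order_trans[OF norm_ge_zero le[of 0]] by simp
  have bk: "norm (g k) \<le> norm (g (Suc k)) + norm (u k)" for k
  proof -
    have "norm (g k) \<le> norm (lam * g k)"
      using lam mult_right_mono[of 1 "norm lam" "norm (g k)"] by (simp add: norm_mult)
    also have "lam * g k = g (Suc k) - u k" by (simp add: step)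
    also have "norm \<dots> \<le> norm (g (Suc k)) + norm (u k)" by (rule norm_triangle_ineq4)
    finally show ?thesis .
  qed
  \<comment> \<open>\<open>D * r ^ k\<close> is the tail sum of \<open>C * r ^ j\<close> over
    \<open>j \<ge> k\<close>; in \<open>fin\<close> the part beyond \<open>k + m\<close> is
    subtracted.\<close>
  define D where "D = C / (1 - r)"
  have DC: "C = D * (1 - r)" using r by (simp add: D_def)
  have fin: "norm (g k) \<le> norm (g (k + m)) + D * r ^ k - D * r ^ (k + m)" for k m
  proof (induction m)
    case (Suc m)
    have "norm (g (k + m)) \<le> norm (g (k + Suc m)) + C * r ^ (k + m)"
      using bk[of "k + m"] le[of "k + m"] by simp
    with Suc show ?case unfolding DC by (simp add: algebra_simps)
  qed simp
  have "norm (g k) \<le> D * r ^ k" for k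
  proof (rule tendsto_lowerbound)
    have "(\<lambda>m. norm (g (m + k)) + D * r ^ k) \<longlonglongrightarrow> norm (0::complex) + D * r ^ k"
      by (intro tendsto_intros LIMSEQ_ignore_initial_segment g)
    then show "(\<lambda>m. norm (g (k + m)) + D * r ^ k) \<longlonglongrightarrow> D * r ^ k" by (simp add: add.commute)
    have "D \<ge> 0" using C r by (simp add: D_def)
    then show "\<forall>\<^sub>F m in sequentially. norm (g k) \<le> norm (g (k + m)) + D * r ^ k"
      using r by (intro always_eventually allI) (use fin in \<open>smt (verit) mult_nonneg_nonneg zero_le_power\<close>)
  qed simp
  then show ?thesis using r unfolding geometrically_bounded_def by blast
qed

text \<open>The polynomial \<open>p\<close> in the forward shift, applied to \<open>g\<close>. A
  linear factor of \<open>p\<close> then splits off as a first-order recursion.\<close>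

definition shift_poly :: "complex poly \<Rightarrow> (nat \<Rightarrow> complex) \<Rightarrow> nat \<Rightarrow> complex" where
  "shift_poly p g k = (\<Sum>i\<le>degree p. coeff p i * g (k + i))"

lemma shift_poly_bound:
  assumes "degree p \<le> N"
  shows "shift_poly p g k = (\<Sum>i\<le>N. coeff p i * g (k + i))"
  unfolding shift_poly_def
  by (rule sum.mono_neutral_left) (use assms in \<open>auto simp: coeff_eq_0\<close>)

lemma shift_poly_linear_factor:
  "shift_poly ([:- lam, 1:] * q) g k = shift_poly q g (Suc k) - lam * shift_poly q g k"
proof -
  have deg: "degree ([:- lam, 1:] * q) \<le> Suc (degree q)"
    using degree_mult_le[of "[:- lam, 1:]" q] by simp
  have "[:- lam, 1:] * q = pCons 0 q - smult lam q" by simp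
  then have co: "coeff ([:- lam, 1:] * q) i = (case i of 0 \<Rightarrow> 0 | Suc j \<Rightarrow> coeff q j) - lam * coeff q i" for i
    by (simp only: coeff_diff coeff_pCons coeff_smult)
  have "shift_poly ([:- lam, 1:] * q) g k
      = (\<Sum>i\<le>Suc (degree q). (case i of 0 \<Rightarrow> 0 | Suc j \<Rightarrow> coeff q j) * g (k + i))
        - lam * (\<Sum>i\<le>Suc (degree q). coeff q i * g (k + i))"
    unfolding shift_poly_bound[OF deg] co
    by (simp only: left_diff_distrib sum_subtractf sum_distrib_left mult.assoc)
  also have "(\<Sum>i\<le>Suc (degree q). coeff q i * g (k + i)) = shift_poly q g k"
    by (rule shift_poly_bound[symmetric]) simp
  also have "(\<Sum>i\<le>Suc (degree q). (case i of 0 \<Rightarrow> 0 | Suc j \<Rightarrow> coeff q j) * g (k + i))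
      = shift_poly q g (Suc k)"
    unfolding shift_poly_def by (subst sum.atMost_Suc_shift) simp
  finally show ?thesis .
qed

text \<open>Induction peels off one root \<open>lam\<close> of \<open>p\<close>: the sequence
  belonging to the cofactor obeys a first-order recursion with multiplier \<open>lam\<close> and
  geometric forcing. Convergence of \<open>g\<close> to 0 takes care of roots of modulus at least 1,
  which hidden modes of a realization can contribute.\<close>

lemma geometrically_bounded_of_recurrence:
  assumes "p \<noteq> 0" and "g \<longlonglongrightarrow> 0" and "geometrically_bounded (shift_poly p g)"
  shows "geometrically_bounded g"
  using assms
proof (induction "degree p" arbitrary: p)
  case 0
  then obtain a where p: "p = [:a:]" "a \<noteq> 0" by (metis degree_eq_zeroE pCons_0_0)
  obtain C r where r: "0 < r" "r < 1" and le: "\<And>k. norm (shift_poly p g k) \<le> C * r ^ k"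
    using 0 unfolding geometrically_bounded_def by blast
  have "norm (g k) \<le> (C / norm a) * r ^ k" for k
    using le[of k] p by (simp add: shift_poly_def norm_mult field_simps)
  then show ?case using r unfolding geometrically_bounded_def by blast
next
  case (Suc n)
  then have "\<not> constant (poly p)" by (simp add: constant_degree)
  then obtain lam where "poly p lam = 0" using fundamental_theorem_of_algebra by blast
  then obtain q where q: "p = [:- lam, 1:] * q" unfolding poly_eq_0_iff_dvd by (auto simp: dvd_def)
  have q0: "q \<noteq> 0" using Suc.prems(1) q by auto
  then have deg: "n = degree q" using Suc.hyps(2) unfolding q by (subst (asm) degree_mult_eq) auto
  define g' where "g' = shift_poly q g"
  have step: "g' (Suc k) = lam * g' k + shift_poly p g k" for k
    unfolding q g'_def shift_poly_linear_factor by simp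
  have "(\<lambda>k. \<Sum>i\<le>degree q. coeff q i * g (k + i)) \<longlonglongrightarrow> (\<Sum>i\<le>degree q. coeff q i * 0)"
    by (intro tendsto_intros LIMSEQ_ignore_initial_segment Suc.prems(2))
  then have g'0: "g' \<longlonglongrightarrow> 0" unfolding g'_def shift_poly_def by simp
  have "geometrically_bounded g'"
    using geometrically_bounded_of_stable_step[OF _ step Suc.prems(3)]
      geometrically_bounded_of_unstable_step[OF _ step Suc.prems(3) g'0]
    by (cases "norm lam < 1") auto
  then show ?case using Suc.hyps(1)[OF deg q0 Suc.prems(2)] unfolding g'_def by simp
qed

text \<open>Any \<open>n + 1\<close> vectors in dimension \<open>n\<close> are linearly dependent,
  and applying \<open>A\<close> carries the relation to all later times. This takes the place of the
  Cayley-Hamilton theorem.\<close>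

lemma krylov_dependence:
  fixes A :: "real mat"
  assumes A: "A \<in> carrier_mat n n" and x: "\<And>k. x k \<in> carrier_vec n"
    and step: "\<And>k. x (Suc k) = A *\<^sub>v x k"
  obtains \<alpha> where "\<exists>i\<le>n. \<alpha> i \<noteq> 0"
    and "\<And>c k. c \<in> carrier_vec n \<Longrightarrow> (\<Sum>i\<le>n. \<alpha> i * scalar_prod c (x (k + i))) = 0"
proof -
  \<comment> \<open>The states are the columns; a zero row is appended to make the matrix square, so
    that its vanishing determinant yields a kernel vector.\<close>
  define B where "B = mat (Suc n) (Suc n) (\<lambda>(j, i). if j < n then x i $ j else 0)"
  have B: "B \<in> carrier_mat (Suc n) (Suc n)" by (simp add: B_def)
  have "B = mat\<^sub>r (Suc n) (Suc n) (\<lambda>i. if i = n then 0\<^sub>v (Suc n) else row B i)"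
    by (intro eq_matI) (auto simp: B_def)
  moreover have "det (mat\<^sub>r (Suc n) (Suc n) (\<lambda>i. if i = n then 0\<^sub>v (Suc n) else row B i)) = 0"
    by (rule det_row_0) (auto simp: B_def)
  ultimately have "det B = 0" by metis
  then obtain v where v: "v \<in> carrier_vec (Suc n)" "v \<noteq> 0\<^sub>v (Suc n)" "B *\<^sub>v v = 0\<^sub>v (Suc n)"
    using det_0_iff_vec_prod_zero_field[OF B] by blast
  have nz: "\<exists>i\<le>n. v $ i \<noteq> 0"
  proof (rule ccontr)
    assume "\<not> ?thesis"
    then have "v = 0\<^sub>v (Suc n)" using v(1) by (intro eq_vecI) (auto simp: less_Suc_eq_le)
    with v(2) show False by simp
  qed
  have comp: "(\<Sum>i\<le>n. v $ i * (x (k + i) $ j)) = 0" if "j < n" for j k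
    using that
  proof (induction k arbitrary: j)
    case 0
    have "(B *\<^sub>v v) $ j = 0" using v(3) 0 by simp
    then have "(\<Sum>i\<in>{0..<Suc n}. x i $ j * v $ i) = 0"
      using 0 v(1) by (simp add: scalar_prod_def B_def mult_mat_vec_def)
    then show ?case by (simp add: atLeast0LessThan lessThan_Suc_atMost mult.commute)
  next
    case (Suc k)
    have "x (Suc k + i) $ j = (\<Sum>l<n. A $$ (j, l) * x (k + i) $ l)" for i
      using Suc.prems A x[of "k + i"] by (simp add: step scalar_prod_def atLeast0LessThan)
    then have "(\<Sum>i\<le>n. v $ i * (x (Suc k + i) $ j))
        = (\<Sum>i\<le>n. \<Sum>l<n. A $$ (j, l) * (v $ i * x (k + i) $ l))"
      by (simp add: sum_distrib_left mult_ac)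
    also have "\<dots> = (\<Sum>l<n. A $$ (j, l) * (\<Sum>i\<le>n. v $ i * x (k + i) $ l))"
      by (subst sum.swap) (simp add: sum_distrib_left)
    also have "\<dots> = 0" using Suc.IH by simp
    finally show ?case .
  qed
  have "(\<Sum>i\<le>n. v $ i * scalar_prod c (x (k + i))) = 0" if c: "c \<in> carrier_vec n" for c k
  proof -
    have "(\<Sum>i\<le>n. v $ i * scalar_prod c (x (k + i)))
        = (\<Sum>i\<le>n. \<Sum>j<n. c $ j * (v $ i * (x (k + i) $ j)))"
      by (simp add: scalar_prod_def atLeast0LessThan sum_distrib_left mult_ac carrier_vecD[OF x])
    also have "\<dots> = (\<Sum>j<n. c $ j * (\<Sum>i\<le>n. v $ i * (x (k + i) $ j)))"
      by (subst sum.swap) (simp add: sum_distrib_left)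
    also have "\<dots> = 0" using comp by simp
    finally show ?thesis .
  qed
  with nz show thesis by (rule that)
qed

section \<open>Impulse response and convolution form\<close>

definition delta :: "nat \<Rightarrow> nat \<Rightarrow> real" where
  "delta j = (\<lambda>i. if i = j then 1 else 0)"

lemma finite_support_l2: "(\<And>k. k \<ge> n \<Longrightarrow> w k = 0) \<Longrightarrow> w \<in> l2"
  unfolding l2_def mem_Collect_eq by (rule summable_finite[of "{..<n}"]) auto

lemma delta_l2: "delta j \<in> l2"
  by (rule finite_support_l2[of "Suc j"]) (simp add: delta_def)

lemma l2_tendsto_0:
  assumes "x \<in> l2" shows "x \<longlonglongrightarrow> 0"
proof -
  have "(\<lambda>k. (x k)\<^sup>2) \<longlonglongrightarrow> 0" using assms by (auto simp: l2_def dest: summable_LIMSEQ_zero)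
  then have "(\<lambda>k. sqrt ((x k)\<^sup>2)) \<longlonglongrightarrow> sqrt 0" by (rule tendsto_real_sqrt)
  then show ?thesis by (simp add: tendsto_rabs_zero_iff)
qed

text \<open>Boundedness puts the impulse response into \<open>l2\<close>, so it tends to 0; the
  state space makes it satisfy a linear recurrence. Together these force geometric decay.\<close>

lemma impulse_response_summable:
  assumes real: "finite_dim_realizable G" and bdd: "l2_bounded G"
  shows "summable (\<lambda>k. \<bar>G (delta 0) k\<bar>)"
proof -
  let ?h = "G (delta 0)"
  obtain n A b c D where A: "A \<in> carrier_mat n n" and b: "b \<in> carrier_vec n" and c: "c \<in> carrier_vec n"
    and r: "\<And>w. \<exists>x. x 0 = 0\<^sub>v n \<and> (\<forall>k. x (Suc k) = A *\<^sub>v x k + w k \<cdot>\<^sub>v b \<and>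
                G w k = scalar_prod c (x k) + D * w k)"
    using real unfolding finite_dim_realizable_def by blast
  obtain x where x0: "x 0 = 0\<^sub>v n" and x: "\<And>k. x (Suc k) = A *\<^sub>v x k + delta 0 k \<cdot>\<^sub>v b"
      and h: "\<And>k. ?h k = scalar_prod c (x k) + D * delta 0 k" using r[of "delta 0"] by blast
  have xc: "x k \<in> carrier_vec n" for k
    by (induction k) (use x0 x A b in auto)
  \<comment> \<open>From time 1 on the impulse no longer acts: the state evolves freely and the
    feedthrough \<open>D\<close> drops out.\<close>
  define y where "y k = x (Suc k)" for k
  have step: "y (Suc k) = A *\<^sub>v y k" for k
    using A b xc[of "Suc k"] unfolding y_def x[of "Suc k"] by (auto simp: delta_def)
  obtain \<alpha> where nz: "\<exists>i\<le>n. \<alpha> i \<noteq> 0"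
    and rec: "\<And>c k. c \<in> carrier_vec n \<Longrightarrow> (\<Sum>i\<le>n. \<alpha> i * scalar_prod c (y (k + i))) = 0"
    by (rule krylov_dependence[where x = y, OF A]) (use xc step in \<open>auto simp: y_def\<close>)
  \<comment> \<open>Complex values, so that the recurrence polynomial has roots to peel off.\<close>
  define g where "g k = complex_of_real (?h (Suc k))" for k
  have g: "g k = complex_of_real (scalar_prod c (y k))" for k
    unfolding g_def h y_def by (simp add: delta_def)
  define p where "p = Poly (map (\<lambda>i. complex_of_real (\<alpha> i)) [0..<Suc n])"
  have co: "coeff p i = (if i \<le> n then complex_of_real (\<alpha> i) else 0)" for i
    unfolding p_def by (auto simp: coeff_Poly_eq nth_default_def simp del: upt_Suc)
  have deg: "degree p \<le> n" by (rule degree_le) (simp add: co)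
  have "p \<noteq> 0" using nz co by (metis coeff_0 of_real_eq_0_iff)
  moreover have "?h \<in> l2" using bdd delta_l2 unfolding l2_bounded_def by blast
  then have "(\<lambda>k. ?h (Suc k)) \<longlonglongrightarrow> 0" using l2_tendsto_0 LIMSEQ_Suc by blast
  then have "g \<longlonglongrightarrow> 0" unfolding g_def by (metis of_real_0 tendsto_of_real)
  moreover have "shift_poly p g k = 0" for k
    unfolding shift_poly_bound[OF deg] g using arg_cong[OF rec[OF c, of k], of complex_of_real]
    by (simp add: co)
  then have "geometrically_bounded (shift_poly p g)"
    unfolding geometrically_bounded_def by (intro exI[of _ 0] exI[of _ "1/2"]) simp
  ultimately have "geometrically_bounded g" by (rule geometrically_bounded_of_recurrence)
  then have "summable (\<lambda>k. \<bar>?h (Suc k)\<bar>)"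
    using geometrically_bounded_summable by (fastforce simp: g_def)
  then show ?thesis by (rule iffD1[OF summable_Suc_iff])
qed

lemma linear_system_sum:
  assumes lin: "linear_system G" and "finite I"
  shows "G (\<lambda>k. \<Sum>i\<in>I. a i * x i k) = (\<lambda>k. \<Sum>i\<in>I. a i * G (x i) k)"
proof -
  have two: "G (\<lambda>k. a * x k + b * y k) = (\<lambda>k. a * G x k + b * G y k)" for a b x y
    using lin unfolding linear_system_def by blast
  show ?thesis using \<open>finite I\<close>
  proof (induction I)
    case empty
    show ?case using two[of 0 "\<lambda>_. 0" 0 "\<lambda>_. 0"] by simp
  next
    case (insert i I)
    then show ?case using two[of "a i" "x i" 1 "\<lambda>k. \<Sum>i\<in>I. a i * x i k"] by simp
  qed
qed

text \<open>Causality lets the input be cut off after time \<open>k\<close>, where it is a finite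
  combination of shifted impulses; hence the formula holds for all signals and not only for those in
  \<open>l2\<close>.\<close>

lemma convolution_representation:
  assumes lin: "linear_system G" and ti: "time_invariant G" and ca: "causal G"
  shows "G w k = (\<Sum>l\<le>k. G (delta 0) l * w (k - l))"
proof -
  have shift: "G (delta j) k = (if j \<le> k then G (delta 0) (k - j) else 0)" for j k
  proof (induction j arbitrary: k)
    case (Suc j)
    have "delta (Suc j) = right_shift (delta j)"
      by (auto simp: delta_def right_shift_def split: nat.split)
    then have "G (delta (Suc j)) = right_shift (G (delta j))"
      using ti by (simp add: time_invariant_def)
    then show ?case by (auto simp: right_shift_def Suc split: nat.split)
  qed simp
  have "trunc k w = (\<lambda>t. \<Sum>j\<le>k. w j * delta j t)"
    by (auto simp: trunc_def delta_def if_distrib cong: if_cong)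
  then have "G (trunc k w) k = (\<Sum>j\<le>k. w j * G (delta j) k)"
    using linear_system_sum[OF lin, of "{..k}" w delta] by simp
  also have "\<dots> = (\<Sum>j\<le>k. w j * G (delta 0) (k - j))"
    by (intro sum.cong refl, subst shift) simp
  also have "\<dots> = (\<Sum>l\<le>k. G (delta 0) l * w (k - l))"
    by (rule sum.reindex_bij_witness[of _ "\<lambda>l. k - l" "\<lambda>l. k - l"]) auto
  also have "G (trunc k w) k = G w k"
    using ca fun_cong[of "trunc k (G w)" "trunc k (G (trunc k w))" k]
    unfolding causal_def trunc_def by auto
  finally show ?thesis .
qed

section \<open>A minimax alternative\<close>

lemma compact_sublevel:
  fixes f :: "'a::topological_space \<Rightarrow> real"
  assumes "compact X" "continuous_on X f"
  shows "compact {x \<in> X. f x \<le> 0}"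
proof -
  have "{x \<in> X. f x \<le> 0} = X \<inter> f -` {..0}" by auto
  moreover have "closedin (top_of_set X) (X \<inter> f -` {..0})"
    using assms(2) by (intro continuous_closedin_preimage) auto
  ultimately show ?thesis using closedin_compact[OF assms(1)] by metis
qed

text \<open>Look for a positive combination \<open>f + s * g\<close>. Where
  \<open>f \<le> 0\<close>, the factor \<open>s\<close> must exceed the largest ratio
  \<open>- f / g\<close>, called \<open>\<alpha>\<close>. Where \<open>g \<le> 0\<close>, the factor
  \<open>\<alpha>\<close> still leaves a positive margin, so a slightly larger one works everywhere.
  \<open>mix\<close> stands in for convexity of \<open>X\<close> and affinity of \<open>f\<close>
  and \<open>g\<close>.\<close>

lemma two_function_minimax:
  fixes f g :: "'a::topological_space \<Rightarrow> real"
  assumes X: "compact X" and f: "continuous_on X f" and g: "continuous_on X g"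
    and mix: "\<And>x y t. x \<in> X \<Longrightarrow> y \<in> X \<Longrightarrow> 0 \<le> t \<Longrightarrow> t \<le> 1 \<Longrightarrow>
      \<exists>z\<in>X. f z = (1 - t) * f x + t * f y \<and> g z = (1 - t) * g x + t * g y"
    and pos: "\<And>x. x \<in> X \<Longrightarrow> f x > 0 \<or> g x > 0"
  shows "\<exists>a b. 0 \<le> a \<and> 0 \<le> b \<and> (\<forall>x\<in>X. a * f x + b * g x > 0)"
proof -
  let ?A = "{x \<in> X. f x \<le> 0}" and ?B = "{x \<in> X. g x \<le> 0}"
  show ?thesis
  proof (cases "?A = {} \<or> ?B = {}")
    case True
    then show ?thesis
    proof
      assume "?A = {}"
      then show ?thesis by (intro exI[of _ 1] exI[of _ 0]) force
    next
      assume "?B = {}"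
      then show ?thesis by (intro exI[of _ 0] exI[of _ 1]) force
    qed
  next
    case False
    have gA: "g x > 0" if "x \<in> ?A" for x using pos[of x] that by auto
    have "continuous_on ?A (\<lambda>x. - f x / g x)"
      using gA by (intro continuous_intros continuous_on_subset[OF f] continuous_on_subset[OF g]) force+
    from continuous_attains_sup[OF compact_sublevel[OF X f] _ this] False
    obtain p where p: "p \<in> ?A" and pmax: "\<And>x. x \<in> ?A \<Longrightarrow> - f x / g x \<le> - f p / g p" by blast
    define \<alpha> where "\<alpha> = - f p / g p"
    have gp: "g p > 0" using gA[OF p] .
    have \<alpha>0: "\<alpha> \<ge> 0" using p gp by (auto simp: \<alpha>_def intro: divide_nonpos_pos)
    have posB: "f y + \<alpha> * g y > 0" if y: "y \<in> ?B" for y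
    proof -
      \<comment> \<open>The mixing weight at which \<open>g\<close> vanishes between
        \<open>p\<close> and \<open>y\<close>; \<open>f\<close> must be positive there, which is the
        claim up to a positive factor.\<close>
      define t where "t = g p / (g p - g y)"
      have d: "g p - g y > 0" using gp y by auto
      have t: "0 \<le> t" "t \<le> 1" "1 - t = - g y / (g p - g y)"
        using gp y d by (auto simp: t_def divide_simps)
      have dt: "(g p - g y) * (1 - t) = - g y" "(g p - g y) * t = g p"
        unfolding t(3) unfolding t_def using d by auto
      obtain z where z: "z \<in> X" "f z = (1 - t) * f p + t * f y" "g z = (1 - t) * g p + t * g y"
        using mix[of p y t] p y t by auto
      have "g z = 0" unfolding z(3) t(3) unfolding t_def using d by (simp add: divide_simps)
      then have "f z > 0" using pos[OF z(1)] by simp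
      then have "(g p - g y) * f z > 0" using d by simp
      also have "(g p - g y) * f z = - g y * f p + g p * f y"
        unfolding z(2) using dt by (simp add: distrib_left mult.assoc[symmetric])
      also have "\<dots> = g p * (f y + \<alpha> * g y)"
        unfolding \<alpha>_def using gp by (simp add: field_simps)
      finally show ?thesis using gp by (simp add: zero_less_mult_iff)
    qed
    have "continuous_on ?B (\<lambda>x. f x + \<alpha> * g x)"
      by (intro continuous_intros continuous_on_subset[OF f] continuous_on_subset[OF g]) auto
    from continuous_attains_inf[OF compact_sublevel[OF X g] _ this] False
    obtain q where q: "q \<in> ?B" and qmin: "\<And>x. x \<in> ?B \<Longrightarrow> f q + \<alpha> * g q \<le> f x + \<alpha> * g x" by blast
    have "continuous_on ?B (\<lambda>x. g x)" by (rule continuous_on_subset[OF g]) auto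
    from continuous_attains_inf[OF compact_sublevel[OF X g] _ this] False
    obtain r where r: "r \<in> ?B" and rmin: "\<And>x. x \<in> ?B \<Longrightarrow> g r \<le> g x" by blast
    define \<delta> where "\<delta> = f q + \<alpha> * g q"
    \<comment> \<open>At \<open>p\<close> the factor \<open>\<alpha>\<close> gives exactly 0, so it
      has to be raised. The summand 1 in the denominator keeps the loss on \<open>?B\<close>, at
      most \<open>- \<eta> * g r = \<delta> - \<eta>\<close>, strictly below
      \<open>\<delta>\<close>.\<close>
    define \<eta> where "\<eta> = \<delta> / (1 - g r)"
    have \<delta>0: "\<delta> > 0" using posB[OF q] by (simp add: \<delta>_def)
    have r0: "1 - g r > 0" using r by simp
    have \<eta>0: "\<eta> > 0" using \<delta>0 r0 by (simp add: \<eta>_def)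
    have "f x + (\<alpha> + \<eta>) * g x > 0" if x: "x \<in> X" for x
    proof (cases "f x \<le> 0")
      case True
      then have xA: "x \<in> ?A" using x by simp
      then have "- f x / g x \<le> \<alpha>" using pmax \<alpha>_def by simp
      then have "- f x \<le> \<alpha> * g x" using gA[OF xA] by (simp only: pos_divide_le_eq)
      moreover have "\<eta> * g x > 0" using gA[OF xA] \<eta>0 by simp
      ultimately show ?thesis by (simp add: algebra_simps)
    next
      case fx: False
      show ?thesis
      proof (cases "g x \<le> 0")
        case True
        then have xB: "x \<in> ?B" using x by simp
        have "\<eta> * (1 - g r) = \<delta>" using r0 by (simp add: \<eta>_def)
        moreover have "\<eta> * g r \<le> \<eta> * g x" using rmin[OF xB] \<eta>0 by simp
        moreover have "\<delta> \<le> f x + \<alpha> * g x" using qmin[OF xB] \<delta>_def by simp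
        ultimately show ?thesis using \<eta>0 unfolding distrib_right right_diff_distrib by linarith
      next
        case False
        then show ?thesis using fx \<alpha>0 \<eta>0 by (intro add_pos_nonneg) auto
      qed
    qed
    then show ?thesis using \<alpha>0 \<eta>0 by (intro exI[of _ 1] exI[of _ "\<alpha> + \<eta>"]) auto
  qed
qed

text \<open>Where \<open>F i \<le> 0\<close>, one of the remaining functions must be positive. That
  sublevel set is compact and closed under mixing, so the induction hypothesis merges the others
  into one function, which is then combined with \<open>F i\<close>.\<close>

lemma finite_minimax:
  fixes F :: "'i \<Rightarrow> 'a::topological_space \<Rightarrow> real"
  assumes "finite I" and "compact X" and "\<And>i. i \<in> I \<Longrightarrow> continuous_on X (F i)"
    and "\<And>x y t. x \<in> X \<Longrightarrow> y \<in> X \<Longrightarrow> 0 \<le> t \<Longrightarrow> t \<le> 1 \<Longrightarrow>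
      \<exists>z\<in>X. \<forall>i\<in>I. F i z = (1 - t) * F i x + t * F i y"
    and "\<And>x. x \<in> X \<Longrightarrow> \<exists>i\<in>I. F i x > 0"
  shows "\<exists>a. (\<forall>i\<in>I. 0 \<le> a i) \<and> (\<forall>x\<in>X. (\<Sum>i\<in>I. a i * F i x) > 0)"
  using assms
proof (induction I arbitrary: X)
  case (insert i I)
  define X' where "X' = {x \<in> X. F i x \<le> 0}"
  have "\<exists>a. (\<forall>i\<in>I. 0 \<le> a i) \<and> (\<forall>x\<in>X'. (\<Sum>i\<in>I. a i * F i x) > 0)"
  proof (rule insert.IH)
    show "compact X'" unfolding X'_def by (intro compact_sublevel insert.prems) simp
    show "continuous_on X' (F j)" if "j \<in> I" for j
      using that by (intro continuous_on_subset[OF insert.prems(2)]) (auto simp: X'_def)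
    show "\<exists>z\<in>X'. \<forall>i\<in>I. F i z = (1 - t) * F i x + t * F i y"
      if xy: "x \<in> X'" "y \<in> X'" and t: "0 \<le> t" "t \<le> 1" for x y t
    proof -
      obtain z where z: "z \<in> X" "\<And>j. j \<in> insert i I \<Longrightarrow> F j z = (1 - t) * F j x + t * F j y"
        using insert.prems(3)[of x y t] xy t unfolding X'_def by blast
      have "(1 - t) * F i x \<le> 0" "t * F i y \<le> 0"
        using xy t by (auto simp: X'_def mult_nonneg_nonpos)
      then have "F i z \<le> 0" using z(2)[of i] by simp
      then show ?thesis using z unfolding X'_def by blast
    qed
    show "\<exists>j\<in>I. F j x > 0" if "x \<in> X'" for x
      using insert.prems(4)[of x] that unfolding X'_def by auto
  qed
  then obtain a where a: "\<And>j. j \<in> I \<Longrightarrow> 0 \<le> a j" "\<And>x. x \<in> X' \<Longrightarrow> (\<Sum>j\<in>I. a j * F j x) > 0" by blast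
  have "\<exists>\<alpha> \<beta>. 0 \<le> \<alpha> \<and> 0 \<le> \<beta> \<and> (\<forall>x\<in>X. \<alpha> * F i x + \<beta> * (\<Sum>j\<in>I. a j * F j x) > 0)"
  proof (rule two_function_minimax)
    show "continuous_on X (\<lambda>x. \<Sum>j\<in>I. a j * F j x)"
      using insert.prems(2) by (intro continuous_intros) auto
    show "\<exists>z\<in>X. F i z = (1 - t) * F i x + t * F i y \<and>
        (\<Sum>j\<in>I. a j * F j z) = (1 - t) * (\<Sum>j\<in>I. a j * F j x) + t * (\<Sum>j\<in>I. a j * F j y)"
      if xyt: "x \<in> X" "y \<in> X" "0 \<le> t" "t \<le> 1" for x y t
    proof -
      obtain z where z: "z \<in> X" "\<And>j. j \<in> insert i I \<Longrightarrow> F j z = (1 - t) * F j x + t * F j y"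
        using insert.prems(3)[OF xyt] by blast
      have "(\<Sum>j\<in>I. a j * F j z) = (\<Sum>j\<in>I. (1 - t) * (a j * F j x) + t * (a j * F j y))"
        by (intro sum.cong refl) (simp add: z(2) distrib_left mult.left_commute)
      then have "(\<Sum>j\<in>I. a j * F j z) = (1 - t) * (\<Sum>j\<in>I. a j * F j x) + t * (\<Sum>j\<in>I. a j * F j y)"
        by (simp only: sum.distrib sum_distrib_left)
      then show ?thesis using z by blast
    qed
    show "F i x > 0 \<or> (\<Sum>j\<in>I. a j * F j x) > 0" if "x \<in> X" for x
      using a(2)[of x] that unfolding X'_def by (cases "F i x \<le> 0") auto
  qed (use insert.prems in auto)
  then obtain \<alpha> \<beta> where ab: "0 \<le> \<alpha>" "0 \<le> \<beta>"
    and p: "\<And>x. x \<in> X \<Longrightarrow> \<alpha> * F i x + \<beta> * (\<Sum>j\<in>I. a j * F j x) > 0" by blast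
  define a' where "a' j = (if j = i then \<alpha> else \<beta> * a j)" for j
  have "(\<Sum>j\<in>insert i I. a' j * F j x) = \<alpha> * F i x + \<beta> * (\<Sum>j\<in>I. a j * F j x)" for x
  proof -
    have "(\<Sum>j\<in>I. a' j * F j x) = (\<Sum>j\<in>I. \<beta> * (a j * F j x))"
      using insert.hyps by (intro sum.cong) (auto simp: a'_def)
    then show ?thesis using insert.hyps by (simp add: a'_def sum_distrib_left)
  qed
  then show ?case using p a ab by (intro exI[of _ a']) (auto simp: a'_def)
qed auto

text \<open>The open sets where some \<open>F i\<close> is positive cover \<open>X\<close>, so
  finitely many indices suffice.\<close>

lemma compact_minimax:
  fixes F :: "'i \<Rightarrow> 'a::topological_space \<Rightarrow> real"
  assumes X: "compact X" and cont: "\<And>i. i \<in> W \<Longrightarrow> continuous_on X (F i)"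
    and mix: "\<And>x y t. x \<in> X \<Longrightarrow> y \<in> X \<Longrightarrow> 0 \<le> t \<Longrightarrow> t \<le> 1 \<Longrightarrow>
      \<exists>z\<in>X. \<forall>i\<in>W. F i z = (1 - t) * F i x + t * F i y"
    and pos: "\<And>x. x \<in> X \<Longrightarrow> \<exists>i\<in>W. F i x > 0"
  obtains I a where "finite I" "I \<subseteq> W" "\<And>i. i \<in> I \<Longrightarrow> 0 \<le> a i"
    and "\<And>x. x \<in> X \<Longrightarrow> (\<Sum>i\<in>I. a i * F i x) > 0"
proof -
  let ?U = "\<lambda>i. X \<inter> F i -` {0<..}"
  have "\<forall>c\<in>?U ` W. openin (top_of_set X) c"
    using cont by (auto intro!: continuous_openin_preimage_gen)
  moreover have "X \<subseteq> \<Union> (?U ` W)" using pos by force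
  ultimately have "\<exists>D\<subseteq>?U ` W. finite D \<and> X \<subseteq> \<Union> D"
    using X unfolding compact_eq_openin_cover by blast
  then obtain D where D: "D \<subseteq> ?U ` W" "finite D" "X \<subseteq> \<Union> D" by blast
  then obtain I where I: "I \<subseteq> W" "finite I" "D = ?U ` I" by (meson finite_subset_image)
  have "\<exists>a. (\<forall>i\<in>I. 0 \<le> a i) \<and> (\<forall>x\<in>X. (\<Sum>i\<in>I. a i * F i x) > 0)"
  proof (rule finite_minimax[OF I(2) X])
    show "\<exists>z\<in>X. \<forall>i\<in>I. F i z = (1 - t) * F i x + t * F i y"
      if "x \<in> X" "y \<in> X" "0 \<le> t" "t \<le> 1" for x y t
      using mix[OF that] I(1) by blast
    show "\<exists>i\<in>I. F i x > 0" if "x \<in> X" for x using D(3) I(3) that by auto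
  qed (use cont I in auto)
  with I show thesis using that by blast
qed

text \<open>Total mass at most 1 instead of exactly 1 survives pointwise limits, in which mass may
  escape to infinity.\<close>

definition substochastic :: "('i \<Rightarrow> real) set" where
  "substochastic = {\<mu>. (\<forall>j. 0 \<le> \<mu> j) \<and> (\<forall>F. finite F \<longrightarrow> sum \<mu> F \<le> 1)}"

text \<open>Tychonoff for the cube: each defining condition involves finitely many coordinates and
  is therefore closed in the product topology.\<close>

lemma compact_substochastic: "compact (substochastic :: ('i \<Rightarrow> real) set)"
proof -
  have "compactin (product_topology (\<lambda>_. euclidean) UNIV) (PiE UNIV (\<lambda>_::'i. {0..1::real}))"
    unfolding compactin_PiE by simp
  then have c: "compact (PiE UNIV (\<lambda>_::'i. {0..1::real}))"
    by (simp add: euclidean_product_topology)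
  have "closed ((\<Inter>j. {\<mu>::'i \<Rightarrow> real. 0 \<le> \<mu> j}) \<inter> (\<Inter>F\<in>{F. finite F}. {\<mu>. sum \<mu> F \<le> 1}))"
    by (intro closed_Int closed_INT ballI closed_Collect_le continuous_intros
        continuous_on_product_coordinates)
  moreover have "substochastic = PiE UNIV (\<lambda>_::'i. {0..1::real}) \<inter>
      ((\<Inter>j. {\<mu>. 0 \<le> \<mu> j}) \<inter> (\<Inter>F\<in>{F. finite F}. {\<mu>. sum \<mu> F \<le> 1}))"
  proof -
    have "\<mu> j \<le> 1" if "\<forall>F. finite F \<longrightarrow> sum \<mu> F \<le> 1" for \<mu> :: "'i \<Rightarrow> real" and j
      using that[rule_format, of "{j}"] by simp
    then show ?thesis by (auto simp: substochastic_def)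
  qed
  ultimately show ?thesis using compact_Int_closed[OF c] by metis
qed

lemma substochastic_mix:
  assumes "\<mu> \<in> substochastic" "\<nu> \<in> substochastic" "0 \<le> t" "t \<le> 1"
  shows "(\<lambda>j. (1 - t) * \<mu> j + t * \<nu> j) \<in> substochastic"
proof -
  have "(\<Sum>j\<in>F. (1 - t) * \<mu> j + t * \<nu> j) \<le> 1" if F: "finite F" for F
  proof -
    have "(\<Sum>j\<in>F. (1 - t) * \<mu> j + t * \<nu> j) = (1 - t) * sum \<mu> F + t * sum \<nu> F"
      by (simp add: sum.distrib sum_distrib_left)
    also have "\<dots> \<le> (1 - t) * 1 + t * 1"
      using assms F by (intro add_mono mult_left_mono) (auto simp: substochastic_def)
    finally show ?thesis by simp
  qed
  then show ?thesis using assms by (auto simp: substochastic_def)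
qed

lemma substochastic_zero: "(\<lambda>_. 0) \<in> substochastic"
  by (simp add: substochastic_def)

lemma substochastic_point: "(\<lambda>i. if i = j then 1 else 0) \<in> substochastic"
  by (auto simp: substochastic_def sum.delta)

section \<open>Multipliers and signal tuples\<close>

lemma sum_Cauchy_Schwarz:
  fixes x y :: "'i \<Rightarrow> real"
  shows "(\<Sum>j\<in>A. x j * y j)\<^sup>2 \<le> (\<Sum>j\<in>A. (x j)\<^sup>2) * (\<Sum>j\<in>A. (y j)\<^sup>2)"
proof -
  have "\<bar>\<Sum>j\<in>A. x j * y j\<bar> \<le> (\<Sum>j\<in>A. \<bar>x j\<bar> * \<bar>y j\<bar>)"
    by (rule order_trans[OF sum_abs]) (simp add: abs_mult)
  also have "\<dots> \<le> L2_set x A * L2_set y A" by (rule L2_set_mult_ineq)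
  finally have "\<bar>\<Sum>j\<in>A. x j * y j\<bar>\<^sup>2 \<le> (L2_set x A * L2_set y A)\<^sup>2"
    by (rule power_mono) simp
  then show ?thesis by (simp add: power_mult_distrib L2_set_def sum_nonneg)
qed

text \<open>Cauchy-Schwarz with the weight \<open>\<bar>c j\<bar>\<close> split evenly between the
  two factors, as a Schur test requires.\<close>

lemma weighted_Cauchy_Schwarz:
  fixes c x :: "'i \<Rightarrow> real"
  shows "(\<Sum>j\<in>A. c j * x j)\<^sup>2 \<le> (\<Sum>j\<in>A. \<bar>c j\<bar>) * (\<Sum>j\<in>A. \<bar>c j\<bar> * (x j)\<^sup>2)"
proof -
  have c: "c j = sqrt \<bar>c j\<bar> * (sqrt \<bar>c j\<bar> * sgn (c j))" for j
    by (simp add: mult.assoc[symmetric] abs_mult_sgn)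
  have "(\<Sum>j\<in>A. c j * x j) = (\<Sum>j\<in>A. sqrt \<bar>c j\<bar> * (sqrt \<bar>c j\<bar> * sgn (c j) * x j))"
    by (subst c) (simp add: mult.assoc)
  also have "\<dots>\<^sup>2 \<le> (\<Sum>j\<in>A. (sqrt \<bar>c j\<bar>)\<^sup>2) * (\<Sum>j\<in>A. (sqrt \<bar>c j\<bar> * sgn (c j) * x j)\<^sup>2)"
    by (rule sum_Cauchy_Schwarz)
  also have "\<dots> = (\<Sum>j\<in>A. \<bar>c j\<bar>) * (\<Sum>j\<in>A. \<bar>c j\<bar> * (x j)\<^sup>2)"
    by (intro arg_cong2[of _ _ _ _ "(*)"] sum.cong refl) (auto simp: power_mult_distrib sgn_if)
  finally show ?thesis .
qed

section \<open>Square summable signals and Toeplitz operators\<close>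

lemma l2_add: "x \<in> l2 \<Longrightarrow> y \<in> l2 \<Longrightarrow> (\<lambda>k. x k + y k) \<in> l2"
proof -
  assume "x \<in> l2" "y \<in> l2"
  then have S: "summable (\<lambda>k. 2 * (x k)\<^sup>2 + 2 * (y k)\<^sup>2)"
    unfolding l2_def by (intro summable_add summable_mult) auto
  have B: "norm ((x k + y k)\<^sup>2) \<le> 2 * (x k)\<^sup>2 + 2 * (y k)\<^sup>2" for k
    using zero_le_power2[of "x k - y k"] unfolding real_norm_def abs_power2
    by (simp add: power2_eq_square algebra_simps)
  show ?thesis unfolding l2_def mem_Collect_eq
    by (rule summable_comparison_test'[OF S, of 0]) (rule B)
qed

lemma l2_cmult: "x \<in> l2 \<Longrightarrow> (\<lambda>k. a * x k) \<in> l2"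
  unfolding l2_def by (auto simp: power_mult_distrib intro: summable_mult)

lemma l2_diff: "x \<in> l2 \<Longrightarrow> y \<in> l2 \<Longrightarrow> (\<lambda>k. x k - y k) \<in> l2"
  using l2_add[of x "\<lambda>k. - 1 * y k"] l2_cmult[of y "- 1"] by simp

lemma l2_summable_mult:
  assumes "x \<in> l2" "y \<in> l2"
  shows "summable (\<lambda>k. x k * y k)"
proof -
  have S: "summable (\<lambda>k. (x k)\<^sup>2 + (y k)\<^sup>2)"
    using assms unfolding l2_def by (intro summable_add) auto
  have B: "norm (x k * y k) \<le> (x k)\<^sup>2 + (y k)\<^sup>2" for k
    using sum_squares_bound[of "\<bar>x k\<bar>" "\<bar>y k\<bar>"] mult_nonneg_nonneg[of "\<bar>x k\<bar>" "\<bar>y k\<bar>"]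
    unfolding real_norm_def abs_mult power2_abs by linarith
  show ?thesis by (rule summable_comparison_test'[OF S, of 0]) (rule B)
qed

lemma l2_inner_commute: "l2_inner x y = l2_inner y x"
  by (simp add: l2_inner_def mult.commute)

lemma l2_inner_add_right:
  "x \<in> l2 \<Longrightarrow> y \<in> l2 \<Longrightarrow> z \<in> l2 \<Longrightarrow> l2_inner x (\<lambda>k. y k + z k) = l2_inner x y + l2_inner x z"
  unfolding l2_inner_def by (simp add: distrib_left suminf_add l2_summable_mult)

lemma l2_inner_cmult_right:
  "x \<in> l2 \<Longrightarrow> y \<in> l2 \<Longrightarrow> l2_inner x (\<lambda>k. a * y k) = a * l2_inner x y"
  unfolding l2_inner_def by (simp add: mult.left_commute suminf_mult l2_summable_mult)

lemma l2_inner_diff_right: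
  "x \<in> l2 \<Longrightarrow> y \<in> l2 \<Longrightarrow> z \<in> l2 \<Longrightarrow> l2_inner x (\<lambda>k. y k - z k) = l2_inner x y - l2_inner x z"
  unfolding l2_inner_def by (simp add: right_diff_distrib suminf_diff l2_summable_mult)

lemma l2_inner_self_nonneg: "x \<in> l2 \<Longrightarrow> l2_inner x x \<ge> 0"
  unfolding l2_inner_def by (intro suminf_nonneg l2_summable_mult) auto

lemma l2_norm_squared: "x \<in> l2 \<Longrightarrow> (l2_norm x)\<^sup>2 = l2_inner x x"
  by (simp add: l2_norm_def l2_inner_self_nonneg)

lemma l2_partial_energy: "x \<in> l2 \<Longrightarrow> (\<Sum>k<n. (x k)\<^sup>2) \<le> l2_inner x x"
  unfolding l2_inner_def power2_eq_square by (intro sum_le_suminf l2_summable_mult) auto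

lemma l2_inner_finite_support:
  assumes "\<And>k. k \<ge> n \<Longrightarrow> w k = 0"
  shows "l2_inner w y = (\<Sum>k<n. w k * y k)"
  unfolding l2_inner_def by (rule suminf_finite) (use assms in auto)

lemma toeplitz_op_summable:
  assumes "m summable_on (UNIV :: int set)" "x \<in> l2"
  shows "summable (\<lambda>j. toeplitz m i j * x j)"
  using has_sum_imp_sums[OF has_sum_infsum[OF toeplitz_row_prod_summable(1)[OF assms]]]
  by (auto simp: sums_iff)

lemma toeplitz_op_diff:
  assumes "m summable_on (UNIV :: int set)" "x \<in> l2" "y \<in> l2"
  shows "matrix_op (toeplitz m) (\<lambda>k. x k - y k) i = matrix_op (toeplitz m) x i - matrix_op (toeplitz m) y i"
  unfolding matrix_op_def
  by (simp add: right_diff_distrib suminf_diff toeplitz_op_summable assms)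

lemma toeplitz_op_cmult:
  assumes "m summable_on (UNIV :: int set)" "x \<in> l2"
  shows "matrix_op (toeplitz m) (\<lambda>k. a * x k) i = a * matrix_op (toeplitz m) x i"
  unfolding matrix_op_def
  by (simp add: mult.left_commute suminf_mult toeplitz_op_summable assms)

text \<open>Schur test: rows and columns both have absolute sum at most the l1 norm of
  \<open>m\<close>.\<close>

lemma toeplitz_op_energy:
  assumes m: "m summable_on (UNIV :: int set)" and x: "x \<in> l2"
  shows "(\<Sum>i<n. (matrix_op (toeplitz m) x i)\<^sup>2) \<le> (\<Sum>\<^sub>\<infinity>k. \<bar>m k\<bar>)\<^sup>2 * l2_inner x x"
proof -
  define K where "K = (\<Sum>\<^sub>\<infinity>k. \<bar>m k\<bar>)"
  have K: "K \<ge> 0" unfolding K_def by (simp add: infsum_nonneg)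
  have sq: "summable (\<lambda>j. \<bar>toeplitz m i j\<bar> * (x j)\<^sup>2)" for i
    using has_sum_imp_sums[OF has_sum_infsum[OF toeplitz_row_prod_summable(2)[OF assms]]]
    by (auto simp: sums_iff)
  have row: "(matrix_op (toeplitz m) x i)\<^sup>2 \<le> K * (\<Sum>j. \<bar>toeplitz m i j\<bar> * (x j)\<^sup>2)" for i
  proof (rule LIMSEQ_le_const2)
    show "(\<lambda>J. (\<Sum>j<J. toeplitz m i j * x j)\<^sup>2) \<longlonglongrightarrow> (matrix_op (toeplitz m) x i)\<^sup>2"
      unfolding matrix_op_def by (intro tendsto_power summable_LIMSEQ toeplitz_op_summable assms)
    have "(\<Sum>j<J. toeplitz m i j * x j)\<^sup>2 \<le> K * (\<Sum>j. \<bar>toeplitz m i j\<bar> * (x j)\<^sup>2)" for J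
    proof -
      have "(\<Sum>j<J. toeplitz m i j * x j)\<^sup>2
          \<le> (\<Sum>j<J. \<bar>toeplitz m i j\<bar>) * (\<Sum>j<J. \<bar>toeplitz m i j\<bar> * (x j)\<^sup>2)"
        by (rule weighted_Cauchy_Schwarz)
      also have "\<dots> \<le> K * (\<Sum>j. \<bar>toeplitz m i j\<bar> * (x j)\<^sup>2)"
      proof (intro mult_mono sum_le_suminf sq)
        have "(\<Sum>j<J. \<bar>toeplitz m i j\<bar>) \<le> (\<Sum>\<^sub>\<infinity>j. \<bar>toeplitz m i j\<bar>)"
          by (intro finite_sum_le_infsum toeplitz_row_summable[OF m]) auto
        also have "\<dots> \<le> K" unfolding K_def by (rule toeplitz_row_summable[OF m])
        finally show "(\<Sum>j<J. \<bar>toeplitz m i j\<bar>) \<le> K" .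
      qed (use K in \<open>auto intro: sum_nonneg\<close>)
      finally show ?thesis .
    qed
    then show "\<exists>N. \<forall>J\<ge>N. (\<Sum>j<J. toeplitz m i j * x j)\<^sup>2 \<le> K * (\<Sum>j. \<bar>toeplitz m i j\<bar> * (x j)\<^sup>2)"
      by blast
  qed
  have "(\<Sum>i<n. (matrix_op (toeplitz m) x i)\<^sup>2) \<le> K * (\<Sum>i<n. \<Sum>j. \<bar>toeplitz m i j\<bar> * (x j)\<^sup>2)"
    using row by (simp add: sum_distrib_left sum_mono)
  also have "(\<Sum>i<n. \<Sum>j. \<bar>toeplitz m i j\<bar> * (x j)\<^sup>2) = (\<Sum>j. \<Sum>i<n. \<bar>toeplitz m i j\<bar> * (x j)\<^sup>2)"
    by (rule suminf_sum[symmetric]) (rule sq)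
  also have "\<dots> \<le> (\<Sum>j. K * (x j * x j))"
  proof (rule suminf_le)
    fix j
    have "(\<Sum>i<n. \<bar>toeplitz m i j\<bar>) \<le> (\<Sum>\<^sub>\<infinity>i. \<bar>toeplitz m i j\<bar>)"
      by (intro finite_sum_le_infsum toeplitz_row_summable[OF m]) auto
    also have "\<dots> \<le> K" unfolding K_def by (rule toeplitz_row_summable[OF m])
    finally have "(\<Sum>i<n. \<bar>toeplitz m i j\<bar>) * (x j)\<^sup>2 \<le> K * (x j)\<^sup>2"
      by (intro mult_right_mono) auto
    then show "(\<Sum>i<n. \<bar>toeplitz m i j\<bar> * (x j)\<^sup>2) \<le> K * (x j * x j)"
      by (simp add: sum_distrib_right power2_eq_square)
  qed (intro summable_sum sq summable_mult l2_summable_mult x)+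
  also have "\<dots> = K * l2_inner x x"
    unfolding l2_inner_def by (intro suminf_mult l2_summable_mult x)
  finally have "(\<Sum>i<n. (matrix_op (toeplitz m) x i)\<^sup>2) \<le> K * (K * l2_inner x x)"
    using K by (simp add: mult_left_mono)
  then show ?thesis by (simp add: K_def power2_eq_square)
qed

text \<open>With \<lambda> = 0, moving the adjoint across makes the two off-diagonal blocks
  contribute equally, and likewise the two summands of the diagonal block; only the combination
  \<open>a k - recip \<kappa> * w k\<close> survives.\<close>

lemma Pi_mult_form:
  assumes m: "doubly_hyperdominant m" and a: "a \<in> l2" and w: "w \<in> l2"
  shows "l2_inner_pair (a, w) (Pi_mult (toeplitz m) 0 \<kappa> (a, w))
    = 2 * l2_inner w (matrix_op (toeplitz m) (\<lambda>k. a k - recip \<kappa> * w k))"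
proof -
  let ?T = "matrix_op (toeplitz m)" and ?T' = "matrix_op (toeplitz (\<lambda>k. m (- k)))"
  have ms: "m summable_on UNIV" using m by (simp add: doubly_hyperdominant_def)
  have ms': "(\<lambda>k. m (- k)) summable_on UNIV"
    using summable_on_reindex_bij_betw[of "uminus :: int \<Rightarrow> int" UNIV UNIV m] ms
    by (simp add: bij_uminus)
  note l = toeplitz_l2[OF ms a] toeplitz_l2[OF ms w] toeplitz_l2[OF ms' a] toeplitz_l2[OF ms' w]
  have "?T (\<lambda>k. a k - recip \<kappa> * w k) = (\<lambda>i. ?T a i - recip \<kappa> * ?T w i)"
    by (rule ext) (simp add: toeplitz_op_diff toeplitz_op_cmult ms a w l2_cmult)
  then have "l2_inner w (?T (\<lambda>k. a k - recip \<kappa> * w k)) = l2_inner w (?T a) - recip \<kappa> * l2_inner w (?T w)"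
    by (simp add: l2_inner_diff_right l2_inner_cmult_right l2_cmult l w)
  moreover have "l2_inner a (?T' w) = l2_inner w (?T a)" "l2_inner w (?T' w) = l2_inner w (?T w)"
    using toeplitz_adjoint[OF ms w a] toeplitz_adjoint[OF ms w w] by (simp_all add: l2_inner_commute)
  ultimately show ?thesis
    by (simp add: Pi_mult_def Let_def l2_inner_pair_def l2_adjoint_toeplitz[OF m w]
        l2_inner_diff_right l2_inner_cmult_right l2_inner_add_right l2_cmult l2_add l w a algebra_simps)
qed

text \<open>The multipliers with sequence \<open>\<delta> - \<mu>\<close> form a compact family: mass of \<open>\<mu>\<close> escaping to infinity is
  harmless because the signals it is tested against tend to zero.\<close>

definition hyper_seq :: "(int \<Rightarrow> real) \<Rightarrow> int \<Rightarrow> real" where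
  "hyper_seq \<mu> = (\<lambda>k. (if k = 0 then 1 else 0) - \<mu> k)"

lemma substochastic_summable:
  assumes "\<mu> \<in> substochastic"
  shows "\<mu> summable_on UNIV" and "infsum \<mu> UNIV \<le> 1"
proof -
  show s: "\<mu> summable_on UNIV"
    using assms by (intro nonneg_bdd_above_summable_on) (auto simp: substochastic_def bdd_above_def)
  show "infsum \<mu> UNIV \<le> 1"
    using assms by (intro infsum_le_finite_sums[OF s]) (auto simp: substochastic_def)
qed

lemma hyper_seq_hyperdominant:
  assumes "\<mu> \<in> substochastic"
  shows "doubly_hyperdominant (hyper_seq \<mu>)" and "toeplitz (hyper_seq \<mu>) \<in> multipliers1"
proof -
  have d: "((\<lambda>k::int. if k = 0 then 1 else 0 :: real) has_sum 1) UNIV"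
    by (rule has_sum_finite_neutralI[of "{0}"]) auto
  have "((\<lambda>k. - 1 * \<mu> k) has_sum (- 1 * infsum \<mu> UNIV)) UNIV"
    by (intro has_sum_cmult_right has_sum_infsum substochastic_summable assms)
  from has_sum_add[OF d this] have "(hyper_seq \<mu> has_sum (1 - infsum \<mu> UNIV)) UNIV"
    by (simp add: hyper_seq_def)
  then show h: "doubly_hyperdominant (hyper_seq \<mu>)"
    using assms substochastic_summable(2)[OF assms] unfolding doubly_hyperdominant_def
    by (auto simp: has_sum_iff hyper_seq_def substochastic_def)
  have "toeplitz (hyper_seq \<mu>) 0 0 \<le> 1"
    using assms by (simp add: toeplitz_def hyper_seq_def substochastic_def)
  with h show "toeplitz (hyper_seq \<mu>) \<in> multipliers1"
    unfolding multipliers1_def multipliers_def by auto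
qed

lemma substochastic_row:
  assumes mu: "\<mu> \<in> substochastic"
  shows "(\<Sum>j\<in>A. toeplitz \<mu> i j) \<le> 1"
proof (cases "finite A")
  case True
  have "(\<Sum>j\<in>A. toeplitz \<mu> i j) = sum \<mu> ((\<lambda>j. int i - int j) ` A)"
    by (subst sum.reindex) (auto simp: inj_on_def toeplitz_def)
  then show ?thesis using mu True by (simp add: substochastic_def)
qed simp

lemma toeplitz_hyper_seq_op:
  assumes mu: "\<mu> \<in> substochastic" and z: "z \<in> l2"
  shows "matrix_op (toeplitz (hyper_seq \<mu>)) z i = z i - matrix_op (toeplitz \<mu>) z i"
proof -
  have "(\<lambda>j. (if j = i then z j else 0)) sums z i"
    using sums_single[of i "\<lambda>j. z j"] by simp
  moreover have "(\<lambda>j. toeplitz \<mu> i j * z j) sums matrix_op (toeplitz \<mu>) z i"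
    unfolding matrix_op_def by (intro summable_sums toeplitz_op_summable substochastic_summable assms)
  ultimately have "(\<lambda>j. (if j = i then z j else 0) - toeplitz \<mu> i j * z j)
      sums (z i - matrix_op (toeplitz \<mu>) z i)"
    by (rule sums_diff)
  moreover have "(\<lambda>j. (if j = i then z j else 0) - toeplitz \<mu> i j * z j)
      = (\<lambda>j. toeplitz (hyper_seq \<mu>) i j * z j)"
    by (auto simp: toeplitz_def hyper_seq_def algebra_simps)
  ultimately show ?thesis by (simp add: matrix_op_def sums_iff)
qed

text \<open>Partial sums depend on finitely many coordinates of \<open>\<mu>\<close> and converge
  uniformly in \<open>\<mu>\<close>: beyond \<open>J0\<close> the entries of \<open>z\<close> are
  small, while each row of weights has mass at most 1.\<close>

lemma continuous_on_toeplitz_op: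
  assumes z: "z \<in> l2"
  shows "continuous_on substochastic (\<lambda>\<mu>. matrix_op (toeplitz \<mu>) z i)"
proof (rule uniform_limit_theorem)
  show "\<forall>\<^sub>F J in sequentially. continuous_on substochastic (\<lambda>\<mu>. \<Sum>j<J. toeplitz \<mu> i j * z j)"
    unfolding toeplitz_def
    by (intro always_eventually allI continuous_intros
        continuous_on_subset[OF continuous_on_product_coordinates]) auto
  show "uniform_limit substochastic (\<lambda>J \<mu>. \<Sum>j<J. toeplitz \<mu> i j * z j)
      (\<lambda>\<mu>. matrix_op (toeplitz \<mu>) z i) sequentially"
  proof (rule uniform_limitI)
    fix e :: real assume e: "e > 0"
    obtain J0 where J0: "\<And>j. j \<ge> J0 \<Longrightarrow> \<bar>z j\<bar> < e / 2"
      using LIMSEQ_D[OF l2_tendsto_0[OF z], of "e / 2"] e by auto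
    have "dist (\<Sum>j<J. toeplitz \<mu> i j * z j) (matrix_op (toeplitz \<mu>) z i) < e"
      if J: "J \<ge> J0" and mu: "\<mu> \<in> substochastic" for J \<mu>
    proof -
      have nn: "toeplitz \<mu> i j \<ge> 0" for j using mu by (simp add: toeplitz_def substochastic_def)
      have fin: "\<bar>(\<Sum>j<N. toeplitz \<mu> i j * z j) - (\<Sum>j<J. toeplitz \<mu> i j * z j)\<bar> \<le> e / 2"
        if "N \<ge> J" for N
      proof -
        have "(\<Sum>j<N. toeplitz \<mu> i j * z j) - (\<Sum>j<J. toeplitz \<mu> i j * z j)
            = (\<Sum>j\<in>{..<N} - {..<J}. toeplitz \<mu> i j * z j)"
          using that by (subst sum_diff) auto
        also have "\<bar>\<dots>\<bar> \<le> (\<Sum>j\<in>{..<N} - {..<J}. toeplitz \<mu> i j * (e / 2))"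
          using J0 J nn by (intro order_trans[OF sum_abs] sum_mono)
            (simp add: abs_mult not_less mult_left_mono less_imp_le del: times_divide_eq_right)
        also have "\<dots> = (\<Sum>j\<in>{..<N} - {..<J}. toeplitz \<mu> i j) * (e / 2)"
          by (rule sum_distrib_right[symmetric])
        also have "\<dots> \<le> 1 * (e / 2)"
          using e by (intro mult_right_mono substochastic_row[OF mu]) auto
        finally show ?thesis by simp
      qed
      have "(\<lambda>N. \<bar>(\<Sum>j<N. toeplitz \<mu> i j * z j) - (\<Sum>j<J. toeplitz \<mu> i j * z j)\<bar>)
          \<longlonglongrightarrow> \<bar>matrix_op (toeplitz \<mu>) z i - (\<Sum>j<J. toeplitz \<mu> i j * z j)\<bar>"
        unfolding matrix_op_def
        by (intro tendsto_intros summable_LIMSEQ toeplitz_op_summable substochastic_summable mu z)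
      then have "\<bar>matrix_op (toeplitz \<mu>) z i - (\<Sum>j<J. toeplitz \<mu> i j * z j)\<bar> \<le> e / 2"
        by (rule LIMSEQ_le_const2) (use fin in blast)
      then show ?thesis using e by (simp add: dist_real_def abs_minus_commute)
    qed
    then show "\<forall>\<^sub>F J in sequentially. \<forall>\<mu>\<in>substochastic.
        dist (\<Sum>j<J. toeplitz \<mu> i j * z j) (matrix_op (toeplitz \<mu>) z i) < e"
      unfolding eventually_sequentially by blast
  qed
qed simp

text \<open>Both sides are continuous in the \<open>l2\<close> norm, so the inequality passes from
  cut-offs of \<open>w\<close> to \<open>w\<close>. Hence a violated inequality is already violated
  by a finitely supported signal, which can later be periodized.\<close>

lemma multiplier_condition_by_density:
  fixes c \<epsilon> :: real
  assumes lin: "linear_system G" and bdd: "l2_bounded G" and m: "doubly_hyperdominant m"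
    and fin: "\<And>w n. (\<And>k. k \<ge> n \<Longrightarrow> w k = 0) \<Longrightarrow>
      2 * l2_inner w (matrix_op (toeplitz m) (\<lambda>k. G w k - c * w k)) \<le> - \<epsilon> * l2_inner w w"
    and w: "w \<in> l2"
  shows "2 * l2_inner w (matrix_op (toeplitz m) (\<lambda>k. G w k - c * w k)) \<le> - \<epsilon> * l2_inner w w"
proof -
  have ms: "m summable_on UNIV" using m by (simp add: doubly_hyperdominant_def)
  obtain g where Gl2: "\<And>x. x \<in> l2 \<Longrightarrow> G x \<in> l2"
    and g: "\<And>x. x \<in> l2 \<Longrightarrow> l2_norm (G x) \<le> g * l2_norm x"
    using bdd unfolding l2_bounded_def by blast
  define z where "z x = (\<lambda>k. G x k - c * x k)" for x
  define P where "P N = (\<lambda>k. if k < N then w k else 0)" for N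
  define R where "R N = (\<lambda>k. w k - P N k)" for N
  have Pl: "P N \<in> l2" for N by (rule finite_support_l2[of N]) (simp add: P_def)
  have Rl: "R N \<in> l2" for N unfolding R_def by (intro l2_diff w Pl)
  have zl: "z x \<in> l2" if "x \<in> l2" for x unfolding z_def using that by (intro l2_diff l2_cmult Gl2)
  have zR: "z (R N) = (\<lambda>k. z w k - z (P N) k)" for N
  proof -
    have "G (\<lambda>k. 1 * w k + (- 1) * P N k) = (\<lambda>k. 1 * G w k + (- 1) * G (P N) k)"
      using lin unfolding linear_system_def by blast
    then show ?thesis by (auto simp: z_def R_def algebra_simps)
  qed
  \<comment> \<open>From \<open>(a - b)\<^sup>2 \<le> 2 * a\<^sup>2 + 2 * b\<^sup>2\<close>.\<close>
  define B where "B = 2 * g\<^sup>2 + 2 * c\<^sup>2"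
  have zE: "l2_inner (z x) (z x) \<le> B * l2_inner x x" if x: "x \<in> l2" for x
  proof -
    have "l2_norm (G x) ^ 2 \<le> (g * l2_norm x) ^ 2"
      using g[OF x] l2_inner_self_nonneg[OF Gl2[OF x]] by (intro power_mono) (auto simp: l2_norm_def)
    then have gE: "l2_inner (G x) (G x) \<le> g\<^sup>2 * l2_inner x x"
      by (simp add: power_mult_distrib l2_norm_squared Gl2 x)
    have "l2_inner (z x) (z x) \<le> (\<Sum>k. 2 * (G x k * G x k) + 2 * c\<^sup>2 * (x k * x k))"
      unfolding l2_inner_def
    proof (rule suminf_le)
      show "z x k * z x k \<le> 2 * (G x k * G x k) + 2 * c\<^sup>2 * (x k * x k)" for k
        using zero_le_power2[of "G x k + c * x k"]
        by (simp add: z_def power2_eq_square algebra_simps)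
    qed (intro l2_summable_mult zl x Gl2 summable_add summable_mult)+
    also have "\<dots> = 2 * l2_inner (G x) (G x) + 2 * c\<^sup>2 * l2_inner x x"
      unfolding l2_inner_def
      by (simp add: suminf_add[symmetric] suminf_mult summable_mult l2_summable_mult x Gl2)
    also have "\<dots> \<le> B * l2_inner x x" using gE by (simp add: B_def algebra_simps)
    finally show ?thesis .
  qed
  let ?M = "matrix_op (toeplitz m)"
  define S where "S N = (\<Sum>i<N. w i * ?M (z w) i)" for N
  \<comment> \<open>\<open>S N - D N\<close> is the form at the cut-off signal \<open>P N\<close>.
    The error \<open>D N\<close> stems from the response to the discarded remainder
    \<open>R N\<close> and vanishes by Cauchy-Schwarz.\<close>
  define D where "D N = (\<Sum>i<N. w i * ?M (z (R N)) i)" for N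
  have S: "S \<longlonglongrightarrow> l2_inner w (?M (z w))"
    unfolding S_def l2_inner_def by (intro summable_LIMSEQ l2_summable_mult w toeplitz_l2 ms zl)
  have E: "(\<lambda>N. \<Sum>k<N. w k * w k) \<longlonglongrightarrow> l2_inner w w"
    unfolding l2_inner_def by (intro summable_LIMSEQ l2_summable_mult w)
  have RE: "l2_inner (R N) (R N) = l2_inner w w - (\<Sum>k<N. w k * w k)" for N
  proof -
    have "(\<lambda>k. w k * w k) sums l2_inner w w"
      unfolding l2_inner_def by (intro summable_sums l2_summable_mult w)
    moreover have "(\<lambda>k. if k \<in> {..<N} then w k * w k else 0) sums (\<Sum>k<N. w k * w k)"
      by (rule sums_If_finite_set) simp
    ultimately have "(\<lambda>k. w k * w k - (if k \<in> {..<N} then w k * w k else 0))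
        sums (l2_inner w w - (\<Sum>k<N. w k * w k))" by (rule sums_diff)
    moreover have "(\<lambda>k. w k * w k - (if k \<in> {..<N} then w k * w k else 0)) = (\<lambda>k. R N k * R N k)"
      by (auto simp: R_def P_def)
    ultimately show ?thesis by (simp add: l2_inner_def sums_iff)
  qed
  define K where "K = (\<Sum>\<^sub>\<infinity>k. \<bar>m k\<bar>)\<^sup>2"
  have DB: "(D N)\<^sup>2 \<le> l2_inner w w * (K * (B * l2_inner (R N) (R N)))" for N
  proof -
    have "(D N)\<^sup>2 \<le> (\<Sum>i<N. (w i)\<^sup>2) * (\<Sum>i<N. (?M (z (R N)) i)\<^sup>2)"
      unfolding D_def by (rule sum_Cauchy_Schwarz)
    also have "\<dots> \<le> l2_inner w w * (K * (B * l2_inner (R N) (R N)))"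
    proof (intro mult_mono l2_partial_energy w)
      have "(\<Sum>i<N. (?M (z (R N)) i)\<^sup>2) \<le> K * l2_inner (z (R N)) (z (R N))"
        unfolding K_def by (intro toeplitz_op_energy ms zl Rl)
      also have "\<dots> \<le> K * (B * l2_inner (R N) (R N))"
        by (intro mult_left_mono zE Rl) (simp add: K_def)
      finally show "(\<Sum>i<N. (?M (z (R N)) i)\<^sup>2) \<le> K * (B * l2_inner (R N) (R N))" .
    qed (auto intro: sum_nonneg l2_inner_self_nonneg w)
    finally show ?thesis .
  qed
  have "(\<lambda>N. l2_inner w w * (K * (B * l2_inner (R N) (R N))))
      \<longlonglongrightarrow> l2_inner w w * (K * (B * (l2_inner w w - l2_inner w w)))"
    unfolding RE by (intro tendsto_intros E)
  then have lim: "(\<lambda>N. l2_inner w w * (K * (B * l2_inner (R N) (R N)))) \<longlonglongrightarrow> 0" by simp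
  have "(\<lambda>N. (D N)\<^sup>2) \<longlonglongrightarrow> 0"
    by (rule tendsto_sandwich[OF _ _ tendsto_const lim]) (simp_all add: DB)
  then have "(\<lambda>N. sqrt ((D N)\<^sup>2)) \<longlonglongrightarrow> sqrt 0" by (rule tendsto_real_sqrt)
  then have D: "D \<longlonglongrightarrow> 0" by (simp add: tendsto_rabs_zero_iff)
  have le: "2 * (S N - D N) \<le> - \<epsilon> * (\<Sum>k<N. w k * w k)" for N
  proof -
    have "l2_inner (P N) (?M (z (P N))) = (\<Sum>i<N. P N i * ?M (z (P N)) i)"
      by (rule l2_inner_finite_support) (simp add: P_def)
    also have "\<dots> = S N - D N"
    proof -
      have "?M (z (R N)) i = ?M (z w) i - ?M (z (P N)) i" for i
        by (simp add: zR toeplitz_op_diff ms zl w Pl)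
      then have "P N i * ?M (z (P N)) i = w i * ?M (z w) i - w i * ?M (z (R N)) i" if "i < N" for i
      proof -
        have "P N i = w i" using that by (simp add: P_def)
        then show ?thesis using \<open>\<And>i. ?M (z (R N)) i = _\<close>[of i] by (simp only: right_diff_distrib)
      qed
      then show ?thesis by (simp add: S_def D_def sum_subtractf)
    qed
    finally have "l2_inner (P N) (?M (z (P N))) = S N - D N" .
    moreover have "l2_inner (P N) (P N) = (\<Sum>k<N. w k * w k)"
      by (subst l2_inner_finite_support[of N]) (auto simp: P_def)
    ultimately show ?thesis using fin[of N "P N"] by (simp add: z_def P_def)
  qed
  have "2 * (l2_inner w (?M (z w)) - 0) \<le> - \<epsilon> * l2_inner w w"
  proof (rule LIMSEQ_le)
    show "(\<lambda>N. 2 * (S N - D N)) \<longlonglongrightarrow> 2 * (l2_inner w (?M (z w)) - 0)"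
      by (intro tendsto_intros S D)
    show "(\<lambda>N. - \<epsilon> * (\<Sum>k<N. w k * w k)) \<longlonglongrightarrow> - \<epsilon> * l2_inner w w"
      by (intro tendsto_intros E)
  qed (use le in blast)
  then show ?thesis by (simp add: z_def)
qed

text \<open>Extension by 0 to negative times, so that signals can be shifted by arbitrary
  integers.\<close>

definition zext :: "(nat \<Rightarrow> real) \<Rightarrow> int \<Rightarrow> real" where
  "zext z t = (if t < 0 then 0 else z (nat t))"

lemma toeplitz_point_op:
  "matrix_op (toeplitz (\<lambda>k. if k = j then 1 else 0)) z i = zext z (int i - j)"
proof (cases "int i - j < 0")
  case True
  then have "toeplitz (\<lambda>k. if k = j then 1 else 0 :: real) i l = 0" for l by (auto simp: toeplitz_def)
  then show ?thesis using True by (simp add: matrix_op_def zext_def)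
next
  case False
  have "matrix_op (toeplitz (\<lambda>k. if k = j then 1 else 0)) z i
      = (\<Sum>l\<in>{nat (int i - j)}. toeplitz (\<lambda>k. if k = j then 1 else 0) i l * z l)"
    unfolding matrix_op_def by (rule suminf_finite) (use False in \<open>auto simp: toeplitz_def\<close>)
  then show ?thesis using False by (simp add: toeplitz_def zext_def)
qed

lemma toeplitz_mix_op:
  assumes "\<mu> \<in> substochastic" "\<nu> \<in> substochastic" "z \<in> l2"
  shows "matrix_op (toeplitz (\<lambda>j. (1 - t) * \<mu> j + t * \<nu> j)) z i
    = (1 - t) * matrix_op (toeplitz \<mu>) z i + t * matrix_op (toeplitz \<nu>) z i"
proof -
  have "(\<lambda>j. (1 - t) * (toeplitz \<mu> i j * z j) + t * (toeplitz \<nu> i j * z j))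
      sums ((1 - t) * matrix_op (toeplitz \<mu>) z i + t * matrix_op (toeplitz \<nu>) z i)"
    unfolding matrix_op_def
    by (intro sums_add sums_mult summable_sums toeplitz_op_summable substochastic_summable assms)
  then show ?thesis
    by (simp add: matrix_op_def toeplitz_def sums_iff algebra_simps)
qed

text \<open>Each multiplier with sequence \<open>\<delta> - \<mu>\<close> is violated by some
  signal; minimax turns this into one finite weighted family that violates all of them at
  once.\<close>

lemma dual_certificate:
  fixes c \<epsilon> :: real
  assumes lin: "linear_system G" and bdd: "l2_bounded G"
    and none: "\<not> (\<exists>M\<in>multipliers1. \<forall>w\<in>l2.
           l2_inner_pair (G w, w) (Pi_mult M 0 \<kappa> (G w, w)) \<le> - \<epsilon> * (l2_norm w)\<^sup>2)"
    and c: "c = recip \<kappa>"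
  obtains p n and v :: "nat \<Rightarrow> nat \<Rightarrow> real" where "\<And>i k. k \<ge> n \<Longrightarrow> v i k = 0"
    and "2 * (\<Sum>i<p. \<Sum>s<n. v i s * (G (v i) s - c * v i s)) > - \<epsilon> * (\<Sum>i<p. \<Sum>s<n. (v i s)\<^sup>2)"
    and "\<And>j. 2 * (\<Sum>i<p. \<Sum>s<n. v i s *
        ((G (v i) s - c * v i s) - zext (\<lambda>k. G (v i) k - c * v i k) (int s - j)))
      > - \<epsilon> * (\<Sum>i<p. \<Sum>s<n. (v i s)\<^sup>2)"
proof -
  define z where "z x = (\<lambda>k. G x k - c * x k)" for x
  define W where "W = {w::nat \<Rightarrow> real. \<exists>n. \<forall>k\<ge>n. w k = 0}"
  \<comment> \<open>\<open>F w \<mu> > 0\<close> says that \<open>w\<close> violates the inequality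
    for \<open>\<mu>\<close>. For fixed \<open>w\<close> this excess is affine and continuous in
    \<open>\<mu>\<close>, as minimax demands.\<close>
  define F where "F w \<mu> = 2 * l2_inner w (matrix_op (toeplitz (hyper_seq \<mu>)) (z w)) + \<epsilon> * l2_inner w w"
    for w \<mu>
  have Wl: "w \<in> l2" if "w \<in> W" for w
    using that finite_support_l2 unfolding W_def by blast
  have Gl2: "G x \<in> l2" if "x \<in> l2" for x using bdd that unfolding l2_bounded_def by blast
  have zl: "z x \<in> l2" if "x \<in> l2" for x unfolding z_def using that by (intro l2_diff l2_cmult Gl2)
  have Fn: "F w \<mu> = 2 * (\<Sum>s<n. w s * (z w s - matrix_op (toeplitz \<mu>) (z w) s)) + \<epsilon> * (\<Sum>s<n. (w s)\<^sup>2)"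
    if "\<mu> \<in> substochastic" "\<And>k. k \<ge> n \<Longrightarrow> w k = 0" for w \<mu> n
    using that finite_support_l2[of n w]
    by (simp add: F_def l2_inner_finite_support[of n w] toeplitz_hyper_seq_op zl power2_eq_square)
  obtain I a where I: "finite I" "I \<subseteq> W" "\<And>w. w \<in> I \<Longrightarrow> 0 \<le> a w"
    and pos: "\<And>\<mu>. \<mu> \<in> substochastic \<Longrightarrow> (\<Sum>w\<in>I. a w * F w \<mu>) > 0"
  proof (rule compact_minimax[where F = F and W = W, OF compact_substochastic])
    show "continuous_on substochastic (F w)" if w: "w \<in> W" for w
    proof -
      obtain n where n: "\<And>k. k \<ge> n \<Longrightarrow> w k = 0" using w by (auto simp: W_def)
      have "continuous_on substochastic (\<lambda>\<mu>. 2 * (\<Sum>s<n. w s * (z w s - matrix_op (toeplitz \<mu>) (z w) s))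
          + \<epsilon> * (\<Sum>s<n. (w s)\<^sup>2))"
        by (intro continuous_intros continuous_on_toeplitz_op zl Wl w)
      then show ?thesis by (rule continuous_on_eq) (simp add: Fn[OF _ n])
    qed
    show "\<exists>\<mu>\<in>substochastic. \<forall>w\<in>W. F w \<mu> = (1 - t) * F w x + t * F w y"
      if xy: "x \<in> substochastic" "y \<in> substochastic" and t: "0 \<le> t" "t \<le> 1" for x y t
    proof (intro bexI ballI)
      let ?\<mu> = "\<lambda>j. (1 - t) * x j + t * y j"
      show mu: "?\<mu> \<in> substochastic" by (rule substochastic_mix[OF xy t])
      fix w assume w: "w \<in> W"
      obtain n where n: "\<And>k. k \<ge> n \<Longrightarrow> w k = 0" using w by (auto simp: W_def)
      have "w s * (z w s - matrix_op (toeplitz ?\<mu>) (z w) s)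
          = (1 - t) * (w s * (z w s - matrix_op (toeplitz x) (z w) s))
            + t * (w s * (z w s - matrix_op (toeplitz y) (z w) s))" for s
        unfolding toeplitz_mix_op[OF xy zl[OF Wl[OF w]]] by (simp add: algebra_simps)
      then have "(\<Sum>s<n. w s * (z w s - matrix_op (toeplitz ?\<mu>) (z w) s))
          = (1 - t) * (\<Sum>s<n. w s * (z w s - matrix_op (toeplitz x) (z w) s))
            + t * (\<Sum>s<n. w s * (z w s - matrix_op (toeplitz y) (z w) s))"
        by (simp only: sum.distrib sum_distrib_left)
      moreover have comb: "2 * ((1 - t) * a + t * b) + e = (1 - t) * (2 * a + e) + t * (2 * b + e)"
        for a b e :: real by (simp add: algebra_simps)
      moreover note Fn[OF mu n] Fn[OF xy(1) n] Fn[OF xy(2) n]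
      ultimately have "F w ?\<mu> = 2 * ((1 - t) * (\<Sum>s<n. w s * (z w s - matrix_op (toeplitz x) (z w) s))
            + t * (\<Sum>s<n. w s * (z w s - matrix_op (toeplitz y) (z w) s))) + \<epsilon> * (\<Sum>s<n. (w s)\<^sup>2)"
        "F w x = 2 * (\<Sum>s<n. w s * (z w s - matrix_op (toeplitz x) (z w) s)) + \<epsilon> * (\<Sum>s<n. (w s)\<^sup>2)"
        "F w y = 2 * (\<Sum>s<n. w s * (z w s - matrix_op (toeplitz y) (z w) s)) + \<epsilon> * (\<Sum>s<n. (w s)\<^sup>2)"
        by simp_all
      then show "F w ?\<mu> = (1 - t) * F w x + t * F w y"
        by (simp only: comb)
    qed
    show "\<exists>w\<in>W. F w \<mu> > 0" if mu: "\<mu> \<in> substochastic" for \<mu>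
    proof (rule ccontr)
      assume "\<not> ?thesis"
      then have neg: "F w \<mu> \<le> 0" if "w \<in> W" for w using that by (meson not_less)
      have "2 * l2_inner w (matrix_op (toeplitz (hyper_seq \<mu>)) (\<lambda>k. G w k - c * w k)) \<le> - \<epsilon> * l2_inner w w"
        if w: "w \<in> l2" for w
      proof (rule multiplier_condition_by_density[OF lin bdd hyper_seq_hyperdominant(1)[OF mu] _ w])
        fix w :: "nat \<Rightarrow> real" and n assume "\<And>k. k \<ge> n \<Longrightarrow> w k = 0"
        then have "w \<in> W" by (auto simp: W_def)
        from neg[OF this]
        show "2 * l2_inner w (matrix_op (toeplitz (hyper_seq \<mu>)) (\<lambda>k. G w k - c * w k)) \<le> - \<epsilon> * l2_inner w w"
          by (simp add: F_def z_def)
      qed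
      then have "\<forall>w\<in>l2. l2_inner_pair (G w, w) (Pi_mult (toeplitz (hyper_seq \<mu>)) 0 \<kappa> (G w, w))
          \<le> - \<epsilon> * (l2_norm w)\<^sup>2"
        by (simp add: Pi_mult_form[OF hyper_seq_hyperdominant(1)[OF mu]] Gl2 c l2_norm_squared)
      then show False using none hyper_seq_hyperdominant(2)[OF mu] by blast
    qed
  qed (use that in blast)
  obtain n where n: "\<And>w k. w \<in> I \<Longrightarrow> k \<ge> n \<Longrightarrow> w k = 0"
  proof -
    have "\<forall>w\<in>I. \<exists>n. \<forall>k\<ge>n. w k = 0" using I(2) by (auto simp: W_def)
    then obtain N where N: "\<And>w k. w \<in> I \<Longrightarrow> k \<ge> N w \<Longrightarrow> w k = 0" by metis
    have "w k = 0" if "w \<in> I" "k \<ge> Max (insert 0 (N ` I))" for w k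
    proof -
      have "N w \<le> Max (insert 0 (N ` I))" using I(1) that(1) by (intro Max_ge) auto
      then show ?thesis using N that by simp
    qed
    then show thesis by (rule that)
  qed
  obtain b where b: "bij_betw b {..<card I} I"
    using ex_bij_betw_nat_finite[OF I(1)] by (auto simp: atLeast0LessThan)
  have bI: "b i \<in> I" if "i < card I" for i using b that by (auto simp: bij_betw_def)
  \<comment> \<open>\<open>F\<close> is quadratic in the signal, so scaling by the square root of
    the weight absorbs the weight.\<close>
  define v where "v i = (\<lambda>k. if i < card I then sqrt (a (b i)) * b i k else 0)" for i
  have v0: "v i k = 0" if "k \<ge> n" for i k using n[OF bI that] by (simp add: v_def)
  have zv: "z (v i) = (\<lambda>k. sqrt (a (b i)) * z (b i) k)" if "i < card I" for i
  proof -
    have "G (\<lambda>k. sqrt (a (b i)) * b i k + 0 * b i k) = (\<lambda>k. sqrt (a (b i)) * G (b i) k + 0 * G (b i) k)"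
      using lin unfolding linear_system_def by blast
    then show ?thesis using that by (simp add: v_def z_def algebra_simps)
  qed
  have main: "2 * (\<Sum>i<card I. \<Sum>s<n. v i s * (z (v i) s - matrix_op (toeplitz \<mu>) (z (v i)) s))
      > - \<epsilon> * (\<Sum>i<card I. \<Sum>s<n. (v i s)\<^sup>2)" if mu: "\<mu> \<in> substochastic" for \<mu>
  proof -
    have "a (b i) * F (b i) \<mu> = 2 * (\<Sum>s<n. v i s * (z (v i) s - matrix_op (toeplitz \<mu>) (z (v i)) s))
        + \<epsilon> * (\<Sum>s<n. (v i s)\<^sup>2)" if i: "i < card I" for i
    proof -
      define q where "q = sqrt (a (b i))"
      have a: "a (b i) = q * q" using I(3)[OF bI[OF i]] by (simp add: q_def)
      have v: "v i s = q * b i s" for s using i by (simp add: v_def q_def)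
      have z: "z (v i) s = q * z (b i) s" for s using zv[OF i] by (simp add: q_def)
      have "matrix_op (toeplitz \<mu>) (z (v i)) s = q * matrix_op (toeplitz \<mu>) (z (b i)) s" for s
        unfolding zv[OF i] q_def[symmetric] using bI[OF i] I(2)
        by (intro toeplitz_op_cmult substochastic_summable mu zl Wl) auto
      with v z have t: "v i s * (z (v i) s - matrix_op (toeplitz \<mu>) (z (v i)) s)
          = a (b i) * (b i s * (z (b i) s - matrix_op (toeplitz \<mu>) (z (b i)) s))"
        "(v i s)\<^sup>2 = a (b i) * (b i s)\<^sup>2" for s
        unfolding a by (simp_all add: power2_eq_square algebra_simps)
      have "F (b i) \<mu> = 2 * (\<Sum>s<n. b i s * (z (b i) s - matrix_op (toeplitz \<mu>) (z (b i)) s))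
          + \<epsilon> * (\<Sum>s<n. (b i s)\<^sup>2)" by (rule Fn[OF mu n[OF bI[OF i]]])
      then show ?thesis unfolding t by (simp only: sum_distrib_left[symmetric]) (simp add: distrib_left)
    qed
    then have "(\<Sum>i<card I. a (b i) * F (b i) \<mu>)
        = (\<Sum>i<card I. 2 * (\<Sum>s<n. v i s * (z (v i) s - matrix_op (toeplitz \<mu>) (z (v i)) s))
        + \<epsilon> * (\<Sum>s<n. (v i s)\<^sup>2))" by simp
    moreover have "(\<Sum>i<card I. a (b i) * F (b i) \<mu>) = (\<Sum>w\<in>I. a w * F w \<mu>)"
      using sum.reindex_bij_betw[OF b] .
    ultimately have "(\<Sum>w\<in>I. a w * F w \<mu>)
        = 2 * (\<Sum>i<card I. \<Sum>s<n. v i s * (z (v i) s - matrix_op (toeplitz \<mu>) (z (v i)) s))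
          + \<epsilon> * (\<Sum>i<card I. \<Sum>s<n. (v i s)\<^sup>2)"
      by (simp only: sum.distrib sum_distrib_left)
    then show ?thesis using pos[OF mu] by simp
  qed
  \<comment> \<open>The weights \<open>\<mu> = 0\<close> and a unit mass at \<open>j\<close> give
    the identity and the identity minus the shift by \<open>j\<close>.\<close>
  show thesis
  proof (rule that[where v = v and p = "card I" and n = n, OF v0])
    have "matrix_op (toeplitz (\<lambda>_. 0)) x i = 0" for x i by (simp add: matrix_op_def toeplitz_def)
    then show "2 * (\<Sum>i<card I. \<Sum>s<n. v i s * (G (v i) s - c * v i s)) > - \<epsilon> * (\<Sum>i<card I. \<Sum>s<n. (v i s)\<^sup>2)"
      using main[OF substochastic_zero] by (simp add: z_def)
    show "2 * (\<Sum>i<card I. \<Sum>s<n. v i s *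
        ((G (v i) s - c * v i s) - zext (\<lambda>k. G (v i) k - c * v i k) (int s - j)))
      > - \<epsilon> * (\<Sum>i<card I. \<Sum>s<n. (v i s)\<^sup>2)" for j
      using main[OF substochastic_point[of j]] unfolding toeplitz_point_op by (simp add: z_def)
  qed
qed

section \<open>Lower bounds for the gain\<close>

lemma l2_norm_trunc_vec:
  "l2_norm_vec (trunc_vec N x) = sqrt (\<Sum>k\<le>N. scalar_prod (x k) (x k))"
proof -
  have "(\<Sum>k. scalar_prod (trunc_vec N x k) (trunc_vec N x k))
      = (\<Sum>k\<le>N. scalar_prod (trunc_vec N x k) (trunc_vec N x k))"
    by (rule suminf_finite) (auto simp: trunc_vec_def)
  then show ?thesis by (simp add: l2_norm_vec_def l2_inner_vec_def trunc_vec_def)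
qed

text \<open>A single pair suffices when the energies grow linearly in time: division by the square
  root of \<open>N + 1\<close> removes the offset \<open>\<beta>\<close> and the transient
  \<open>B\<close> in the limit and leaves the ratio of the rates.\<close>

lemma gain_lower_bound:
  assumes xy: "(x, y) \<in> R" and "\<alpha> > 0" "\<delta> > 0"
    and x: "\<And>N. (\<Sum>k\<le>N. scalar_prod (x k) (x k)) \<le> \<alpha> * \<delta> * real (Suc N) + B"
    and y: "\<And>N. (\<Sum>k\<le>N. scalar_prod (y k) (y k)) \<ge> \<alpha> * real (Suc N)"
  shows "gain R \<ge> ereal (1 / sqrt \<delta>)"
  unfolding gain_def
proof (rule Inf_greatest, clarify)
  fix \<gamma> \<beta> :: real
  assume \<gamma>: "0 \<le> \<gamma>"
    and le: "\<forall>(x, y)\<in>R. \<forall>N. l2_norm_vec (trunc_vec N y) \<le> \<gamma> * l2_norm_vec (trunc_vec N x) + \<beta>"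
  have fin: "1 \<le> \<gamma> * sqrt (\<delta> + (B / \<alpha>) * inverse (real (Suc N)))
      + (\<beta> / sqrt \<alpha>) * sqrt (inverse (real (Suc N)))" for N
  proof -
    let ?r = "sqrt (\<alpha> * real (Suc N))"
    have r: "?r > 0" using \<open>\<alpha> > 0\<close> by simp
    have "?r \<le> l2_norm_vec (trunc_vec N y)" unfolding l2_norm_trunc_vec using y by simp
    also have "\<dots> \<le> \<gamma> * l2_norm_vec (trunc_vec N x) + \<beta>" using le xy by fast
    also have "\<dots> \<le> \<gamma> * sqrt (\<alpha> * \<delta> * real (Suc N) + B) + \<beta>"
      unfolding l2_norm_trunc_vec using x \<gamma> by (intro add_right_mono mult_left_mono) auto
    finally have "1 \<le> (\<gamma> * sqrt (\<alpha> * \<delta> * real (Suc N) + B) + \<beta>) / ?r" using r by simp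
    also have "\<dots> = \<gamma> * sqrt ((\<alpha> * \<delta> * real (Suc N) + B) / (\<alpha> * real (Suc N))) + \<beta> / ?r"
      by (simp only: real_sqrt_divide times_divide_eq_right) (rule add_divide_distrib)
    also have "(\<alpha> * \<delta> * real (Suc N) + B) / (\<alpha> * real (Suc N)) = \<delta> + (B / \<alpha>) * inverse (real (Suc N))"
      using \<open>\<alpha> > 0\<close> by (simp add: field_simps del: of_nat_Suc)
    also have "\<beta> / ?r = (\<beta> / sqrt \<alpha>) * sqrt (inverse (real (Suc N)))"
      by (simp add: real_sqrt_mult real_sqrt_inverse divide_inverse del: of_nat_Suc)
    finally show ?thesis .
  qed
  have "1 \<le> \<gamma> * sqrt (\<delta> + (B / \<alpha>) * 0) + (\<beta> / sqrt \<alpha>) * sqrt 0"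
  proof (rule LIMSEQ_le_const)
    show "(\<lambda>N. \<gamma> * sqrt (\<delta> + (B / \<alpha>) * inverse (real (Suc N)))
      + (\<beta> / sqrt \<alpha>) * sqrt (inverse (real (Suc N)))) \<longlonglongrightarrow> \<gamma> * sqrt (\<delta> + (B / \<alpha>) * 0) + (\<beta> / sqrt \<alpha>) * sqrt 0"
      by (intro tendsto_intros LIMSEQ_inverse_real_of_nat)
  qed (use fin in blast)
  then show "ereal (1 / sqrt \<delta>) \<le> ereal \<gamma>"
    using \<open>\<delta> > 0\<close> by (simp add: field_simps)
qed

section \<open>Normal cone multifunctions\<close>

text \<open>Convex combinations of \<open>0\<close> and \<open>y 0, \<dots>, y (T - 1)\<close>.\<close>

definition hull_point :: "nat \<Rightarrow> nat \<Rightarrow> (nat \<Rightarrow> real vec) \<Rightarrow> (nat \<Rightarrow> real) \<Rightarrow> real vec" where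
  "hull_point d T y \<mu> = vec d (\<lambda>i. \<Sum>k<T. \<mu> k * y k $ i)"

text \<open>The pairs with \<open>y \<in> K\<close> and \<open>z - c y\<close> in the normal cone of \<open>K\<close> at \<open>y\<close>, where \<open>K\<close> is the
  polytope above: for \<open>c > 0\<close> this is \<open>z \<mapsto> P\<^sub>K (z / c)\<close>, for \<open>c = 0\<close> the subdifferential of the
  support function of \<open>K\<close>.\<close>

definition hull_multi :: "nat \<Rightarrow> real \<Rightarrow> nat \<Rightarrow> (nat \<Rightarrow> real vec) \<Rightarrow> (real vec \<times> real vec) set" where
  "hull_multi d c T y = {(z, u). z \<in> carrier_vec d \<and> u \<in> hull_point d T y ` substochastic \<and>
     (\<forall>u'\<in>hull_point d T y ` substochastic.
        scalar_prod u' (z - c \<cdot>\<^sub>v u) \<le> scalar_prod u (z - c \<cdot>\<^sub>v u))}"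

lemma hull_point_carrier [simp]: "hull_point d T y \<mu> \<in> carrier_vec d"
  by (simp add: hull_point_def)

lemma scalar_prod_hull_point:
  assumes "w \<in> carrier_vec d" "\<And>k. y k \<in> carrier_vec d"
  shows "scalar_prod (hull_point d T y \<mu>) w = (\<Sum>k<T. \<mu> k * scalar_prod (y k) w)"
proof -
  have "scalar_prod (hull_point d T y \<mu>) w = (\<Sum>i<d. \<Sum>k<T. \<mu> k * (y k $ i * w $ i))"
    using assms by (simp add: scalar_prod_def hull_point_def atLeast0LessThan sum_distrib_right mult.assoc)
  also have "\<dots> = (\<Sum>k<T. \<mu> k * (\<Sum>i<d. y k $ i * w $ i))"
    by (subst sum.swap) (simp add: sum_distrib_left)
  finally show ?thesis using assms by (simp add: scalar_prod_def atLeast0LessThan)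
qed

text \<open>By \<open>max\<close>, the pairing \<open>scalar_prod u x\<close> is the value at
  \<open>x\<close> of the support function of the range. Each term of the cyclic sum is at most the
  increment of that function, and the increments telescope to 0.\<close>

lemma cyclically_monotone_maximal_pairing:
  assumes carrier: "\<And>x u. (x, u) \<in> F \<Longrightarrow> x \<in> carrier_vec d \<and> u \<in> carrier_vec d"
    and max: "\<And>x u x' u'. (x, u) \<in> F \<Longrightarrow> (x', u') \<in> F \<Longrightarrow> scalar_prod u' x \<le> scalar_prod u x"
  shows "cyclically_monotone F"
  unfolding cyclically_monotone_def
proof (intro allI impI, elim conjE)
  fix n :: nat and x u :: "nat \<Rightarrow> real vec"
  assume F: "\<forall>j\<in>{1..n}. (x j, u j) \<in> F" and cyc: "x (n + 1) = x 1"
  \<comment> \<open>\<open>u (n + 1)\<close> is unconstrained although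
    \<open>x (n + 1) = x 1\<close>, so the last index is wrapped to 1 by hand.\<close>
  define g where "g j = (if j = n + 1 then scalar_prod (u 1) (x 1) else scalar_prod (u j) (x j))" for j
  have "scalar_prod (u j) (x (j + 1) - x j) \<le> g (Suc j) - g j" if j: "j \<in> {1..n}" for j
  proof -
    have Fj: "(x j, u j) \<in> F" using F j by blast
    define i where "i = (if j = n then 1 else j + 1)"
    have i: "i \<in> {1..n}" "x (j + 1) = x i" using j cyc by (auto simp: i_def)
    then have Fi: "(x i, u i) \<in> F" using F by blast
    have "scalar_prod (u j) (x i - x j) = scalar_prod (u j) (x i) - scalar_prod (u j) (x j)"
      using carrier[OF Fj] carrier[OF Fi] by (intro scalar_prod_minus_distrib) auto
    also have "\<dots> \<le> scalar_prod (u i) (x i) - scalar_prod (u j) (x j)"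
      using max[OF Fi Fj] by simp
    also have "\<dots> = g (Suc j) - g j" using j by (auto simp: g_def i_def)
    finally show ?thesis unfolding i(2) .
  qed
  then have "(\<Sum>j = 1..n. scalar_prod (u j) (x (j + 1) - x j)) \<le> (\<Sum>j = 1..n. g (Suc j) - g j)"
    by (rule sum_mono)
  also have "\<dots> = g (Suc n) - g 1" by (rule sum_Suc_diff) simp
  also have "\<dots> \<le> 0" by (auto simp: g_def)
  finally show "(\<Sum>j = 1..n. scalar_prod (u j) (x (j + 1) - x j)) \<le> 0" .
qed

text \<open>The transform takes \<open>(z, u)\<close> to
  \<open>(z - recip \<kappa> \<cdot>\<^sub>v u, u)\<close>, a normal cone pair of the polytope, in
  which \<open>u\<close> maximizes the pairing.\<close>

lemma hull_multi_slope: "hull_multi d (recip \<kappa>) T y \<in> slope d 0 \<kappa>"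
proof -
  let ?f = "hull_multi d (recip \<kappa>) T y"
  have sub: "?f \<subseteq> carrier_vec d \<times> carrier_vec d" by (auto simp: hull_multi_def)
  have T: "x \<in> carrier_vec d \<and> u \<in> hull_point d T y ` substochastic \<and>
      (\<forall>u'\<in>hull_point d T y ` substochastic. scalar_prod u' x \<le> scalar_prod u x)"
    if xu: "(x, u) \<in> T_multi 0 \<kappa> ?f" for x u
  proof -
    obtain z w where f: "(z, w) \<in> ?f" and x: "x = z - recip \<kappa> \<cdot>\<^sub>v w" and u: "u = w - 0 \<cdot>\<^sub>v z"
      using xu unfolding T_multi_def by blast
    have c: "z \<in> carrier_vec d" "w \<in> carrier_vec d" using f sub by auto
    then have "u = w" unfolding u by auto
    then show ?thesis using f c unfolding x hull_multi_def by auto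
  qed
  have "cyclically_monotone (T_multi 0 \<kappa> ?f)"
  proof (rule cyclically_monotone_maximal_pairing[where d = d])
    show "scalar_prod u' x \<le> scalar_prod u x"
      if "(x, u) \<in> T_multi 0 \<kappa> ?f" "(x', u') \<in> T_multi 0 \<kappa> ?f" for x u x' u'
      using T[OF that(1)] T[OF that(2)] by blast
    show "x \<in> carrier_vec d \<and> u \<in> carrier_vec d" if "(x, u) \<in> T_multi 0 \<kappa> ?f" for x u
      using T[OF that] hull_point_carrier by blast
  qed
  with sub show ?thesis by (simp add: slope_def)
qed

text \<open>A suitable \<open>u\<close> minimizes \<open>c / 2 * |u|\<^sup>2 - <u, z>\<close> over
  the polytope: first-order optimality is the normal cone condition. This covers
  \<open>c = 0\<close> and \<open>c > 0\<close> alike; the minimum exists because the weights form a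
  compact set.\<close>

lemma hull_multi_total:
  assumes c: "c \<ge> 0" and y: "\<And>k. y k \<in> carrier_vec d"
  shows "total_multi d (hull_multi d c T y)"
proof -
  have "\<exists>u. (z, u) \<in> hull_multi d c T y" if z: "z \<in> carrier_vec d" for z
  proof -
    define U where "U = hull_point d T y"
    have Uc: "U \<mu> \<in> carrier_vec d" for \<mu> by (simp add: U_def)
    define J where "J \<mu> = c / 2 * scalar_prod (U \<mu>) (U \<mu>) - scalar_prod (U \<mu>) z" for \<mu>
    have UU: "scalar_prod (U \<mu>) (U \<mu>) = (\<Sum>k<T. \<mu> k * (\<Sum>l<T. \<mu> l * scalar_prod (y l) (y k)))" for \<mu>
      unfolding U_def scalar_prod_hull_point[OF hull_point_carrier y]
      by (simp add: comm_scalar_prod[OF y hull_point_carrier] scalar_prod_hull_point y)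
    have "continuous_on substochastic J"
      unfolding J_def UU unfolding U_def scalar_prod_hull_point[OF z y]
      by (intro continuous_intros continuous_on_subset[OF continuous_on_product_coordinates]) auto
    then obtain \<mu> where mu: "\<mu> \<in> substochastic" and min: "\<And>\<nu>. \<nu> \<in> substochastic \<Longrightarrow> J \<mu> \<le> J \<nu>"
      using continuous_attains_inf[OF compact_substochastic] substochastic_zero by (metis empty_iff)
    have "scalar_prod (U \<nu>) (z - c \<cdot>\<^sub>v U \<mu>) \<le> scalar_prod (U \<mu>) (z - c \<cdot>\<^sub>v U \<mu>)"
      if nu: "\<nu> \<in> substochastic" for \<nu>
    proof -
      define b where "b = scalar_prod (U \<mu>) (U \<mu>)"
      define b' where "b' = scalar_prod (U \<nu>) (U \<mu>)"
      define b'' where "b'' = scalar_prod (U \<nu>) (U \<nu>)"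
      \<comment> \<open>The one-sided derivative of \<open>J\<close> at \<open>\<mu>\<close> towards
        \<open>\<nu>\<close>, nonnegative at a minimum.\<close>
      define s where "s = c * (b' - b) - (scalar_prod (U \<nu>) z - scalar_prod (U \<mu>) z)"
      have ineq: "0 \<le> s + t * (c / 2 * (b - 2 * b' + b''))" if t: "0 < t" "t \<le> 1" for t
      proof -
        let ?\<xi> = "\<lambda>k. (1 - t) * \<mu> k + t * \<nu> k"
        have mix: "scalar_prod (U ?\<xi>) w = (1 - t) * scalar_prod (U \<mu>) w + t * scalar_prod (U \<nu>) w"
          if "w \<in> carrier_vec d" for w
          unfolding U_def scalar_prod_hull_point[OF that y]
          by (simp add: sum_distrib_left sum.distrib[symmetric] algebra_simps)
        have UUx: "scalar_prod (U ?\<xi>) (U ?\<xi>) = (1 - t) * ((1 - t) * b + t * b') + t * ((1 - t) * b' + t * b'')"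
          unfolding mix[OF Uc]
          by (subst (1 2) comm_scalar_prod[OF Uc Uc])
            (simp add: mix Uc b_def b'_def b''_def comm_scalar_prod[OF Uc[of \<mu>] Uc[of \<nu>]])
        have "J ?\<xi> - J \<mu> = t * (s + t * (c / 2 * (b - 2 * b' + b'')))"
          unfolding J_def UUx mix[OF z] b_def[symmetric] s_def by (simp add: field_simps)
        then have "0 \<le> t * (s + t * (c / 2 * (b - 2 * b' + b'')))"
          using min[OF substochastic_mix[OF mu nu, of t]] t by simp
        then show ?thesis using t by (simp add: zero_le_mult_iff)
      qed
      have "0 \<le> s"
      proof (rule tendsto_lowerbound)
        have "((\<lambda>t. s + t * (c / 2 * (b - 2 * b' + b''))) \<longlongrightarrow> s + 0 * (c / 2 * (b - 2 * b' + b''))) (at_right 0)"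
          by (intro tendsto_intros)
        then show "((\<lambda>t. s + t * (c / 2 * (b - 2 * b' + b''))) \<longlongrightarrow> s) (at_right 0)" by simp
        show "\<forall>\<^sub>F t in at_right 0. 0 \<le> s + t * (c / 2 * (b - 2 * b' + b''))"
        proof (rule eventually_mono)
          show "\<forall>\<^sub>F t in at_right (0::real). t \<in> {0<..<1}" by (rule eventually_at_right_real) simp
        qed (rule ineq, auto)
      qed simp
      have ex: "scalar_prod (U \<xi>) (z - c \<cdot>\<^sub>v U \<mu>) = scalar_prod (U \<xi>) z - c * scalar_prod (U \<xi>) (U \<mu>)" for \<xi>
        using scalar_prod_minus_distrib[OF Uc z, of "c \<cdot>\<^sub>v U \<mu>"] Uc
        by (simp add: scalar_prod_smult_distrib[OF Uc Uc])
      show ?thesis unfolding ex using \<open>0 \<le> s\<close> by (simp add: s_def b_def b'_def algebra_simps)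
    qed
    then show ?thesis using mu z unfolding hull_multi_def U_def by blast
  qed
  then show ?thesis unfolding total_multi_def by (auto simp: hull_multi_def)
qed

lemma hull_multi_zero:
  assumes "\<And>k. y k \<in> carrier_vec d"
  shows "(0\<^sub>v d, 0\<^sub>v d) \<in> hull_multi d c T y"
proof -
  have "hull_point d T y (\<lambda>_. 0) = 0\<^sub>v d" by (auto simp: hull_point_def)
  then have "0\<^sub>v d \<in> hull_point d T y ` substochastic"
    using substochastic_zero by (metis imageI)
  moreover have "0\<^sub>v d - c \<cdot>\<^sub>v 0\<^sub>v d = (0\<^sub>v d :: real vec)" by auto
  ultimately show ?thesis unfolding hull_multi_def by (auto simp: scalar_prod_right_zero)
qed

text \<open>A linear functional on a polytope attains its maximum at a generator;
  \<open>nonneg\<close> is the comparison with the generator 0.\<close>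

lemma hull_multi_vertex:
  assumes y: "\<And>k. y k \<in> carrier_vec d" and x: "x \<in> carrier_vec d" and t: "t < T"
    and max: "\<And>k. k < T \<Longrightarrow> scalar_prod (y k) x \<le> scalar_prod (y t) x"
    and nonneg: "0 \<le> scalar_prod (y t) x"
  shows "(x + c \<cdot>\<^sub>v y t, y t) \<in> hull_multi d c T y"
proof -
  let ?\<delta> = "\<lambda>k. if k = t then 1 else 0 :: real"
  have "hull_point d T y ?\<delta> = y t"
  proof (rule eq_vecI)
    fix i assume i: "i < dim_vec (y t)"
    have "(\<Sum>k<T. ?\<delta> k * y k $ i) = (\<Sum>k<T. if k = t then y k $ i else 0)"
      by (intro sum.cong) auto
    then show "hull_point d T y ?\<delta> $ i = y t $ i"
      using i t y[of t] by (simp add: hull_point_def)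
  qed (use y[of t] in \<open>auto simp: hull_point_def\<close>)
  then have mem: "y t \<in> hull_point d T y ` substochastic"
    using substochastic_point by (metis imageI)
  have eq: "x + c \<cdot>\<^sub>v y t - c \<cdot>\<^sub>v y t = x" using x y[of t] by auto
  have "scalar_prod (hull_point d T y \<mu>) x \<le> scalar_prod (y t) x" if mu: "\<mu> \<in> substochastic" for \<mu>
  proof -
    have "scalar_prod (hull_point d T y \<mu>) x \<le> (\<Sum>k<T. \<mu> k * scalar_prod (y t) x)"
      unfolding scalar_prod_hull_point[OF x y]
      using mu max by (intro sum_mono mult_left_mono) (auto simp: substochastic_def)
    also have "\<dots> = sum \<mu> {..<T} * scalar_prod (y t) x" by (simp add: sum_distrib_right)
    also have "\<dots> \<le> 1 * scalar_prod (y t) x"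
      using mu nonneg by (intro mult_right_mono) (auto simp: substochastic_def)
    finally show ?thesis by simp
  qed
  then show ?thesis unfolding hull_multi_def using mem eq x y[of t] by auto
qed

section \<open>Periodic signals\<close>

definition per :: "nat \<Rightarrow> (nat \<Rightarrow> real) \<Rightarrow> int \<Rightarrow> real" where
  "per T v t = v (nat (t mod int T))"

lemma per_mod [simp]: "per T v (t mod int T) = per T v t"
  by (simp add: per_def)

lemma per_of_nat: "s < T \<Longrightarrow> per T v (int s) = v s"
  by (simp add: per_def)

lemma per_cong: "a mod int T = b mod int T \<Longrightarrow> per T v a = per T v b"
  by (simp add: per_def)

lemma sum_periodic_shift:
  fixes f :: "int \<Rightarrow> real"
  assumes T: "T > 0" and f: "\<And>x. f (x mod int T) = f x"
  shows "(\<Sum>s<T. f (int s + a)) = (\<Sum>s<T. f (int s))"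
proof (rule sum.reindex_bij_witness[of _ "\<lambda>s. nat ((int s - a) mod int T)" "\<lambda>s. nat ((int s + a) mod int T)"])
  have lt: "nat (x mod int T) < T" for x using T by (simp add: nat_less_iff)
  have nn: "int (nat (x mod int T)) = x mod int T" for x using T by simp
  fix s assume s: "s \<in> {..<T}"
  then have sm: "int s mod int T = int s" by simp
  show "nat ((int (nat ((int s + a) mod int T)) - a) mod int T) = s"
    unfolding nn by (simp add: mod_diff_left_eq sm)
  show "nat ((int (nat ((int s - a) mod int T)) + a) mod int T) = s"
    unfolding nn by (simp add: mod_add_left_eq sm)
  show "nat ((int s + a) mod int T) \<in> {..<T}" "nat ((int s - a) mod int T) \<in> {..<T}" using lt by auto
  show "f (int (nat ((int s + a) mod int T))) = f (int s + a)" unfolding nn by (rule f)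
qed

lemma sum_per_squares:
  assumes "T > 0" "n \<le> T" "\<And>k. k \<ge> n \<Longrightarrow> v k = 0"
  shows "(\<Sum>s<T. (per T v (int s + a))\<^sup>2) = (\<Sum>s<n. (v s)\<^sup>2)"
proof -
  have "(\<Sum>s<T. (per T v (int s + a))\<^sup>2) = (\<Sum>s<T. (per T v (int s))\<^sup>2)"
    using sum_periodic_shift[of T "\<lambda>x. (per T v x)\<^sup>2" a] assms(1) by simp
  also have "\<dots> = (\<Sum>s<T. (v s)\<^sup>2)" by (simp add: per_of_nat)
  also have "\<dots> = (\<Sum>s<n. (v s)\<^sup>2)"
    by (rule sum.mono_neutral_right) (use assms in auto)
  finally show ?thesis .
qed

text \<open>The last \<open>T - n\<close> samples of each period are silent, so the periodic
  extension agrees with the extension by 0 back to time \<open>n - T\<close>.\<close>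

lemma per_eq_ext:
  assumes "n \<le> T" "\<And>k. k \<ge> n \<Longrightarrow> v k = 0" "int n - int T \<le> t" "t < int T"
  shows "per T v t = zext v t"
proof (cases "t < 0")
  case True
  have "t mod int T = (t + int T) mod int T" by simp
  also have "\<dots> = t + int T" using True assms by (intro mod_pos_pos_trivial) auto
  finally show ?thesis using True assms by (simp add: per_def zext_def)
qed (use assms in \<open>simp add: per_def zext_def\<close>)

definition autocorr :: "nat \<Rightarrow> (nat \<Rightarrow> real) \<Rightarrow> int \<Rightarrow> real" where
  "autocorr n v a = (\<Sum>s<n. v s * zext v (int s - a))"

lemma per_autocorr:
  assumes v: "\<And>k. k \<ge> n \<Longrightarrow> v k = 0" and "n \<le> T" "int n - int T \<le> a" "a \<le> int T - int n"
  shows "(\<Sum>s<T. per T v (int s) * per T v (int s - a)) = autocorr n v a"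
proof -
  have "(\<Sum>s<T. per T v (int s) * per T v (int s - a)) = (\<Sum>s<n. per T v (int s) * per T v (int s - a))"
    by (rule sum.mono_neutral_right) (use assms in \<open>auto simp: per_of_nat\<close>)
  also have "\<dots> = autocorr n v a"
    unfolding autocorr_def
  proof (intro sum.cong refl)
    fix s assume s: "s \<in> {..<n}"
    have "per T v (int s - a) = zext v (int s - a)"
      by (rule per_eq_ext[OF \<open>n \<le> T\<close> v]) (use s assms in auto)
    then show "per T v (int s) * per T v (int s - a) = v s * zext v (int s - a)"
      using s assms by (simp add: per_of_nat)
  qed
  finally show ?thesis .
qed

lemma autocorr_bound:
  assumes v: "\<And>k. k \<ge> n \<Longrightarrow> v k = 0"
  shows "\<bar>autocorr n v a\<bar> \<le> (\<Sum>s<n. (v s)\<^sup>2)"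
proof -
  \<comment> \<open>A period so long that the lag \<open>a\<close> causes no wrap-around. In cyclic
    form the shifted factor keeps its full energy, and Cauchy-Schwarz gives the bound.\<close>
  define T where "T = n + nat \<bar>a\<bar> + 1"
  have T: "T > 0" "n \<le> T" "int n - int T \<le> a" "a \<le> int T - int n" by (auto simp: T_def)
  have "(autocorr n v a)\<^sup>2 = (\<Sum>s<T. per T v (int s) * per T v (int s - a))\<^sup>2"
    using per_autocorr[of n v T a, OF v T(2-4)] by simp
  also have "\<dots> \<le> (\<Sum>s<T. (per T v (int s))\<^sup>2) * (\<Sum>s<T. (per T v (int s - a))\<^sup>2)"
    by (rule sum_Cauchy_Schwarz)
  also have "\<dots> = (\<Sum>s<n. (v s)\<^sup>2)\<^sup>2"
    using sum_per_squares[of T n v 0, OF T(1,2) v] sum_per_squares[of T n v "- a", OF T(1,2) v]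
    by (simp add: power2_eq_square)
  finally show ?thesis by (simp add: abs_le_square_iff[symmetric] sum_nonneg)
qed

lemma ext_convolution:
  assumes G: "\<And>t. y t = (\<Sum>l\<le>t. h l * v (t - l))" and B: "t < int B"
  shows "zext y t = (\<Sum>l<B. h l * zext v (t - int l))"
proof (cases "t < 0")
  case True
  then show ?thesis by (simp add: zext_def)
next
  case False
  have "(\<Sum>l<B. h l * zext v (t - int l)) = (\<Sum>l\<le>nat t. h l * zext v (t - int l))"
    by (rule sum.mono_neutral_right) (use False B in \<open>auto simp: zext_def\<close>)
  also have "\<dots> = (\<Sum>l\<le>nat t. h l * v (nat t - l))"
    by (intro sum.cong refl) (use False in \<open>auto simp: zext_def nat_diff_distrib'\<close>)
  finally show ?thesis using False by (simp add: zext_def G)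
qed

text \<open>Steady-state response of the impulse response \<open>h\<close>, truncated to length \<open>L\<close>.\<close>

definition fir :: "nat \<Rightarrow> (nat \<Rightarrow> real) \<Rightarrow> nat \<Rightarrow> (nat \<Rightarrow> real) \<Rightarrow> int \<Rightarrow> real" where
  "fir L h T v t = (\<Sum>l<L. h l * per T v (t - int l))"

lemma fir_mod [simp]: "fir L h T v (t mod int T) = fir L h T v t"
  unfolding fir_def by (intro sum.cong refl arg_cong2[of _ _ _ _ "(*)"] per_cong) (simp add: mod_diff_left_eq)

text \<open>The bounds on \<open>j\<close> delimit the lags for which the periodization causes no wrap-around.\<close>

lemma periodic_correlation:
  fixes c \<theta> :: real
  assumes G: "\<And>t. y t = (\<Sum>l\<le>t. h l * v (t - l))" and v: "\<And>k. k \<ge> n \<Longrightarrow> v k = 0"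
    and tail: "\<And>B. (\<Sum>l\<in>{L..<B}. \<bar>h l\<bar>) \<le> \<theta>"
    and T: "2 * n + L \<le> T" and j: "int n - int T \<le> j" "j \<le> int n"
  shows "\<bar>(\<Sum>s<T. per T v (int s) * (fir L h T v (int s - j) - c * per T v (int s - j)))
      - (\<Sum>s<n. v s * zext (\<lambda>k. y k - c * v k) (int s - j))\<bar> \<le> \<theta> * (\<Sum>s<n. (v s)\<^sup>2)"
proof -
  \<comment> \<open>Exceeds every time \<open>s - j\<close> with \<open>s < n\<close>, so the
    convolution up to \<open>B\<close> is complete; it also exceeds \<open>L\<close>, so the tail
    can be split off.\<close>
  define B where "B = L + n + nat (- j) + 1"
  let ?q = "autocorr n v"
  have "(\<Sum>s<T. per T v (int s) * (fir L h T v (int s - j) - c * per T v (int s - j)))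
      = (\<Sum>s<T. \<Sum>l<L. h l * (per T v (int s) * per T v (int s - (j + int l))))
        - c * (\<Sum>s<T. per T v (int s) * per T v (int s - j))"
    by (simp add: fir_def right_diff_distrib sum_subtractf sum_distrib_left mult_ac diff_diff_eq)
  also have "(\<Sum>s<T. \<Sum>l<L. h l * (per T v (int s) * per T v (int s - (j + int l))))
      = (\<Sum>l<L. h l * (\<Sum>s<T. per T v (int s) * per T v (int s - (j + int l))))"
    by (subst sum.swap) (simp add: sum_distrib_left)
  \<comment> \<open>The lags \<open>j + int l\<close> stay between \<open>n - T\<close> and
    \<open>T - n\<close> since \<open>l < L\<close>, \<open>j \<le> n\<close> and
    \<open>2 * n + L \<le> T\<close>.\<close>
  also have "\<dots> = (\<Sum>l<L. h l * ?q (j + int l))"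
    by (intro sum.cong refl arg_cong2[of _ _ _ _ "(*)"] per_autocorr v) (use T j in auto)
  also have "(\<Sum>s<T. per T v (int s) * per T v (int s - j)) = ?q j"
    by (intro per_autocorr v) (use T j in auto)
  finally have R: "(\<Sum>s<T. per T v (int s) * (fir L h T v (int s - j) - c * per T v (int s - j)))
      = (\<Sum>l<L. h l * ?q (j + int l)) - c * ?q j" .
  have "zext (\<lambda>k. y k - c * v k) (int s - j) = (\<Sum>l<B. h l * zext v (int s - (j + int l))) - c * zext v (int s - j)"
    if "s < n" for s
  proof -
    have "zext (\<lambda>k. y k - c * v k) (int s - j) = zext y (int s - j) - c * zext v (int s - j)"
      by (simp add: zext_def)
    also have "zext y (int s - j) = (\<Sum>l<B. h l * zext v (int s - j - int l))"
      by (rule ext_convolution[OF G]) (use that in \<open>auto simp: B_def\<close>)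
    finally show ?thesis by (simp add: diff_diff_eq)
  qed
  then have "(\<Sum>s<n. v s * zext (\<lambda>k. y k - c * v k) (int s - j))
      = (\<Sum>s<n. v s * ((\<Sum>l<B. h l * zext v (int s - (j + int l))) - c * zext v (int s - j)))"
    by simp
  also have "\<dots> = (\<Sum>s<n. \<Sum>l<B. h l * (v s * zext v (int s - (j + int l)))) - c * ?q j"
    by (simp add: autocorr_def right_diff_distrib sum_subtractf sum_distrib_left mult_ac)
  also have "(\<Sum>s<n. \<Sum>l<B. h l * (v s * zext v (int s - (j + int l)))) = (\<Sum>l<B. h l * ?q (j + int l))"
    by (subst sum.swap) (simp add: autocorr_def sum_distrib_left)
  finally have r: "(\<Sum>s<n. v s * zext (\<lambda>k. y k - c * v k) (int s - j))
      = (\<Sum>l<B. h l * ?q (j + int l)) - c * ?q j" .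
  have split: "(\<Sum>l<B. h l * ?q (j + int l)) = (\<Sum>l<L. h l * ?q (j + int l)) + (\<Sum>l\<in>{L..<B}. h l * ?q (j + int l))"
    using sum.atLeastLessThan_concat[of 0 L B "\<lambda>l. h l * ?q (j + int l)"]
    by (simp add: B_def atLeast0LessThan)
  have "\<bar>\<Sum>l\<in>{L..<B}. h l * ?q (j + int l)\<bar> \<le> (\<Sum>l\<in>{L..<B}. \<bar>h l\<bar> * (\<Sum>s<n. (v s)\<^sup>2))"
    by (rule order_trans[OF sum_abs])
      (auto simp: abs_mult intro!: sum_mono mult_left_mono autocorr_bound v)
  also have "\<dots> = (\<Sum>l\<in>{L..<B}. \<bar>h l\<bar>) * (\<Sum>s<n. (v s)\<^sup>2)" by (simp add: sum_distrib_right)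
  also have "\<dots> \<le> \<theta> * (\<Sum>s<n. (v s)\<^sup>2)" by (intro mult_right_mono tail sum_nonneg) auto
  finally show ?thesis unfolding R r split by simp
qed

text \<open>Young's inequality on the cyclic group. The index set \<open>A\<close> is left free
  because both early and late parts of the impulse response will be estimated.\<close>

lemma partial_convolution_energy:
  assumes T: "T > 0" "n \<le> T" and v: "\<And>k. k \<ge> n \<Longrightarrow> v k = 0"
  shows "(\<Sum>s<T. (\<Sum>l\<in>A. h l * per T v (int s + a - int l))\<^sup>2) \<le> (\<Sum>l\<in>A. \<bar>h l\<bar>)\<^sup>2 * (\<Sum>s<n. (v s)\<^sup>2)"
proof -
  let ?H = "\<Sum>l\<in>A. \<bar>h l\<bar>"
  have sq: "(\<Sum>s<T. (per T v (int s + b))\<^sup>2) = (\<Sum>s<n. (v s)\<^sup>2)" for b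
    by (rule sum_per_squares[OF T]) (rule v)
  have "(\<Sum>s<T. (\<Sum>l\<in>A. h l * per T v (int s + a - int l))\<^sup>2)
      \<le> (\<Sum>s<T. ?H * (\<Sum>l\<in>A. \<bar>h l\<bar> * (per T v (int s + a - int l))\<^sup>2))"
    by (intro sum_mono weighted_Cauchy_Schwarz)
  also have "\<dots> = ?H * (\<Sum>s<T. \<Sum>l\<in>A. \<bar>h l\<bar> * (per T v (int s + (a - int l)))\<^sup>2)"
    by (simp add: sum_distrib_left add_diff_eq)
  also have "\<dots> = ?H * (\<Sum>l\<in>A. \<bar>h l\<bar> * (\<Sum>s<T. (per T v (int s + (a - int l)))\<^sup>2))"
    by (subst sum.swap) (simp add: sum_distrib_left)
  also have "\<dots> = ?H\<^sup>2 * (\<Sum>s<n. (v s)\<^sup>2)"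
    by (simp add: sq sum_distrib_right[symmetric] power2_eq_square[of ?H])
  finally show ?thesis .
qed

lemma sum_blocks:
  fixes g :: "nat \<Rightarrow> nat \<Rightarrow> real"
  assumes "T > 0"
  shows "(\<Sum>r<m * T. g (r div T) (r mod T)) = (\<Sum>i<m. \<Sum>s<T. g i s)"
proof -
  have "(\<Sum>r<m * T. g (r div T) (r mod T)) = (\<Sum>i<m. \<Sum>r\<in>{i * T..<i * T + T}. g (r div T) (r mod T))"
    by (rule sum.nat_group[symmetric])
  also have "\<dots> = (\<Sum>i<m. \<Sum>s<T. g i s)"
  proof (rule sum.cong[OF refl])
    fix i
    have "(\<Sum>r\<in>{i * T..<i * T + T}. g (r div T) (r mod T)) = (\<Sum>s\<in>{0..<T}. g ((s + i * T) div T) ((s + i * T) mod T))"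
      using sum.shift_bounds_nat_ivl[of "\<lambda>r. g (r div T) (r mod T)" 0 "i * T" T]
      by (simp add: add.commute)
    then show "(\<Sum>r\<in>{i * T..<i * T + T}. g (r div T) (r mod T)) = (\<Sum>s<T. g i s)"
      using assms by (simp add: atLeast0LessThan)
  qed
  finally show ?thesis .
qed

section \<open>The destabilizing nonlinearity\<close>

definition blocks :: "nat \<Rightarrow> nat \<Rightarrow> (nat \<Rightarrow> nat \<Rightarrow> real) \<Rightarrow> real vec" where
  "blocks m T F = vec (m * T) (\<lambda>r. F (r div T) (r mod T))"

lemma blocks_carrier [simp]: "blocks m T F \<in> carrier_vec (m * T)"
  by (simp add: blocks_def)

lemma blocks_add: "blocks m T F + blocks m T F' = blocks m T (\<lambda>i s. F i s + F' i s)"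
  by (auto simp: blocks_def)

lemma blocks_diff: "blocks m T F - blocks m T F' = blocks m T (\<lambda>i s. F i s - F' i s)"
  by (auto simp: blocks_def)

lemma blocks_smult: "c \<cdot>\<^sub>v blocks m T F = blocks m T (\<lambda>i s. c * F i s)"
  by (auto simp: blocks_def)

lemma scalar_prod_blocks:
  assumes "T > 0"
  shows "scalar_prod (blocks m T F) (blocks m T F') = (\<Sum>i<m. \<Sum>s<T. F i s * F' i s)"
  using sum_blocks[OF assms, of "\<lambda>i s. F i s * F' i s" m]
  by (simp add: scalar_prod_def blocks_def atLeast0LessThan)

lemma interconnectionI:
  assumes "u1 \<in> l2e_vec d" "u2 \<in> l2e_vec d" "e1 \<in> l2e_vec d" "e2 \<in> l2e_vec d"
    and "e2 = (\<lambda>k. G e1 k + u2 k)" and "(e2, \<lambda>k. e1 k - u1 k) \<in> \<Delta>"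
  shows "(\<lambda>k. u1 k @\<^sub>v u2 k, \<lambda>k. e1 k @\<^sub>v e2 k) \<in> interconnection d G \<Delta>"
  unfolding interconnection_def
  by (intro CollectI exI[of _ u1] exI[of _ u2] exI[of _ e1] exI[of _ e2] conjI refl assms)

text \<open>The loop signals are prescribed first and the inputs are solved from the loop equations
  afterwards. The inputs then have to supply only the impulses, the missing past and the truncated
  tail of the response.\<close>

lemma certificate_gain:
  fixes v :: "nat \<Rightarrow> nat \<Rightarrow> real" and c \<epsilon> :: real
  assumes conv: "\<And>w k. G w k = (\<Sum>l\<le>k. h l * w (k - l))"
    and h: "summable (\<lambda>l. \<bar>h l\<bar>)"
    and c: "c = recip \<kappa>" "c \<ge> 0" and eps: "0 < \<epsilon>" "\<epsilon> < 1 / 8"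
    and v: "\<And>i k. k \<ge> n \<Longrightarrow> v i k = 0"
    and E_def: "E = (\<Sum>i<p. \<Sum>s<n. (v i s)\<^sup>2)"
    and cert0: "2 * (\<Sum>i<p. \<Sum>s<n. v i s * (G (v i) s - c * v i s)) > - \<epsilon> * E"
    and cert: "\<And>j. 2 * (\<Sum>i<p. \<Sum>s<n. v i s *
        ((G (v i) s - c * v i s) - zext (\<lambda>k. G (v i) k - c * v i k) (int s - j))) > - \<epsilon> * E"
  shows "\<exists>d\<ge>1. \<exists>\<Delta>\<in>Delta_class d 0 \<kappa>.
           gain (interconnection d (kron_id G d) \<Delta>) \<ge> ereal (1 / sqrt (8 * \<epsilon>))"
proof -
  have "E \<noteq> 0"
  proof
    assume "E = 0"
    then have "v i s = 0" if "i < p" "s < n" for i s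
      using that unfolding E_def by (simp add: sum_nonneg_eq_0_iff sum_nonneg)
    then show False using cert0 \<open>E = 0\<close> by simp
  qed
  moreover have "E \<ge> 0" unfolding E_def by (simp add: sum_nonneg)
  ultimately have E: "E > 0" by simp
  \<comment> \<open>\<open>R_max\<close> spends \<open>\<epsilon> / 2\<close> on the certificate and
    \<open>\<theta>\<close> on each of two correlation errors, in total
    \<open>\<epsilon>\<close>.\<close>
  define \<theta> where "\<theta> = \<epsilon> / 4"
  have \<theta>: "\<theta> > 0" "\<theta>\<^sup>2 \<le> \<epsilon>"
    using eps mult_mono[of \<epsilon> 1 \<epsilon> 1] by (auto simp: \<theta>_def power2_eq_square)
  obtain L where tail: "\<And>B. (\<Sum>l\<in>{L..<B}. \<bar>h l\<bar>) \<le> \<theta>"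
  proof -
    obtain L where "\<forall>m\<ge>L. \<forall>B. norm (\<Sum>l\<in>{m..<B}. \<bar>h l\<bar>) < \<theta>"
      using h \<theta>(1) unfolding summable_Cauchy by blast
    then have "(\<Sum>l\<in>{L..<B}. \<bar>h l\<bar>) \<le> \<theta>" for B
      by (metis abs_ge_self less_imp_le order_refl order_trans real_norm_def)
    then show thesis by (rule that)
  qed
  define H where "H = (\<Sum>l. \<bar>h l\<bar>)"
  have H: "(\<Sum>l\<in>A. \<bar>h l\<bar>) \<le> H" if "finite A" for A
    unfolding H_def by (rule sum_le_suminf[OF h that]) simp
  \<comment> \<open>The length that \<open>periodic_correlation\<close> asks for; the summand 1
    keeps the period positive when \<open>n\<close> and \<open>L\<close> are 0.\<close>
  define T where "T = 2 * n + L + 1"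
  have T: "T > 0" "n \<le> T" "2 * n + L \<le> T" by (auto simp: T_def)

  \<comment> \<open>Cyclic correlations of the periodized signals\<close>
  define z where "z i = (\<lambda>k. G (v i) k - c * v i k)" for i
  define r where "r j = (\<Sum>i<p. \<Sum>s<n. v i s * zext (z i) (int s - j))" for j
  define P where "P i t = per T (v i) t" for i t
  define Q where "Q i t = fir L h T (v i) t" for i t
  define R where "R j = (\<Sum>i<p. \<Sum>s<T. P i (int s) * (Q i (int s - j) - c * P i (int s - j)))" for j
  have P_mod [simp]: "P i (t mod int T) = P i t" for i t by (simp add: P_def)
  have Q_mod [simp]: "Q i (t mod int T) = Q i t" for i t by (simp add: Q_def)
  have P_cong: "P i t = P i t'" if "t mod int T = t' mod int T" for i t t'
    using P_mod that by metis
  have Q_cong: "Q i t = Q i t'" if "t mod int T = t' mod int T" for i t t'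
    using Q_mod that by metis
  have P_energy: "(\<Sum>i<p. \<Sum>s<T. (P i (int s + a))\<^sup>2) = E" for a
    unfolding P_def E_def by (intro sum.cong refl sum_per_squares T v)
  have r0: "r 0 = (\<Sum>i<p. \<Sum>s<n. v i s * z i s)"
    unfolding r_def by (simp add: zext_def)
  have R_r: "\<bar>R j - r j\<bar> \<le> \<theta> * E" if "int n - int T \<le> j" "j \<le> int n" for j
  proof -
    have "\<bar>R j - r j\<bar> \<le> (\<Sum>i<p. \<bar>(\<Sum>s<T. P i (int s) * (Q i (int s - j) - c * P i (int s - j)))
        - (\<Sum>s<n. v i s * zext (z i) (int s - j))\<bar>)"
      unfolding R_def r_def sum_subtractf[symmetric] by (rule sum_abs)
    also have "\<dots> \<le> (\<Sum>i<p. \<theta> * (\<Sum>s<n. (v i s)\<^sup>2))"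
      unfolding P_def Q_def z_def
      by (rule sum_mono, rule periodic_correlation[where n = n and L = L])
        (use conv v tail T that in auto)
    finally show ?thesis by (simp add: E_def sum_distrib_left)
  qed
  have R0: "R 0 \<ge> - (3 / 4) * \<epsilon> * E"
  proof -
    have "2 * r 0 > - \<epsilon> * E" using cert0 by (simp add: r0 z_def)
    moreover have "\<bar>R 0 - r 0\<bar> \<le> \<theta> * E" by (rule R_r) (use T in auto)
    ultimately show ?thesis unfolding \<theta>_def abs_le_iff by simp
  qed
  have R_max: "R j \<le> R 0 + \<epsilon> * E" for j
  proof -
    define a where "a = int T - int n"
    \<comment> \<open>The representative of \<open>j\<close> modulo \<open>T\<close> in the range
      from \<open>n - T\<close> to \<open>n - 1\<close>, where \<open>R_r\<close> applies.\<close>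
    define j' where "j' = (j + a) mod int T - a"
    have bounds: "- a \<le> j'" "j' < int T - a" using T by (auto simp: j'_def)
    have cong: "(t - j) mod int T = (t - j') mod int T" for t
    proof -
      have "(t - j') mod int T = ((t + a) - (j + a) mod int T) mod int T" by (simp add: j'_def algebra_simps)
      also have "\<dots> = ((t + a) - (j + a)) mod int T" by (rule mod_diff_right_eq)
      finally show ?thesis by simp
    qed
    have "R j = R j'"
      unfolding R_def by (simp add: P_cong[OF cong] Q_cong[OF cong])
    moreover have "\<bar>R j' - r j'\<bar> \<le> \<theta> * E" by (rule R_r) (use bounds in \<open>auto simp: a_def\<close>)
    moreover have "\<bar>R 0 - r 0\<bar> \<le> \<theta> * E" by (rule R_r) (use T in auto)
    moreover have "2 * (r 0 - r j') > - \<epsilon> * E"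
      using cert[of j'] unfolding r0 unfolding r_def z_def
      by (simp add: right_diff_distrib sum_subtractf)
    ultimately show ?thesis unfolding \<theta>_def abs_le_iff by simp
  qed

  \<comment> \<open>The extra components carry a periodic impulse of energy \<open>\<epsilon> E\<close>, which lifts the diagonal pairings
    by exactly the amount \<open>\<epsilon> E\<close> by which \<open>R 0\<close> may fail to dominate \<open>R\<close>.\<close>
  define a where "a = sqrt (\<epsilon> * E)"
  have a: "a\<^sup>2 = \<epsilon> * E" using eps E by (simp add: a_def)
  define D where "D t = per T (\<lambda>k. if k = 0 then a else 0) t" for t
  have D_mod [simp]: "D (t mod int T) = D t" for t by (simp add: D_def)
  have D_cong: "D t = D t'" if "t mod int T = t' mod int T" for t t'
    using D_mod that by metis
  have D_energy: "(\<Sum>s<T. (D (int s + b))\<^sup>2) = \<epsilon> * E" for b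
    using sum_per_squares[of T 1 "\<lambda>k. if k = 0 then a else 0" b] T(1) by (simp add: D_def a)
  have D_nz: "t mod int T = 0" if "D t \<noteq> 0" for t
  proof -
    have "nat (t mod int T) = 0" using that by (auto simp: D_def per_def split: if_splits)
    moreover have "t mod int T \<ge> 0" using T(1) by simp
    ultimately show ?thesis by simp
  qed

  \<comment> \<open>Loop signals and external inputs\<close>
  define d where "d = Suc p * T"
  define B where "B = blocks (Suc p) T"
  have Bd: "B F \<in> carrier_vec d" for F unfolding B_def d_def by (rule blocks_carrier)
  have B_prod: "scalar_prod (B F) (B F') = (\<Sum>i<p. \<Sum>s<T. F i s * F' i s) + (\<Sum>s<T. F p s * F' p s)" for F F'
    unfolding B_def scalar_prod_blocks[OF T(1)] by simp
  \<comment> \<open>Block \<open>i < p\<close> of \<open>y k\<close> stacks all \<open>T\<close> cyclic shifts of the periodized signal \<open>v i\<close>; block \<open>p\<close> holds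
    those of the impulse.\<close>
  define y where "y k = B (\<lambda>i s. if i < p then P i (int s + int k) else D (int s + int k))" for k
  define x where "x k = B (\<lambda>i s. if i < p then Q i (int s + int k) - c * P i (int s + int k) else D (int s + int k))" for k
  define e1 where "e1 k = B (\<lambda>i s. if i < p then P i (int s + int k) else 0)" for k
  \<comment> \<open>The argument at which \<open>hull_multi_vertex\<close> yields the value
    \<open>y k\<close>; the two loop equations then determine \<open>u1\<close> and
    \<open>u2\<close>.\<close>
  define e2 where "e2 k = x k + c \<cdot>\<^sub>v y k" for k
  define u1 where "u1 k = e1 k - y k" for k
  define u2 where "u2 k = e2 k - kron_id G d e1 k" for k
  have carrier: "y k \<in> carrier_vec d" "x k \<in> carrier_vec d" "e1 k \<in> carrier_vec d" "e2 k \<in> carrier_vec d"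
    "u1 k \<in> carrier_vec d" "kron_id G d e1 k \<in> carrier_vec d" "u2 k \<in> carrier_vec d" for k
    using Bd by (auto simp: y_def x_def e1_def e2_def u1_def u2_def kron_id_def)
  have e2: "e2 k = B (\<lambda>i s. if i < p then Q i (int s + int k) else (1 + c) * D (int s + int k))" for k
    unfolding e2_def x_def y_def B_def blocks_smult blocks_add
    by (intro arg_cong[of _ _ "blocks (Suc p) T"] ext) (auto simp: algebra_simps)
  have u1: "u1 k = B (\<lambda>i s. if i < p then 0 else - D (int s + int k))" for k
    unfolding u1_def e1_def y_def B_def blocks_diff
    by (intro arg_cong[of _ _ "blocks (Suc p) T"] ext) auto
  \<comment> \<open>Truncated steady-state response minus the true response from rest: the missing
    past while \<open>k < L\<close>, the truncated tail afterwards.\<close>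
  define W where "W k i s = Q i (int s + int k) - (\<Sum>l\<le>k. h l * P i (int s + int k - int l))" for k i s
  have kron: "kron_id G d e1 k = B (\<lambda>i s. if i < p then \<Sum>l\<le>k. h l * P i (int s + int k - int l) else 0)" for k
  proof -
    have "G (\<lambda>t. e1 t $ q) k = (if q div T < p then \<Sum>l\<le>k. h l * P (q div T) (int (q mod T) + int k - int l) else 0)"
      if "q < d" for q
      using that by (simp add: conv e1_def B_def blocks_def d_def algebra_simps)
    then show ?thesis unfolding kron_id_def B_def blocks_def d_def by (intro eq_vecI) auto
  qed
  have u2: "u2 k = B (\<lambda>i s. if i < p then W k i s else (1 + c) * D (int s + int k))" for k
    unfolding u2_def e2 kron B_def blocks_diff W_def
    by (intro arg_cong[of _ _ "blocks (Suc p) T"] ext) auto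

  \<comment> \<open>Pairings and membership in the nonlinearity\<close>
  have yx: "scalar_prod (y k) (x l) = R (int k - int l) + (\<Sum>s<T. D (int s + int k) * D (int s + int l))" for k l
  proof -
    \<comment> \<open>With all \<open>T\<close> shifts stacked, the sum runs over a full period, so
      a common shift of both signals does not change it.\<close>
    have "(\<Sum>s<T. P i (int s + int k) * (Q i (int s + int l) - c * P i (int s + int l)))
        = (\<Sum>s<T. P i (int s) * (Q i (int s - (int k - int l)) - c * P i (int s - (int k - int l))))" for i
    proof -
      let ?m = "int k - int l"
      define g where "g t = P i t * (Q i (t - ?m) - c * P i (t - ?m))" for t
      have m: "(t mod int T - ?m) mod int T = (t - ?m) mod int T" for t
        by (rule mod_diff_left_eq)
      have "g (t mod int T) = g t" for t
        unfolding g_def by (simp only: P_cong[OF m] Q_cong[OF m] P_mod)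
      from sum_periodic_shift[OF T(1), of g "int k", OF this] show ?thesis
        unfolding g_def by simp
    qed
    then show ?thesis unfolding y_def x_def B_prod R_def by simp
  qed
  have y_mod: "y (k mod T) = y k" for k
  proof -
    have m: "(int s + int (k mod T)) mod int T = (int s + int k) mod int T" for s
      by (simp add: zmod_int mod_add_right_eq)
    show ?thesis unfolding y_def P_cong[OF m] D_cong[OF m] ..
  qed
  have yx_self: "scalar_prod (y k) (x k) = R 0 + \<epsilon> * E" for k
    using D_energy[of "int k"] by (simp add: yx power2_eq_square)
  have yx_le: "scalar_prod (y l) (x k) \<le> scalar_prod (y k) (x k)" if l: "l < T" for k l
  proof (cases "l = k mod T")
    case True
    then show ?thesis by (simp add: y_mod)
  next
    case False
    \<comment> \<open>Distinct cyclic shifts of the impulse have disjoint supports, so only the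
      diagonal pairing gains \<open>\<epsilon> * E\<close>.\<close>
    have "D (int s + int l) * D (int s + int k) = 0" for s
    proof (rule ccontr)
      assume "D (int s + int l) * D (int s + int k) \<noteq> 0"
      then have "(int s + int l) mod int T = (int s + int k) mod int T" using D_nz by simp
      then have "(int s + int l - int s) mod int T = (int s + int k - int s) mod int T"
        by (metis mod_diff_left_eq)
      then have "l mod T = k mod T" by (simp add: zmod_int[symmetric])
      then show False using l False by simp
    qed
    then have "scalar_prod (y l) (x k) = R (int l - int k)" unfolding yx by (simp only: sum.neutral_const)
    also have "\<dots> \<le> scalar_prod (y k) (x k)" using R_max by (simp add: yx_self)
    finally show ?thesis .
  qed
  have mem: "(e2 k, y k) \<in> hull_multi d c T y" for k
  proof -
    have "(x k + c \<cdot>\<^sub>v y (k mod T), y (k mod T)) \<in> hull_multi d c T y"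
    proof (rule hull_multi_vertex)
      \<comment> \<open>By \<open>R0\<close> the diagonal pairing
        \<open>R 0 + \<epsilon> * E\<close> is at least \<open>\<epsilon> * E / 4\<close>.\<close>
      show "0 \<le> scalar_prod (y (k mod T)) (x k)"
      proof -
        have "(3 / 4) * \<epsilon> * E \<le> \<epsilon> * E" using eps E by simp
        then show ?thesis unfolding y_mod yx_self using R0 by linarith
      qed
    qed (use carrier T yx_le in \<open>auto simp: y_mod\<close>)
    then show ?thesis by (simp add: y_mod e2_def)
  qed
  define \<Delta> where "\<Delta> = static_relation d (hull_multi d c T y)"
  have \<Delta>: "\<Delta> \<in> Delta_class d 0 \<kappa>"
    unfolding \<Delta>_def Delta_class_def
    using hull_multi_slope[of d \<kappa> T y] hull_multi_total[of c y d T] hull_multi_zero[of y d c T] carrier c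
    by auto
  have inter: "(\<lambda>k. u1 k @\<^sub>v u2 k, \<lambda>k. e1 k @\<^sub>v e2 k) \<in> interconnection d (kron_id G d) \<Delta>"
  proof -
    have "e1 k - u1 k = y k" for k using carrier(1,3)[of k] by (auto simp: u1_def)
    moreover have "e2 = (\<lambda>k. kron_id G d e1 k + u2 k)"
    proof
      fix k show "e2 k = kron_id G d e1 k + u2 k" using carrier(4,6)[of k] by (auto simp: u2_def)
    qed
    ultimately show ?thesis
      unfolding \<Delta>_def static_relation_def
      by (intro interconnectionI) (use mem carrier in \<open>auto simp: l2e_vec_def\<close>)
  qed

  \<comment> \<open>Energy rates of the loop signals and the inputs\<close>
  define \<alpha> where "\<alpha> = (1 + c\<^sup>2) * E / 2"
  have \<alpha>: "\<alpha> > 0" using E by (simp add: \<alpha>_def add_pos_nonneg)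
  have e_energy: "scalar_prod (e1 k @\<^sub>v e2 k) (e1 k @\<^sub>v e2 k) \<ge> \<alpha>" for k
  proof -
    have "scalar_prod (e1 k) (e1 k) = E"
      unfolding e1_def B_prod using P_energy[of "int k"] by (simp add: power2_eq_square)
    \<comment> \<open>Summed form of \<open>q\<^sup>2 \<ge> 2 * c * p * (q - c * p) + c\<^sup>2 *
      p\<^sup>2\<close>, whose mixed term adds up to \<open>R 0\<close>.\<close>
    moreover have "scalar_prod (e2 k) (e2 k) \<ge> 2 * c * R 0 + c\<^sup>2 * E"
    proof -
      have "2 * c * R 0 + c\<^sup>2 * E
          = 2 * c * (scalar_prod (y k) (x k) - (\<Sum>s<T. D (int s + int k) * D (int s + int k)))
            + c\<^sup>2 * (\<Sum>i<p. \<Sum>s<T. (P i (int s + int k))\<^sup>2)"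
        by (simp add: yx P_energy)
      also have "\<dots> = (\<Sum>i<p. \<Sum>s<T. 2 * c * (P i (int s + int k) * (Q i (int s + int k) - c * P i (int s + int k)))
            + c\<^sup>2 * (P i (int s + int k))\<^sup>2)"
        unfolding y_def x_def B_prod by (simp add: sum.distrib sum_distrib_left)
      also have "\<dots> \<le> (\<Sum>i<p. \<Sum>s<T. Q i (int s + int k) * Q i (int s + int k))"
      proof (intro sum_mono)
        fix i s
        show "2 * c * (P i (int s + int k) * (Q i (int s + int k) - c * P i (int s + int k)))
            + c\<^sup>2 * (P i (int s + int k))\<^sup>2 \<le> Q i (int s + int k) * Q i (int s + int k)"
          using zero_le_power2[of "Q i (int s + int k) - c * P i (int s + int k)"]
          by (simp add: power2_eq_square algebra_simps)
      qed
      also have "\<dots> \<le> scalar_prod (e2 k) (e2 k)"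
        unfolding e2 B_prod by (simp add: sum_nonneg)
      finally show ?thesis .
    qed
    \<comment> \<open>As \<open>\<epsilon> < 1 / 8\<close>, a negative \<open>2 * c * R 0\<close>
      costs at most \<open>3 / 32\<close> of \<open>(1 + c\<^sup>2) * E\<close>, so more than half
      remains.\<close>
    moreover have "E + (2 * c * R 0 + c\<^sup>2 * E) \<ge> \<alpha>"
    proof -
      have "c * R 0 \<ge> c * (- (3 / 4) * \<epsilon> * E)" using R0 c by (intro mult_left_mono) auto
      then have 1: "c * R 0 \<ge> - (3 / 4) * (\<epsilon> * (c * E))" by (simp add: mult_ac)
      have 2: "\<epsilon> * (c * E) \<le> 1 / 8 * (c * E)" using eps c E by (intro mult_right_mono) auto
      have "2 * c * E \<le> (1 + c\<^sup>2) * E"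
        using zero_le_power2[of "c - 1"] E by (intro mult_right_mono) (auto simp: power2_eq_square algebra_simps)
      then have 3: "2 * (c * E) \<le> E + c\<^sup>2 * E" by (simp add: algebra_simps)
      have "0 \<le> c * E" using c E by simp
      have "S / 2 \<le> S + 2 * A" if "- (3 / 4) * B \<le> A" "B \<le> 1 / 8 * C" "2 * C \<le> S" "0 \<le> C" for A B C S :: real
        using that by linarith
      from this[OF 1 2 3 \<open>0 \<le> c * E\<close>] show ?thesis
        unfolding \<alpha>_def by (simp add: distrib_right add.assoc add.commute mult.assoc)
    qed
    ultimately show ?thesis
      using carrier[of k] by (subst scalar_prod_append) auto
  qed
  \<comment> \<open>The missing past matters only in the first \<open>L\<close> steps and may be
    bounded crudely by \<open>H\<close>; later only the tail remains, and
    \<open>\<theta>\<^sup>2 \<le> \<epsilon>\<close>.\<close>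
  have W_energy: "(\<Sum>i<p. \<Sum>s<T. (W k i s)\<^sup>2) \<le> \<epsilon> * E + (if k < L then H\<^sup>2 * E else 0)" for k
  proof -
    define A where "A = (if k < L then {Suc k..<L} else {L..<Suc k})"
    have W: "(W k i s)\<^sup>2 = (\<Sum>l\<in>A. h l * per T (v i) (int s + int k - int l))\<^sup>2" for i s
    proof (cases "k < L")
      case True
      have "{..<L} = {..k} \<union> {Suc k..<L}" "{..k} \<inter> {Suc k..<L} = {}" using True by auto
      then show ?thesis
        using True by (simp add: W_def Q_def fir_def P_def A_def sum.union_disjoint)
    next
      case False
      have "{..k} = {..<L} \<union> {L..<Suc k}" "{..<L} \<inter> {L..<Suc k} = {}" using False by auto
      then have "W k i s = - (\<Sum>l\<in>{L..<Suc k}. h l * per T (v i) (int s + int k - int l))"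
        by (simp add: W_def Q_def fir_def P_def sum.union_disjoint del: sum.op_ivl_Suc)
      then show ?thesis using False by (simp only: A_def power2_minus if_False)
    qed
    have "(\<Sum>i<p. \<Sum>s<T. (W k i s)\<^sup>2) \<le> (\<Sum>i<p. (\<Sum>l\<in>A. \<bar>h l\<bar>)\<^sup>2 * (\<Sum>s<n. (v i s)\<^sup>2))"
      unfolding W by (intro sum_mono partial_convolution_energy T v)
    also have "\<dots> = (\<Sum>l\<in>A. \<bar>h l\<bar>)\<^sup>2 * E" by (simp add: E_def sum_distrib_left)
    also have "\<dots> \<le> \<epsilon> * E + (if k < L then H\<^sup>2 * E else 0)"
    proof (cases "k < L")
      case True
      have "(\<Sum>l\<in>A. \<bar>h l\<bar>)\<^sup>2 \<le> H\<^sup>2" by (intro power_mono H sum_nonneg) (auto simp: A_def)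
      then have "(\<Sum>l\<in>A. \<bar>h l\<bar>)\<^sup>2 * E \<le> H\<^sup>2 * E" using E by (intro mult_right_mono) auto
      then show ?thesis using True eps E by (simp add: add_increasing)
    next
      case False
      have "(\<Sum>l\<in>A. \<bar>h l\<bar>)\<^sup>2 \<le> \<theta>\<^sup>2"
        using tail[of "Suc k"] False by (intro power_mono sum_nonneg) (auto simp: A_def)
      then have "(\<Sum>l\<in>A. \<bar>h l\<bar>)\<^sup>2 * E \<le> \<epsilon> * E" using E \<theta>(2) by (intro mult_right_mono) auto
      then show ?thesis using False by simp
    qed
    finally show ?thesis .
  qed
  have u_energy: "scalar_prod (u1 k @\<^sub>v u2 k) (u1 k @\<^sub>v u2 k)
      \<le> \<alpha> * (8 * \<epsilon>) + (if k < L then H\<^sup>2 * E else 0)" for k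
  proof -
    have "scalar_prod (u1 k) (u1 k) = \<epsilon> * E"
      unfolding u1 B_prod using D_energy[of "int k"] by (simp add: power2_eq_square)
    moreover have "scalar_prod (u2 k) (u2 k) = (\<Sum>i<p. \<Sum>s<T. (W k i s)\<^sup>2) + (1 + c)\<^sup>2 * (\<epsilon> * E)"
    proof -
      have "(\<Sum>s<T. (1 + c) * D (int s + int k) * ((1 + c) * D (int s + int k))) = (1 + c)\<^sup>2 * (\<epsilon> * E)"
        unfolding D_energy[of "int k", symmetric] by (simp add: sum_distrib_left power2_eq_square mult_ac)
      then show ?thesis unfolding u2 B_prod by (simp add: power2_eq_square)
    qed
    \<comment> \<open>The source of the constant 8: the impulse in \<open>u1\<close>, the tail in
      \<open>u2\<close> and the impulse in \<open>u2\<close> use at most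
      \<open>4 * (1 + c\<^sup>2)\<close> units of \<open>\<epsilon> * E\<close>, and
      \<open>\<alpha>\<close> is half of \<open>(1 + c\<^sup>2) * E\<close>.\<close>
    moreover have "\<epsilon> * E + (\<epsilon> * E + (1 + c)\<^sup>2 * (\<epsilon> * E)) \<le> \<alpha> * (8 * \<epsilon>)"
    proof -
      have "1 + 1 + (1 + c)\<^sup>2 \<le> 4 * (1 + c\<^sup>2)"
      proof -
        have "4 * (1 + c\<^sup>2) = 1 + 1 + (1 + c)\<^sup>2 + ((c - 1)\<^sup>2 + 2 * c\<^sup>2)"
          by (simp add: power2_eq_square algebra_simps)
        then show ?thesis using zero_le_power2[of "c - 1"] zero_le_power2[of c] by linarith
      qed
      then have "(1 + 1 + (1 + c)\<^sup>2) * (\<epsilon> * E) \<le> 4 * (1 + c\<^sup>2) * (\<epsilon> * E)"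
        using eps E by (intro mult_right_mono) auto
      then show ?thesis by (simp add: \<alpha>_def algebra_simps)
    qed
    ultimately have "scalar_prod (u1 k) (u1 k) + scalar_prod (u2 k) (u2 k)
        \<le> \<alpha> * (8 * \<epsilon>) + (if k < L then H\<^sup>2 * E else 0)"
      using W_energy[of k] by linarith
    then show ?thesis using carrier[of k] by (subst scalar_prod_append) auto
  qed
  have "gain (interconnection d (kron_id G d) \<Delta>) \<ge> ereal (1 / sqrt (8 * \<epsilon>))"
  proof (rule gain_lower_bound[OF inter \<alpha>])
    fix N
    show "\<alpha> * real (Suc N) \<le> (\<Sum>k\<le>N. scalar_prod (e1 k @\<^sub>v e2 k) (e1 k @\<^sub>v e2 k))"
      using sum_mono[of "{..N}" "\<lambda>_. \<alpha>", OF e_energy] by (simp add: mult.commute)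
    have "(\<Sum>k\<le>N. scalar_prod (u1 k @\<^sub>v u2 k) (u1 k @\<^sub>v u2 k))
        \<le> (\<Sum>k\<le>N. \<alpha> * (8 * \<epsilon>) + (if k < L then H\<^sup>2 * E else 0))"
      by (intro sum_mono u_energy)
    also have "\<dots> = \<alpha> * (8 * \<epsilon>) * real (Suc N) + (\<Sum>k\<in>{..N} \<inter> {..<L}. H\<^sup>2 * E)"
      unfolding sum.inter_restrict[OF finite_atMost] by (simp add: sum.distrib mult.commute)
    \<comment> \<open>The transient is confined to \<open>L\<close> time steps, so its total is
      bounded independently of \<open>N\<close>.\<close>
    also have "(\<Sum>k\<in>{..N} \<inter> {..<L}. H\<^sup>2 * E) \<le> (\<Sum>k\<in>{..<L}. H\<^sup>2 * E)"
      by (intro sum_mono2) (use E in auto)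
    finally show "(\<Sum>k\<le>N. scalar_prod (u1 k @\<^sub>v u2 k) (u1 k @\<^sub>v u2 k))
        \<le> \<alpha> * (8 * \<epsilon>) * real (Suc N) + (\<Sum>k\<in>{..<L}. H\<^sup>2 * E)" by simp
  qed (use eps in simp)
  moreover have "d \<ge> 1" using T by (simp add: d_def)
  ultimately show ?thesis using \<Delta> by blast
qed

text \<open>The bound is at most 1 here, and the zero nonlinearity already has gain at least 1: with
  \<open>u1 = 0\<close> and \<open>e1 = 0\<close>, a constant \<open>u2\<close> reaches
  \<open>e2\<close> unchanged.\<close>

lemma gain_at_least_one:
  assumes lin: "linear_system G" and eps: "\<epsilon> \<ge> 1 / 8"
  shows "\<exists>d\<ge>1. \<exists>\<Delta>\<in>Delta_class d 0 \<kappa>.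
           gain (interconnection d (kron_id G d) \<Delta>) \<ge> ereal (1 / sqrt (8 * \<epsilon>))"
proof -
  define f where "f = {(w :: real vec, 0\<^sub>v 1 :: real vec) | w. w \<in> carrier_vec 1}"
  define \<Delta> where "\<Delta> = static_relation 1 f"
  define o1 where "o1 k = (0\<^sub>v 1 :: real vec)" for k :: nat
  define j1 where "j1 k = vec 1 (\<lambda>_. 1 :: real)" for k :: nat
  have T: "T_multi 0 \<kappa> f \<subseteq> carrier_vec 1 \<times> {0\<^sub>v 1}"
    unfolding T_multi_def f_def by auto
  have "cyclically_monotone (T_multi 0 \<kappa> f)"
  proof (rule cyclically_monotone_maximal_pairing[where d = 1])
    show "scalar_prod u' x \<le> scalar_prod u x"
      if "(x, u) \<in> T_multi 0 \<kappa> f" "(x', u') \<in> T_multi 0 \<kappa> f" for x u x' u'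
    proof -
      have "u = 0\<^sub>v 1" "u' = 0\<^sub>v 1" using T that by auto
      then show ?thesis by simp
    qed
  qed (use T in auto)
  then have "f \<in> slope 1 0 \<kappa>" by (auto simp: slope_def f_def)
  moreover have "total_multi 1 f" "(0\<^sub>v 1, 0\<^sub>v 1) \<in> f" by (auto simp: total_multi_def f_def)
  ultimately have "\<Delta> \<in> Delta_class 1 0 \<kappa>"
    unfolding \<Delta>_def Delta_class_def by blast
  moreover have "gain (interconnection 1 (kron_id G 1) \<Delta>) \<ge> ereal (1 / sqrt (8 * \<epsilon>))"
  proof (rule gain_lower_bound[where \<alpha> = 1 and B = 0])
    have "G (\<lambda>t. 0) = (\<lambda>_. 0)"
      using linear_system_sum[OF lin, of "{}"] by simp
    then have "kron_id G 1 o1 k = 0\<^sub>v 1" for k by (auto simp: kron_id_def o1_def)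
    then have eq: "j1 = (\<lambda>k. kron_id G 1 o1 k + j1 k)" by (auto simp: j1_def)
    have mem: "(j1, \<lambda>k. o1 k - o1 k) \<in> \<Delta>"
      unfolding \<Delta>_def static_relation_def f_def l2e_vec_def by (auto simp: o1_def j1_def)
    show "(\<lambda>k. o1 k @\<^sub>v j1 k, \<lambda>k. o1 k @\<^sub>v j1 k) \<in> interconnection 1 (kron_id G 1) \<Delta>"
      by (rule interconnectionI[of _ 1 _ _ _ "kron_id G 1", OF _ _ _ _ eq mem]) (auto simp: l2e_vec_def o1_def j1_def)
    have j: "scalar_prod (o1 k @\<^sub>v j1 k) (o1 k @\<^sub>v j1 k) = 1" for k
      by (subst scalar_prod_append[of _ 1 _ 1]) (auto simp: o1_def j1_def scalar_prod_def)
    show "(\<Sum>k\<le>N. scalar_prod (o1 k @\<^sub>v j1 k) (o1 k @\<^sub>v j1 k)) \<le> 1 * (8 * \<epsilon>) * real (Suc N) + 0" for N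
      unfolding j using mult_right_mono[of 1 "8 * \<epsilon>" "real (Suc N)"] eps by simp
    show "1 * real (Suc N) \<le> (\<Sum>k\<le>N. scalar_prod (o1 k @\<^sub>v j1 k) (o1 k @\<^sub>v j1 k))" for N
      unfolding j by simp
  qed (use eps in auto)
  ultimately show ?thesis by blast
qed

theorem theorem4:
  fixes \<kappa> :: ereal and G :: "(nat \<Rightarrow> real) \<Rightarrow> nat \<Rightarrow> real" and \<epsilon> :: real
  assumes "0 < \<kappa>"
    and "linear_system G" and "time_invariant G" and "causal G" and "l2_bounded G"
    and "finite_dim_realizable G"
    and "0 < \<epsilon>"
    and "\<not> (\<exists>M\<in>multipliers1. \<forall>w\<in>l2.
           l2_inner_pair (G w, w) (Pi_mult M 0 \<kappa> (G w, w)) \<le> - \<epsilon> * (l2_norm w)\<^sup>2)"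
  shows "\<exists>d\<ge>1. \<exists>\<Delta>\<in>Delta_class d 0 \<kappa>.
           gain (interconnection d (kron_id G d) \<Delta>) \<ge> ereal (1 / sqrt (8 * \<epsilon>))"
proof (cases "\<epsilon> < 1 / 8")
  case True
  have c: "recip \<kappa> \<ge> 0" using \<open>0 < \<kappa>\<close> by (cases \<kappa>) (auto simp: one_ereal_def)
  obtain p n and v :: "nat \<Rightarrow> nat \<Rightarrow> real" where v: "\<And>i k. k \<ge> n \<Longrightarrow> v i k = 0"
    and cert0: "2 * (\<Sum>i<p. \<Sum>s<n. v i s * (G (v i) s - recip \<kappa> * v i s)) > - \<epsilon> * (\<Sum>i<p. \<Sum>s<n. (v i s)\<^sup>2)"
    and cert: "\<And>j. 2 * (\<Sum>i<p. \<Sum>s<n. v i s *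
        ((G (v i) s - recip \<kappa> * v i s) - zext (\<lambda>k. G (v i) k - recip \<kappa> * v i k) (int s - j)))
      > - \<epsilon> * (\<Sum>i<p. \<Sum>s<n. (v i s)\<^sup>2)"
    by (rule dual_certificate[OF assms(2,5,8) refl]) blast
  show ?thesis
    by (rule certificate_gain[OF convolution_representation[OF assms(2-4)]
          impulse_response_summable[OF assms(6,5)] refl c assms(7) True v refl cert0 cert])
next
  case False
  then show ?thesis using gain_at_least_one[OF assms(2)] by simp
qed

end
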